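(* Let $m\le n$ and let $u\in C^n\big(\overline{\mathbf{I}(m,n)}\big)$ be invariant harmonic in $\mathbf{I}(m,n)$. Then $$\frac{\partial^2u}{\partial z_{j\alpha}\partial\bar z_{k\beta}}(0)=0,\qquad 1\le j,k\le m,\ 1\le\alpha,\beta\le n.$$
   Context: $\mathbf{I}(m,n)=\{\mathbf{z}=[z_{j\alpha}]\in M^{m,n}(\mathbb{C}): I_m-\mathbf{z}\mathbf{z}^*>0\}$. A function $u$ is invariant harmonic in a bounded domain $D$ if $\Delta_{g^D}u=0$ in $D$, where $\Delta_{g^D}$ is the Laplace–Beltrami operator of the Bergman metric of $D$; for $\mathbf{I}(m,n)$ this is (a constant multiple of) $\sum_{j,k=1}^m(\delta_{jk}-\sum_\ell z_{j\ell}\bar z_{k\ell})\sum_{\alpha,\beta=1}^n(\delta_{\alpha\beta}-\sum_{\ell=1}^mz_{\ell\alpha}\bar z_{\ell\beta})\frac{\partial^2}{\partial z_{j\alpha}\partial\bar z_{k\beta}}$. *)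

theory Defs
  imports "HOL-Analysis.Analysis"
begin

text \<open>Matrices z = [z_{j alpha}] in M^{m,n}(C) are elements of complex^'n^'m
  (row index j :: 'm, column index alpha :: 'n); entry z_{j alpha} is z $ j $ alpha.\<close>

definition cstar :: "complex^'n^'m \<Rightarrow> complex^'m^'n" where
  "cstar z = (\<chi> a j. cnj (z $ j $ a))"

definition pos_def_herm :: "complex^'m^'m \<Rightarrow> bool" where
  "pos_def_herm A \<longleftrightarrow>
     (\<forall>i j. A $ i $ j = cnj (A $ j $ i)) \<and>
     (\<forall>w::complex^'m. w \<noteq> 0 \<longrightarrow>
        0 < Re (\<Sum>i\<in>UNIV. \<Sum>j\<in>UNIV. cnj (w $ i) * A $ i $ j * w $ j))"

definition Imn :: "(complex^'n^'m) set" where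
  "Imn = {z. pos_def_herm (mat 1 - z ** cstar z)}"

fun dd :: "('a::real_normed_vector) list \<Rightarrow> ('a \<Rightarrow> 'b::real_normed_vector) \<Rightarrow> 'a \<Rightarrow> 'b" where
  "dd [] f = f"
| "dd (v # vs) f = (\<lambda>z. frechet_derivative (dd vs f) (at z) v)"

definition Ck_on :: "nat \<Rightarrow> ('a::real_normed_vector) set \<Rightarrow> ('a \<Rightarrow> 'b::real_normed_vector) \<Rightarrow> bool" where
  "Ck_on k D f \<longleftrightarrow>
     (\<forall>vs. length vs \<le> k \<longrightarrow> continuous_on D (dd vs f) \<and>
        (length vs < k \<longrightarrow> (\<forall>z\<in>D. dd vs f differentiable (at z))))"

definition Ck_closure :: "nat \<Rightarrow> ('a::real_normed_vector) set \<Rightarrow> ('a \<Rightarrow> 'b::real_normed_vector) \<Rightarrow> bool" where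
  "Ck_closure k D f \<longleftrightarrow> Ck_on k D f \<and> continuous_on (closure D) f \<and>
     (\<forall>vs. length vs \<le> k \<longrightarrow>
        (\<exists>g. continuous_on (closure D) g \<and> (\<forall>z\<in>D. g z = dd vs f z)))"

definition Emat :: "'m \<Rightarrow> 'n \<Rightarrow> complex \<Rightarrow> complex^'n^'m" where
  "Emat j a c = (\<chi> r s. if r = j \<and> s = a then c else 0)"

definition wdz :: "'m \<Rightarrow> 'n \<Rightarrow> (complex^'n^'m \<Rightarrow> complex) \<Rightarrow> complex^'n^'m \<Rightarrow> complex" where
  "wdz j a f = (\<lambda>z. (dd [Emat j a 1] f z - \<i> * dd [Emat j a \<i>] f z) / 2)"

definition wdzbar :: "'m \<Rightarrow> 'n \<Rightarrow> (complex^'n^'m \<Rightarrow> complex) \<Rightarrow> complex^'n^'m \<Rightarrow> complex" where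
  "wdzbar j a f = (\<lambda>z. (dd [Emat j a 1] f z + \<i> * dd [Emat j a \<i>] f z) / 2)"

text \<open>Laplace-Beltrami operator of the Bergman metric of I(m,n) (up to a constant factor).\<close>
definition LB :: "(complex^'n^'m \<Rightarrow> complex) \<Rightarrow> complex^'n^'m \<Rightarrow> complex" where
  "LB u z = (\<Sum>j\<in>UNIV. \<Sum>k\<in>UNIV.
      ((if j = k then 1 else 0) - (\<Sum>l\<in>UNIV. z $ j $ l * cnj (z $ k $ l))) *
      (\<Sum>a\<in>UNIV. \<Sum>b\<in>UNIV.
         ((if a = b then 1 else 0) - (\<Sum>l\<in>UNIV. z $ l $ a * cnj (z $ l $ b))) *
         wdz j a (wdzbar k b u) z))"

definition inv_harmonic :: "(complex^'n^'m \<Rightarrow> complex) \<Rightarrow> bool" where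
  "inv_harmonic u \<longleftrightarrow> Ck_on 2 Imn u \<and> (\<forall>z\<in>Imn. LB u z = 0)"

end

theory Submission
  imports Defs "HOL-Probability.Probability" "HOL-Computational_Algebra.Polynomial"
begin

text \<open>Averaging a harmonic function over \<open>z \<mapsto> z B\<close>, with \<open>B\<close> in the unitary group and the Haar
  measure weighted by \<open>|\<langle>x, B e\<^sub>c\<rangle>|\<^sup>2\<close>, gives a harmonic function on the closed matrix ball. By a maximum
  principle it is determined by its values on the Shilov boundary, and these turn out to be a constant
  independent of the unit vector \<open>x\<close>. For \<open>m < n\<close> one restricts to a ball of dimension
  \<open>n - m + 1\<close> in the boundary: there the average satisfies a hypergeometric equation whose nonconstant
  solutions have a logarithmic term, which the smoothness up to the boundary excludes. For \<open>m = n\<close> the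
  average is harmonic on discs \<open>w \<mapsto> z (1 + (w - 1) b b\<^sup>*)\<close> in the boundary, which determines its radial
  derivatives \<open>z b b\<^sup>*\<close> at \<open>z\<close>; linearity of the derivative then forces the values to agree.

  Once the weighted averages are constant, their second derivatives at the center vanish. By the fourth
  moments of a unit vector this is an invertible linear system for the values of the operator
  \<open>Lam\<close> on matrices of rank one, and polarization yields all mixed second derivatives.\<close>

subsection \<open>Conjugate transposes and unitary matrices\<close>

text \<open>The operator degenerates at the boundary: where \<open>mat 1 - z ** cstar z\<close>
  loses rank, only directions inside a boundary piece keep a nonzero coefficient. Extended by
  continuity to the closed ball, the equation thus restricts to each ball or disc in the boundary;
  this is why functions are replaced by families of derivatives that are continuous up to the
  boundary. An average without weight is invariant under z \<mapsto> z B and at the center yields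
  only a sum over columns; the weight of bidegree (1,1) separates the columns. On the boundary ball
  of dimension N = n - m + 1 the exceptional solution contains s^N log s with s = 1 - r^2, which is
  not C^N at s = 0. For m = 1 one has N = n, hence the class C^n. For m = n the ball is a disc and
  leaves no second axis to compare with, so radial derivatives of several discs through one point
  are compared instead. For n = 1 no second derivatives are available on the closure, and that case
  is read off from the operator at 0.\<close>

definition cip :: "complex^'n \<Rightarrow> complex^'n \<Rightarrow> complex" where
  "cip x y = (\<Sum>i\<in>UNIV. cnj (x$i) * y$i)"

definition unitary :: "complex^'n^'n \<Rightarrow> bool" where
  "unitary U \<longleftrightarrow> cstar U ** U = mat 1 \<and> U ** cstar U = mat 1"

lemma cstar_nth [simp]: "cstar z $ a $ j = cnj (z $ j $ a)"
  by (simp add: cstar_def)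

lemma cstar_cstar [simp]: "cstar (cstar z) = z"
  by (simp add: vec_eq_iff)

lemma cstar_mult: "cstar (A ** B) = cstar B ** cstar A"
  by (simp add: vec_eq_iff matrix_matrix_mult_def mult.commute)

lemma cstar_mat [simp]: "cstar (mat 1) = mat 1"
  by (auto simp: vec_eq_iff mat_def)

lemma cstar_diff: "cstar (A - B) = cstar A - cstar B"
  by (auto simp: vec_eq_iff)

lemma cstar_scaleR: "cstar (c *\<^sub>R A) = c *\<^sub>R cstar A"
  by (auto simp: vec_eq_iff)

lemma cstar_add: "cstar (A + B) = cstar A + cstar B"
  by (auto simp: vec_eq_iff)

lemma unitary_cstar [simp]: "unitary (cstar U) \<longleftrightarrow> unitary U"
  by (auto simp: unitary_def)

lemma unitary_mat [simp]: "unitary (mat 1)"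
  by (simp add: unitary_def)

lemma unitary_mult: "unitary U \<Longrightarrow> unitary V \<Longrightarrow> unitary (U ** V)"
  unfolding unitary_def cstar_mult
  by (metis matrix_mul_assoc matrix_mul_rid)

lemma unitaryI: "cstar U ** U = mat 1 \<Longrightarrow> unitary U"
  using matrix_left_right_inverse unitary_def by blast

lemma norm_vec_sq: "(norm (x::'a::real_normed_vector^'n))\<^sup>2 = (\<Sum>i\<in>UNIV. (norm (x$i))\<^sup>2)"
  by (simp add: norm_vec_def L2_set_def sum_nonneg)

lemma cip_self: "cip x x = of_real ((norm x)\<^sup>2)"
  by (simp add: cip_def norm_vec_sq complex_norm_square mult.commute del: of_real_power)

lemma cip_adj: "cip (cstar A *v x) y = cip x (A *v y)"
proof -
  have "cip (cstar A *v x) y = (\<Sum>i\<in>UNIV. \<Sum>j\<in>UNIV. A$j$i * cnj (x$j) * y$i)"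
    by (simp add: cip_def matrix_vector_mult_def sum_distrib_right)
  also have "\<dots> = (\<Sum>j\<in>UNIV. \<Sum>i\<in>UNIV. A$j$i * cnj (x$j) * y$i)"
    by (rule sum.swap)
  also have "\<dots> = cip x (A *v y)"
    by (simp add: cip_def matrix_vector_mult_def sum_distrib_left mult_ac)
  finally show ?thesis .
qed

lemma unitary_norm_mv: assumes "unitary U" shows "norm (U *v x) = norm x"
proof -
  have "cip (U *v x) (U *v x) = cip (cstar U *v (U *v x)) x"
    by (simp add: cip_adj)
  also have "\<dots> = cip x x"
    using assms by (simp add: unitary_def matrix_vector_mul_assoc)
  finally have "of_real ((norm (U *v x))\<^sup>2) = (of_real ((norm x)\<^sup>2) :: complex)"
    by (simp only: cip_self)
  then have "(norm (U *v x))\<^sup>2 = (norm x)\<^sup>2" by (simp only: of_real_eq_iff)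
  then show ?thesis by simp
qed

lemma norm_mat_cols: "(norm (X::complex^'n^'m))\<^sup>2 = (\<Sum>a\<in>UNIV. (norm (column a X))\<^sup>2)"
  by (simp add: norm_vec_sq column_def) (rule sum.swap)

lemma norm_cstar [simp]: "norm (cstar X) = norm X"
proof -
  have "(norm (cstar X))\<^sup>2 = (norm X)\<^sup>2"
    by (simp add: norm_vec_sq) (rule sum.swap)
  then show ?thesis by simp
qed

lemma column_mult: "column a (U ** X) = U *v column a X"
  by (simp add: column_def vec_eq_iff matrix_matrix_mult_def matrix_vector_mult_def)

lemma unitary_norm_left: "unitary U \<Longrightarrow> norm (U ** X) = norm X"
proof -
  assume "unitary U"
  then have "(norm (U ** X))\<^sup>2 = (norm X)\<^sup>2"
    by (simp add: norm_mat_cols column_mult unitary_norm_mv)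
  then show ?thesis by simp
qed

lemma unitary_norm_right: "unitary U \<Longrightarrow> norm (X ** U) = norm X"
  by (metis cstar_mult norm_cstar unitary_cstar unitary_norm_left)

text \<open>The norm on matrices is the Frobenius norm; Cauchy-Schwarz on each row gives the
  bound.\<close>

lemma norm_mv_le: "norm (A *v x) \<le> norm A * norm (x::complex^'n)" for A :: "complex^'n^'m"
proof -
  have "norm ((A *v x) $ j) \<le> norm (A$j) * norm x" for j
  proof -
    have "norm ((A *v x) $ j) \<le> (\<Sum>i\<in>UNIV. norm (A$j$i) * norm (x$i))"
      by (simp add: matrix_vector_mult_def sum_norm_le norm_mult)
    also have "\<dots> \<le> norm (A$j) * norm x"
      using L2_set_mult_ineq[of "\<lambda>i. norm (A$j$i)" "\<lambda>i. norm (x$i)" UNIV] by (simp add: norm_vec_def)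
    finally show ?thesis .
  qed
  then have "(norm (A *v x))\<^sup>2 \<le> (\<Sum>j\<in>UNIV. (norm (A$j) * norm x)\<^sup>2)"
    unfolding norm_vec_sq[of "A *v x"] by (intro sum_mono power_mono) auto
  also have "\<dots> = (norm A * norm x)\<^sup>2"
    by (simp add: norm_vec_sq[of A] power_mult_distrib sum_distrib_right)
  finally show ?thesis by (rule power2_le_imp_le) simp
qed

lemma norm_mm_le: "norm (A ** B) \<le> norm A * norm B" for A :: "complex^'n^'m" and B :: "complex^'k^'n"
proof -
  have "(norm (A ** B))\<^sup>2 \<le> (\<Sum>a\<in>UNIV. (norm A * norm (column a B))\<^sup>2)"
    unfolding norm_mat_cols[of "A ** B"] column_mult by (intro sum_mono power_mono norm_mv_le) auto
  also have "\<dots> = (norm A * norm B)\<^sup>2"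
    by (simp add: norm_mat_cols[of B] power_mult_distrib sum_distrib_left)
  finally show ?thesis by (rule power2_le_imp_le) simp
qed

lemma bounded_linear_mm_left: "bounded_linear (\<lambda>A. A ** B)" for B :: "complex^'k^'n"
  by (intro linear_conv_bounded_linear[THEN iffD1] linearI)
    (simp_all add: vec_eq_iff matrix_matrix_mult_def distrib_right sum.distrib scaleR_sum_right)

lemma bounded_linear_mm_right: "bounded_linear (\<lambda>B. A ** B)" for A :: "complex^'k^'n"
  by (intro linear_conv_bounded_linear[THEN iffD1] linearI)
    (simp_all add: vec_eq_iff matrix_matrix_mult_def distrib_left sum.distrib scaleR_sum_right)

lemma continuous_on_mm [continuous_intros]:
  fixes f :: "'a::topological_space \<Rightarrow> complex^'k^'n" and g :: "'a \<Rightarrow> complex^'l^'k"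
  assumes "continuous_on S f" "continuous_on S g"
  shows "continuous_on S (\<lambda>x. f x ** g x)"
  unfolding matrix_matrix_mult_def
  by (intro continuous_intros assms)

lemma continuous_on_cstar [continuous_intros]:
  fixes f :: "'a::topological_space \<Rightarrow> complex^'k^'n"
  assumes "continuous_on S f"
  shows "continuous_on S (\<lambda>x. cstar (f x))"
  unfolding cstar_def
  by (intro continuous_intros assms)

lemma tendsto_mm [tendsto_intros]:
  fixes f :: "'a \<Rightarrow> complex^'k^'n" and g :: "'a \<Rightarrow> complex^'l^'k"
  assumes "(f \<longlongrightarrow> a) F" "(g \<longlongrightarrow> b) F"
  shows "((\<lambda>x. f x ** g x) \<longlongrightarrow> a ** b) F"
  unfolding matrix_matrix_mult_def by (intro tendsto_intros assms)

lemma tendsto_cstar [tendsto_intros]: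
  fixes f :: "'a \<Rightarrow> complex^'k^'n"
  assumes "(f \<longlongrightarrow> a) F"
  shows "((\<lambda>x. cstar (f x)) \<longlongrightarrow> cstar a) F"
  unfolding cstar_def by (intro tendsto_intros assms)

lemmas mm_distribs =
  linear_diff[OF bounded_linear.linear[OF bounded_linear_mm_left]] linear_add[OF bounded_linear.linear[OF bounded_linear_mm_left]]
  linear_diff[OF bounded_linear.linear[OF bounded_linear_mm_right]] linear_add[OF bounded_linear.linear[OF bounded_linear_mm_right]]
  linear_scale[OF bounded_linear.linear[OF bounded_linear_mm_left]] linear_scale[OF bounded_linear.linear[OF bounded_linear_mm_right]]

subsection \<open>Haar measure on the unitary group\<close>

lemma nn_integral_lborel_shift:
  fixes c :: "'a::euclidean_space"
  assumes [measurable]: "g \<in> borel_measurable borel"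
  shows "(\<integral>\<^sup>+x. g (c + x) \<partial>lborel) = (\<integral>\<^sup>+x. g x \<partial>lborel)"
  by (subst (2) lborel_distr_plus[of c, symmetric]) (simp add: nn_integral_distr)

text \<open>Uniqueness of translation invariant measures: integrate \<open>g (f x) * h (y - f x)\<close> in both
  orders, with \<open>h\<close> the indicator of the unit ball.\<close>

lemma distr_lborel_isometry:
  fixes f :: "'a::euclidean_space \<Rightarrow> 'a"
  assumes lin: "linear f" and iso: "\<And>x. norm (f x) = norm x"
  shows "distr lborel borel f = lborel"
proof -
  have [measurable]: "f \<in> borel_measurable borel"
    using lin linear_continuous_on linear_conv_bounded_linear borel_measurable_continuous_onI by blast
  have inj: "inj f"
    using lin iso by (simp add: linear_injective_0) (metis norm_eq_zero)
  then obtain f' where f': "\<And>y. f (f' y) = y"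
    using linear_injective_imp_surjective[OF lin] by (metis surjD)
  have add: "f (x + y) = f x + f y" for x y
    using lin by (rule linear_add)
  define h :: "'a \<Rightarrow> ennreal" where "h = indicator (cball 0 1)"
  have hm [measurable]: "h \<in> borel_measurable borel" unfolding h_def by (intro borel_measurable_indicator) simp
  have h: "h (- f x) = h x" for x by (simp add: h_def indicator_def iso)
  have key: "(\<integral>\<^sup>+x. g (f x) \<partial>lborel) = (\<integral>\<^sup>+x. g x \<partial>lborel)"
    if [measurable]: "g \<in> borel_measurable borel" for g
  proof -
    have "(\<integral>\<^sup>+x. g (f x) \<partial>lborel) * (\<integral>\<^sup>+y. h y \<partial>lborel) = (\<integral>\<^sup>+x. g (f x) * (\<integral>\<^sup>+y. h y \<partial>lborel) \<partial>lborel)"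
      by (simp add: nn_integral_multc)
    also have "\<dots> = (\<integral>\<^sup>+x. g (f x) * (\<integral>\<^sup>+y. h (- f x + y) \<partial>lborel) \<partial>lborel)"
      by (simp only: nn_integral_lborel_shift[OF hm])
    also have "\<dots> = (\<integral>\<^sup>+x. (\<integral>\<^sup>+y. g (f x) * h (- f x + y) \<partial>lborel) \<partial>lborel)"
      by (simp add: nn_integral_cmult)
    also have "\<dots> = (\<integral>\<^sup>+y. (\<integral>\<^sup>+x. g (f x) * h (- f x + y) \<partial>lborel) \<partial>lborel)"
      by (rule lborel_pair.Fubini') measurable
    \<comment> \<open>Substituting \<open>f' y + x\<close> for \<open>x\<close> turns
      \<open>f x\<close> into \<open>y + f x\<close>, so that \<open>y\<close> drops out of the
      argument of \<open>h\<close>.\<close>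
    also have "\<dots> = (\<integral>\<^sup>+y. (\<integral>\<^sup>+x. g (f (f' y + x)) * h (- f (f' y + x) + y) \<partial>lborel) \<partial>lborel)"
      by (subst nn_integral_lborel_shift) auto
    also have "\<dots> = (\<integral>\<^sup>+y. (\<integral>\<^sup>+x. g (f x + y) * h (- f x) \<partial>lborel) \<partial>lborel)"
      by (simp add: add f' add.commute)
    also have "\<dots> = (\<integral>\<^sup>+x. (\<integral>\<^sup>+y. g (f x + y) * h (- f x) \<partial>lborel) \<partial>lborel)"
      by (rule lborel_pair.Fubini') measurable
    also have "\<dots> = (\<integral>\<^sup>+x. (\<integral>\<^sup>+y. g (f x + y) \<partial>lborel) * h (- f x) \<partial>lborel)"
      by (simp add: nn_integral_multc)
    also have "\<dots> = (\<integral>\<^sup>+x. (\<integral>\<^sup>+y. g y \<partial>lborel) * h x \<partial>lborel)"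
      by (simp add: nn_integral_lborel_shift h)
    also have "\<dots> = (\<integral>\<^sup>+x. g x \<partial>lborel) * (\<integral>\<^sup>+y. h y \<partial>lborel)"
      by (simp add: nn_integral_cmult)
    finally have eq: "(\<integral>\<^sup>+y. h y \<partial>lborel) * (\<integral>\<^sup>+x. g (f x) \<partial>lborel)
        = (\<integral>\<^sup>+y. h y \<partial>lborel) * (\<integral>\<^sup>+x. g x \<partial>lborel)"
      by (simp add: mult.commute)
    have hv: "(\<integral>\<^sup>+y. h y \<partial>lborel) = emeasure lborel (cball (0::'a) 1)"
      by (simp add: h_def)
    have "emeasure lborel (cball (0::'a) 1) \<noteq> 0" "emeasure lborel (cball (0::'a) 1) \<noteq> \<infinity>"
      using emeasure_lborel_cball_finite[of "0::'a" 1] 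
      using less_imp_neq[OF unit_ball_vol_pos[of "real DIM('a)"]] by (auto simp: emeasure_cball)
    then show ?thesis
      using eq unfolding hv by (simp add: ennreal_mult_cancel_left)
  qed
  show ?thesis
  proof (rule measure_eqI)
    fix A assume "A \<in> sets (distr lborel borel f)"
    then have [measurable]: "A \<in> sets borel" by simp
    have "emeasure (distr lborel borel f) A = (\<integral>\<^sup>+x. indicator A x \<partial>distr lborel borel f)"
      by simp
    also have "\<dots> = (\<integral>\<^sup>+x. indicator A (f x) \<partial>lborel)"
      by (subst nn_integral_distr) auto
    also have "\<dots> = emeasure lborel A"
      using key[of "indicator A"] by simp
    finally show "emeasure (distr lborel borel f) A = emeasure lborel A" .
  qed simp
qed

section \<open>An equivariant retraction onto the unitary group\<close>

definition defect :: "complex^'n^'n \<Rightarrow> complex^'n^'n" where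
  "defect X = mat 1 - X ** cstar X"

text \<open>The Newton-Schulz iteration for the unitary factor of the polar decomposition; it commutes with
  multiplication by unitary matrices on either side.\<close>

definition nstep :: "complex^'n^'n \<Rightarrow> complex^'n^'n" where
  "nstep X = X + (1/2) *\<^sub>R (defect X ** X)"

lemma defect_equiv:
  assumes "unitary U" "unitary V"
  shows "defect (U ** X ** V) = U ** defect X ** cstar U"
proof -
  have *: "U ** X ** V ** (cstar V ** (cstar X ** cstar U)) = U ** X ** (V ** cstar V) ** (cstar X ** cstar U)"
    by (simp add: matrix_mul_assoc)
  show ?thesis
    using assms unfolding defect_def cstar_mult unitary_def *
    by (simp add: mm_distribs matrix_mul_assoc)
qed

lemma nstep_equiv:
  assumes "unitary U" "unitary V"
  shows "nstep (U ** X ** V) = U ** nstep X ** V"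
proof -
  have "U ** defect X ** cstar U ** (U ** X ** V) = U ** defect X ** (cstar U ** U) ** X ** V"
    by (simp add: matrix_mul_assoc)
  then show ?thesis
    using assms(1) unfolding nstep_def defect_equiv[OF assms] unitary_def
    by (simp add: mm_distribs matrix_mul_assoc)
qed

lemma nstep_pow_equiv:
  assumes "unitary U" "unitary V"
  shows "(nstep ^^ k) (U ** X ** V) = U ** (nstep ^^ k) X ** V"
  by (induction k) (simp_all add: nstep_equiv assms)

text \<open>With E = \<open>defect X\<close> the step is X \<mapsto> (1 + E/2) X, and (1 + E/2) (1 -
  E) (1 + E/2) = 1 - 3/4 E^2 - 1/4 E^3. The absence of a linear term makes the iteration
  contract.\<close>

lemma defect_nstep:
  fixes X :: "complex^'n^'n"
  shows "defect (nstep X) = (3/4) *\<^sub>R (defect X ** defect X) + (1/4) *\<^sub>R (defect X ** defect X ** defect X)"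
proof -
  define E where "E = defect X"
  have XX: "X ** cstar X = mat 1 - E" by (simp add: E_def defect_def)
  have cE: "cstar E = E" by (simp add: E_def defect_def cstar_diff cstar_mult)
  have XXm: "M ** X ** cstar X = M - M ** E" for M :: "complex^'n^'n"
    by (simp add: matrix_mul_assoc[symmetric] XX mm_distribs)
  have "defect (nstep X) = mat 1 - nstep X ** cstar (nstep X)"
    by (simp add: defect_def)
  also have "\<dots> = mat 1 - (X ** cstar X + (1/2) *\<^sub>R (X ** cstar X ** E) + (1/2) *\<^sub>R (E ** X ** cstar X)
     + (1/4) *\<^sub>R (E ** X ** cstar X ** E))"
    unfolding nstep_def E_def[symmetric] cstar_add cstar_scaleR cstar_mult cE
    by (simp add: mm_distribs matrix_mul_assoc algebra_simps)
  also have "\<dots> = (3/4) *\<^sub>R (E ** E) + (1/4) *\<^sub>R (E ** E ** E)"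
    unfolding XX XXm
    by (simp add: mm_distribs matrix_mul_assoc) (simp add: vec_eq_iff, simp add: scaleR_conv_of_real field_simps)
  finally show ?thesis by (simp add: E_def)
qed

text \<open>For a defect of norm at most 1/2 the two terms give the factor 3/8 + 1/16 = 7/16,
  rounded up to 1/2.\<close>

lemma norm_defect_nstep:
  assumes "norm (defect X) \<le> 1/2"
  shows "norm (defect (nstep X)) \<le> norm (defect X) / 2"
proof -
  let ?e = "norm (defect X)"
  have 2: "norm (defect X ** defect X) \<le> ?e * ?e" by (rule norm_mm_le)
  have 3: "norm (defect X ** defect X ** defect X) \<le> ?e * ?e * ?e"
    by (rule order_trans[OF norm_mm_le mult_right_mono[OF 2]]) simp
  have a: "?e * ?e \<le> ?e * (1/2)" using assms by (intro mult_left_mono) auto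
  have b: "?e * ?e * ?e \<le> ?e * (1/2) * (1/2)" by (rule mult_mono[OF a assms]) auto
  have "norm (defect (nstep X)) \<le> 3/4 * norm (defect X ** defect X) + 1/4 * norm (defect X ** defect X ** defect X)"
    unfolding defect_nstep by (rule order_trans[OF norm_triangle_ineq]) simp
  also have "\<dots> \<le> ?e / 2" using 2 3 a b norm_ge_zero[of "defect X"] by linarith
  finally show ?thesis .
qed

lemma norm_nstep_pow:
  assumes "norm (defect X) \<le> 1/2"
  shows "norm (defect ((nstep ^^ k) X)) \<le> (1/2) ^ Suc k"
proof (induction k)
  case (Suc k)
  have "(1/2::real) ^ Suc k \<le> 1/2" by (simp add: power_le_one)
  then have "norm (defect ((nstep ^^ k) X)) \<le> 1/2" using Suc by linarith
  from norm_defect_nstep[OF this] Suc show ?case by simp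
qed (use assms in simp)

text \<open>The squared norm of row i is the diagonal entry of \<open>X ** cstar X\<close>, which
  differs from 1 by at most the norm of the defect.\<close>

lemma norm_defect_bound:
  assumes "norm (defect (X::complex^'n^'n)) \<le> 1/2"
  shows "(norm X)\<^sup>2 \<le> 2 * CARD('n)"
proof -
  have "(norm (X $ i))\<^sup>2 \<le> 2" for i
  proof -
    have "of_real ((norm (X $ i))\<^sup>2) = (X ** cstar X) $ i $ i"
      by (simp add: norm_vec_sq matrix_matrix_mult_def complex_norm_square del: of_real_power)
    also have "\<dots> = 1 - defect X $ i $ i"
      by (simp add: defect_def mat_def)
    finally have "norm (of_real ((norm (X $ i))\<^sup>2) :: complex) = norm (1 - defect X $ i $ i)" by simp
    also have "\<dots> \<le> 1 + norm (defect X $ i $ i)" by (metis norm_one norm_triangle_ineq4)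
    also have "norm (defect X $ i $ i) \<le> norm (defect X)"
      using Finite_Cartesian_Product.norm_nth_le[of "defect X $ i" i] Finite_Cartesian_Product.norm_nth_le[of "defect X" i] by linarith
    finally show ?thesis using assms by (simp only: norm_of_real) linarith
  qed
  then have "(\<Sum>i\<in>UNIV. (norm (X $ i))\<^sup>2) \<le> (\<Sum>i\<in>(UNIV::'n set). 2)" by (intro sum_mono)
  then show ?thesis by (simp add: norm_vec_sq)
qed

text \<open>The increments are half of \<open>defect\<close> times the iterate. The iterates stay
  bounded and the defects halve, so the increments are summable; the limit has defect 0.\<close>

lemma nstep_convergent:
  assumes "norm (defect (X::complex^'n^'n)) \<le> 1/2"
  shows "\<exists>L. (\<lambda>k. (nstep ^^ k) X) \<longlonglongrightarrow> L \<and> unitary L"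
proof -
  define x where "x k = (nstep ^^ k) X" for k
  define R where "R = sqrt (2 * CARD('n))"
  have le: "norm (defect (x k)) \<le> (1/2) ^ Suc k" for k
    using norm_nstep_pow[OF assms] by (simp add: x_def)
  have half: "(1/2::real) ^ Suc k \<le> 1/2" for k by (simp add: power_le_one)
  have "norm (defect (x k)) \<le> 1/2" for k by (rule order_trans[OF le half])
  then have R: "norm (x k) \<le> R" for k
    unfolding R_def by (intro real_le_rsqrt norm_defect_bound)
  have "norm (x (Suc k) - x k) \<le> R * (1/2)^k" for k
  proof -
    have "norm (x (Suc k) - x k) = (1/2) * norm (defect (x k) ** x k)"
      by (simp add: x_def nstep_def)
    also have "\<dots> \<le> (1/2) * ((1/2) ^ Suc k * R)"
      by (intro mult_left_mono order_trans[OF norm_mm_le] mult_mono le R) auto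
    also have "\<dots> \<le> R * (1/2)^k" by (simp add: R_def)
    finally show ?thesis .
  qed
  moreover have "summable (\<lambda>k. R * (1/2)^k)"
    by (intro summable_mult summable_geometric) simp
  ultimately have "summable (\<lambda>k. x (Suc k) - x k)"
    using summable_comparison_test'[of "\<lambda>k. R * (1/2)^k" 0 "\<lambda>k. x (Suc k) - x k"] by blast
  then have "convergent (\<lambda>k. \<Sum>i<k. x (Suc i) - x i)"
    by (simp add: summable_iff_convergent)
  then obtain l where "(\<lambda>k. x k - x 0) \<longlonglongrightarrow> l"
    unfolding sum_lessThan_telescope convergent_def by blast
  then have L: "x \<longlonglongrightarrow> l + x 0"
    using tendsto_add[OF _ tendsto_const[of "x 0"], of "\<lambda>k. x k - x 0" l] by simp
  have "(\<lambda>k. defect (x k)) \<longlonglongrightarrow> defect (l + x 0)"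
    unfolding defect_def by (intro tendsto_intros L)
  moreover have "(\<lambda>k. defect (x k)) \<longlonglongrightarrow> 0"
  proof (rule Lim_null_comparison)
    show "(\<lambda>k. (1/2::real) ^ Suc k) \<longlonglongrightarrow> 0" by (intro LIMSEQ_Suc LIMSEQ_power_zero) simp
  qed (use le in auto)
  ultimately have "defect (l + x 0) = 0" using LIMSEQ_unique by blast
  then have "unitary (cstar (l + x 0))" by (intro unitaryI) (simp add: defect_def)
  then have "unitary (l + x 0)" by simp
  then show ?thesis using L unfolding x_def by blast
qed

definition near_unitary :: "(complex^'n^'n) set" where
  "near_unitary = {X. norm (defect X) \<le> 1/2}"

text \<open>The default \<open>mat 1\<close> makes the value unitary everywhere, as a measurable map
  into the subspace \<open>UG\<close> requires.\<close>

definition upart :: "complex^'n^'n \<Rightarrow> complex^'n^'n" where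
  "upart X = (if X \<in> near_unitary then lim (\<lambda>k. (nstep ^^ k) X) else mat 1)"

lemma upart_lim: "X \<in> near_unitary \<Longrightarrow> (\<lambda>k. (nstep ^^ k) X) \<longlonglongrightarrow> upart X"
  using nstep_convergent[of X] by (auto simp: upart_def near_unitary_def limI)

lemma unitary_upart: "unitary (upart X)"
  using nstep_convergent[of X] by (auto simp: upart_def near_unitary_def limI)

lemma near_unitary_equiv:
  assumes "unitary U" "unitary V"
  shows "U ** X ** V \<in> near_unitary \<longleftrightarrow> X \<in> near_unitary"
  using assms by (simp add: near_unitary_def defect_equiv unitary_norm_left unitary_norm_right)

lemma upart_equiv:
  assumes "unitary U" "unitary V" "X \<in> near_unitary"
  shows "upart (U ** X ** V) = U ** upart X ** V"
proof -
  have "(\<lambda>k. (nstep ^^ k) (U ** X ** V)) \<longlonglongrightarrow> upart (U ** X ** V)"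
    using assms by (intro upart_lim) (simp add: near_unitary_equiv)
  moreover have "(\<lambda>k. (nstep ^^ k) (U ** X ** V)) \<longlonglongrightarrow> U ** upart X ** V"
    unfolding nstep_pow_equiv[OF assms(1,2)] by (intro tendsto_intros upart_lim assms)
  ultimately show ?thesis using LIMSEQ_unique by blast
qed

lemma continuous_on_defect: "continuous_on UNIV defect"
  unfolding defect_def by (intro continuous_intros)

lemma continuous_on_nstep_pow: "continuous_on UNIV (nstep ^^ k :: complex^'a^'a \<Rightarrow> _)"
proof (induction k)
  case (Suc k)
  have "continuous_on UNIV (nstep :: complex^'a^'a \<Rightarrow> _)"
    unfolding nstep_def using continuous_on_defect by (intro continuous_intros) (auto simp: eta_contract_eq)
  then have "continuous_on UNIV (nstep \<circ> (nstep ^^ k :: complex^'a^'a \<Rightarrow> _))"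
    using Suc continuous_on_subset by (intro continuous_on_compose) blast+
  then show ?case by simp
qed (simp add: id_def)

lemma closed_near_unitary: "closed near_unitary"
proof -
  have "closed ((\<lambda>X. norm (defect X)) -` {..1/2})"
    by (rule closed_vimage) (auto intro!: continuous_intros continuous_on_defect)
  then show ?thesis by (simp add: near_unitary_def vimage_def)
qed

lemma upart_measurable: "(upart :: complex^'n^'n \<Rightarrow> _) \<in> borel_measurable borel"
proof (rule borel_measurable_LIMSEQ_metric)
  have [measurable]: "(near_unitary :: (complex^'n^'n) set) \<in> sets borel"
    using closed_near_unitary by (rule borel_closed)
  show "(\<lambda>X::complex^'n^'n. if X \<in> near_unitary then (nstep ^^ k) X else mat 1) \<in> borel_measurable borel" for k
    using borel_measurable_continuous_onI[OF continuous_on_nstep_pow[of k]]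
    by (intro measurable_If_set) (auto simp: closed_near_unitary)
  show "(\<lambda>k. if X \<in> near_unitary then (nstep ^^ k) X else mat 1) \<longlonglongrightarrow> upart X" for X
    using upart_lim[of X] by (auto simp: upart_def)
qed

section \<open>The image measure and its invariance\<close>

definition UG :: "(complex^'n^'n) set" where "UG = {U. unitary U}"

text \<open>Lebesgue measure near the unitary group is invariant under the group; so is its image under the
  equivariant retraction \<open>upart\<close>.\<close>

definition haar :: "(complex^'n^'n) measure" where
  "haar = distr (uniform_measure lborel near_unitary) (restrict_space borel UG) upart"

text \<open>The set is compact and contains a ball around \<open>mat 1\<close>; so normalizing
  Lebesgue measure on it gives a probability measure.\<close>

lemma near_unitary_emeasure:
  "emeasure lborel (near_unitary::(complex^'n^'n) set) \<noteq> 0"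
  "emeasure lborel (near_unitary::(complex^'n^'n) set) \<noteq> \<infinity>"
proof -
  let ?O = "near_unitary::(complex^'n^'n) set"
  have "norm X \<le> sqrt (2 * CARD('n))" if "X \<in> ?O" for X
    using that norm_defect_bound[of X] by (auto simp: near_unitary_def intro: real_le_rsqrt)
  then have "bounded ?O" unfolding bounded_iff by blast
  then have "compact ?O" using closed_near_unitary compact_eq_bounded_closed by blast
  then show "emeasure lborel ?O \<noteq> \<infinity>" using emeasure_compact_finite by fastforce
  have "open ((\<lambda>X::complex^'n^'n. norm (defect X)) -` {..<1/2})"
    by (rule open_vimage) (auto intro!: continuous_intros continuous_on_defect)
  moreover have "(mat 1 :: complex^'n^'n) \<in> (\<lambda>X. norm (defect X)) -` {..<1/2}" by (simp add: defect_def)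
  ultimately obtain e where e: "e > 0" "ball (mat 1) e \<subseteq> (\<lambda>X::complex^'n^'n. norm (defect X)) -` {..<1/2}"
    by (meson open_contains_ball)
  then have "ball (mat 1) e \<subseteq> ?O" by (auto simp: near_unitary_def)
  then have "emeasure lborel (ball (mat 1 :: complex^'n^'n) e) \<le> emeasure lborel ?O"
    by (intro emeasure_mono) (auto simp: closed_near_unitary)
  moreover have "emeasure lborel (ball (mat 1 :: complex^'n^'n) e) > 0"
    using e(1) by (simp add: emeasure_ball content_ball_pos)
  ultimately show "emeasure lborel ?O \<noteq> 0" by auto
qed

lemma space_haar [simp]: "space haar = UG" by (simp add: haar_def space_restrict_space)

lemma sets_haar [measurable_cong]: "sets haar = sets (restrict_space borel UG)" by (simp add: haar_def)

lemma upart_measurable_UG: "upart \<in> measurable (uniform_measure lborel near_unitary) (restrict_space borel UG)"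
  using upart_measurable unitary_upart
  by (intro measurable_restrict_space2)
    (auto simp: UG_def measurable_def uniform_measure_def)

lemma prob_space_haar: "prob_space (haar :: (complex^'n^'n) measure)"
  unfolding haar_def
  by (intro prob_space.prob_space_distr prob_space_uniform_measure near_unitary_emeasure upart_measurable_UG)

text \<open>Multiplication by unitary matrices on both sides is an isometry of the Frobenius norm
  and maps \<open>near_unitary\<close> onto itself.\<close>

lemma distr_near_unitary:
  fixes U V :: "complex^'n^'n"
  assumes "unitary U" "unitary V"
  shows "distr (uniform_measure lborel near_unitary) (uniform_measure lborel near_unitary) (\<lambda>X. U ** X ** V) = uniform_measure lborel near_unitary"
    (is "distr ?M _ ?f = _")
proof (rule measure_eqI)
  have bl: "bounded_linear ?f"
    using bounded_linear_compose[OF bounded_linear_mm_left bounded_linear_mm_right] by blast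
  have fm [measurable]: "?f \<in> borel_measurable borel"
    using linear_continuous_on[OF bl] borel_measurable_continuous_onI by blast
  have [measurable]: "(near_unitary :: (complex^'n^'n) set) \<in> sets borel"
    using closed_near_unitary by (rule borel_closed)
  have D: "distr lborel borel ?f = lborel"
    using assms bl by (intro distr_lborel_isometry) (auto simp: linear_conv_bounded_linear unitary_norm_left unitary_norm_right)
  fix A assume "A \<in> sets (distr ?M ?M ?f)"
  then have [measurable]: "A \<in> sets borel" by simp
  let ?O = "near_unitary :: (complex^'n^'n) set"
  have "emeasure (distr ?M ?M ?f) A = emeasure ?M (?f -` A)"
    by (subst emeasure_distr) auto
  also have "\<dots> = emeasure lborel (?O \<inter> ?f -` A) / emeasure lborel ?O"
    by (rule emeasure_uniform_measure) (auto intro: measurable_sets_borel[OF fm])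
  also have "?O \<inter> ?f -` A = ?f -` (?O \<inter> A)"
    using near_unitary_equiv[OF assms] by auto
  also have "emeasure lborel (?f -` (?O \<inter> A)) = emeasure (distr lborel borel ?f) (?O \<inter> A)"
    by (subst emeasure_distr) auto
  also have "\<dots> / emeasure lborel ?O = emeasure ?M A"
    unfolding D by (subst emeasure_uniform_measure) auto
  finally show "emeasure (distr ?M ?M ?f) A = emeasure ?M A" .
qed simp

text \<open>Equivariance moves the translation inside \<open>upart\<close>, where
  \<open>distr_near_unitary\<close> absorbs it. Equivariance holds on \<open>near_unitary\<close>,
  which has full measure; hence the comparison almost everywhere.\<close>

lemma haar_invariant:
  fixes f :: "complex^'n^'n \<Rightarrow> real"
  assumes U: "unitary U" and V: "unitary V" and f: "continuous_on UG f"
  shows "(LINT B|haar. f (U ** B ** V)) = (LINT B|haar. f B)"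
proof -
  let ?M = "uniform_measure lborel near_unitary :: (complex^'n^'n) measure"
  have fm: "f \<in> borel_measurable (restrict_space borel UG)"
    using f by (rule borel_measurable_continuous_on_restrict)
  have inv: "U ** B ** V \<in> UG" if "B \<in> UG" for B
    using that U V by (simp add: UG_def unitary_mult)
  have "continuous_on UG (\<lambda>B. f (U ** B ** V))"
    by (rule continuous_on_compose2[OF f]) (use inv in \<open>auto intro!: continuous_intros\<close>)
  then have fm': "(\<lambda>B. f (U ** B ** V)) \<in> borel_measurable (restrict_space borel UG)"
    by (rule borel_measurable_continuous_on_restrict)
  have bl: "bounded_linear (\<lambda>X. U ** X ** V)"
    using bounded_linear_compose[OF bounded_linear_mm_left bounded_linear_mm_right] by blast
  have mm: "(\<lambda>X. U ** X ** V) \<in> measurable ?M ?M"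
    using borel_measurable_continuous_onI[OF linear_continuous_on[OF bl]] by simp
  have [measurable]: "(near_unitary :: (complex^'n^'n) set) \<in> sets borel"
    using closed_near_unitary by (rule borel_closed)
  have "(LINT B|haar. f (U ** B ** V)) = (LINT X|?M. f (U ** upart X ** V))"
    unfolding haar_def by (rule integral_distr[OF upart_measurable_UG fm'])
  also have "\<dots> = (LINT X|?M. f (upart (U ** X ** V)))"
  proof (rule integral_cong_AE)
    have "AE X in ?M. X \<in> near_unitary" by (rule AE_uniform_measureI) auto
    then show "AE X in ?M. f (U ** upart X ** V) = f (upart (U ** X ** V))"
      by (auto elim!: eventually_mono simp: upart_equiv[OF U V])
    show "(\<lambda>X. f (U ** upart X ** V)) \<in> borel_measurable ?M"
      by (rule measurable_compose[OF upart_measurable_UG fm'])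
    show "(\<lambda>X. f (upart (U ** X ** V))) \<in> borel_measurable ?M"
      by (rule measurable_compose[OF mm measurable_compose[OF upart_measurable_UG fm]])
  qed
  also have "\<dots> = (LINT X|distr ?M ?M (\<lambda>X. U ** X ** V). f (upart X))"
    by (rule integral_distr[symmetric, OF mm measurable_compose[OF upart_measurable_UG fm]])
  also have "\<dots> = (LINT X|?M. f (upart X))"
    by (simp only: distr_near_unitary[OF U V])
  also have "\<dots> = (LINT B|haar. f B)"
    unfolding haar_def by (rule integral_distr[symmetric, OF upart_measurable_UG fm])
  finally show ?thesis .
qed

lemma cip_add_right: "cip x (y + z) = cip x y + cip x z"
  by (simp add: cip_def distrib_left sum.distrib)
lemma cip_diff_right: "cip x (y - z) = cip x y - cip x z"
  by (simp add: cip_def right_diff_distrib sum_subtractf)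
lemma cip_add_left: "cip (x + y) z = cip x z + cip y z"
  by (simp add: cip_def distrib_right sum.distrib)
lemma cip_diff_left: "cip (x - y) z = cip x z - cip y z"
  by (simp add: cip_def left_diff_distrib sum_subtractf)
lemma cip_scale_right: "cip x (c *s y) = c * cip x y"
  by (simp add: cip_def sum_distrib_left mult_ac)
lemma cip_scale_left: "cip (c *s x) y = cnj c * cip x y"
  by (simp add: cip_def sum_distrib_left mult_ac)
lemma cip_cnj: "cnj (cip x y) = cip y x"
  by (simp add: cip_def mult.commute)
lemma cip_axis: "cip (axis s 1) y = y $ s"
  by (simp add: cip_def axis_def if_distrib[of cnj] if_distrib[of "\<lambda>x. x * _"] cong: if_cong)

lemma mv_scale: "A *v (c *s x) = c *s (A *v (x::complex^'n))"
  by (simp add: vec_eq_iff matrix_vector_mult_def sum_distrib_left mult_ac)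

lemma mv_axis: "A *v axis s 1 = column s (A::complex^'n^'m)"
  by (simp add: vec_eq_iff matrix_vector_mult_def column_def axis_def if_distrib[of "\<lambda>x. _ * x"] cong: if_cong)

subsection \<open>Householder reflections and transitivity of the unitary group\<close>

text \<open>A Householder map 1 - v v^* / k with v = a - b, where k = \<open>cip v a\<close> may
  fail to be real. Equality of the norms gives k + cnj k = \<open>cip v v\<close>, which is exactly
  unitarity, and U a = a - v = b.\<close>

lemma complex_reflection:
  fixes a b :: "complex^'n"
  assumes ab: "norm a = norm b"
  shows "\<exists>U. unitary U \<and> U *v a = b \<and> (\<forall>x. cip a x = 0 \<longrightarrow> cip b x = 0 \<longrightarrow> U *v x = x)"
proof (cases "a = b")
  case True
  then show ?thesis by (intro exI[of _ "mat 1"]) auto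
next
  case False
  define v where "v = a - b"
  define k where "k = cip v a"
  have kk: "k + cnj k = cip v v"
  proof -
    have "cip a a = cip b b" by (simp add: cip_self ab)
    then show ?thesis
      unfolding k_def v_def by (simp add: cip_cnj cip_diff_left cip_diff_right)
  qed
  have "cip v v \<noteq> 0" using False by (simp add: cip_self v_def)
  then have k: "k \<noteq> 0" using kk by auto
  define U :: "complex^'n^'n" where "U = (\<chi> i j. (if i = j then 1 else 0) - v$i * cnj (v$j) / k)"
  have Ux: "U *v x = x - (cip v x / k) *s v" for x
  proof -
    have "(U *v x) $ i = x $ i - (\<Sum>j\<in>UNIV. v$i * cnj (v$j) / k * x $ j)" for i
      by (simp add: U_def matrix_vector_mult_def left_diff_distrib sum_subtractf
          if_distrib[of "\<lambda>c. c * _"] cong: if_cong)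
    then show ?thesis
      by (simp add: vec_eq_iff cip_def sum_distrib_left sum_divide_distrib mult_ac)
  qed
  have "(cstar U ** U) $ i $ j = mat 1 $ i $ j" for i j
  proof -
    have "(cstar U ** U) $ i $ j = (U *v axis j 1) $ i - (\<Sum>l\<in>UNIV. cnj (v$l * cnj (v$i) / k) * (U *v axis j 1) $ l)"
      by (simp add: matrix_matrix_mult_def mv_axis column_def U_def left_diff_distrib sum_subtractf
          if_distrib[of "\<lambda>c. c * _"] if_distrib[of cnj] cong: if_cong)
    also have "(\<Sum>l\<in>UNIV. cnj (v$l * cnj (v$i) / k) * (U *v axis j 1) $ l) = v$i / cnj k * cip v (U *v axis j 1)"
      by (simp add: cip_def sum_distrib_left mult_ac)
    also have "cip v (U *v axis j 1) = cip v (axis j 1) * (1 - cip v v / k)"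
      by (simp add: Ux cip_diff_right cip_scale_right algebra_simps)
    also have "1 - cip v v / k = - cnj k / k"
      using k by (simp add: kk[symmetric] field_simps)
    also have "(U *v axis j 1) $ i - v $ i / cnj k * (cip v (axis j 1) * (- cnj k / k)) = mat 1 $ i $ j"
      using k by (simp add: Ux mat_def axis_def)
    finally show ?thesis .
  qed
  then have "unitary U" by (intro unitaryI) (simp add: vec_eq_iff)
  moreover have "U *v a = b" using k by (simp add: Ux flip: k_def) (simp add: v_def)
  moreover have "U *v x = x" if "cip a x = 0" "cip b x = 0" for x
    using that by (simp add: Ux v_def cip_diff_left)
  ultimately show ?thesis by blast
qed

lemma norm_axis_unit [simp]: "norm (axis k 1 :: complex^'n) = 1"
proof -
  have "cip (axis k 1) (axis k 1 :: complex^'n) = 1" unfolding cip_axis by simp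
  then have "(norm (axis k 1 :: complex^'n))\<^sup>2 = 1" unfolding cip_self using of_real_eq_1_iff by blast
  then show ?thesis by (simp add: power2_eq_1_iff)
qed

lemma exists_unitary_column:
  fixes x :: "complex^'n"
  assumes "norm x = 1"
  shows "\<exists>U. unitary U \<and> column k U = x"
proof -
  have "norm (axis k 1 :: complex^'n) = norm x"
    using assms by simp
  then show ?thesis using complex_reflection[of "axis k 1" x] by (metis mv_axis)
qed

text \<open>Columns are matched one at a time. The reflection that corrects column s fixes the
  columns already matched, because these are orthogonal to both the old and the new column
  s.\<close>

lemma isometry_transitive:
  fixes W W' :: "complex^'m^'n"
  assumes W: "cstar W ** W = mat 1" and W': "cstar W' ** W' = mat 1"
  shows "\<exists>U. unitary U \<and> U ** W = W'"
proof -
  have cols: "cip (column i Z) (column j Z) = (if i = j then 1 else 0)"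
    if "cstar Z ** Z = mat 1" for Z :: "complex^'m^'n" and i j
  proof -
    have "cip (column i Z) (column j Z) = (cstar Z ** Z) $ i $ j"
      by (simp add: cip_def column_def matrix_matrix_mult_def)
    then show ?thesis using that by (simp add: mat_def)
  qed
  have "\<exists>U. unitary U \<and> (\<forall>j\<in>F. column j (U ** W) = column j W')" if "finite F" for F
    using that
  proof (induction F)
    case empty
    show ?case by (intro exI[of _ "mat 1"]) auto
  next
    case (insert s F)
    then obtain U where U: "unitary U" "\<forall>j\<in>F. column j (U ** W) = column j W'" by blast
    have UW: "cstar (U ** W) ** (U ** W) = mat 1"
      using U(1) W unfolding unitary_def cstar_mult by (metis matrix_mul_assoc matrix_mul_rid)
    have "of_real ((norm (column s (U ** W)))\<^sup>2) = (of_real ((norm (column s W'))\<^sup>2) :: complex)"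
      using cols[OF UW, of s s] cols[OF W', of s s] by (simp add: cip_self)
    then have "norm (column s (U ** W)) = norm (column s W')"
      by (simp only: of_real_eq_iff) simp
    from complex_reflection[OF this] obtain H where H: "unitary H" "H *v column s (U ** W) = column s W'"
      "\<And>x. cip (column s (U ** W)) x = 0 \<Longrightarrow> cip (column s W') x = 0 \<Longrightarrow> H *v x = x" by blast
    have "column j (H ** U ** W) = column j W'" if "j \<in> insert s F" for j
    proof (cases "j = s")
      case True
      then show ?thesis using H(2) by (simp add: matrix_mul_assoc[symmetric] column_mult)
    next
      case False
      then have "j \<in> F" using that by simp
      then have e: "column j (U ** W) = column j W'" using U by blast
      have "cip (column s (U ** W)) (column j W') = 0" "cip (column s W') (column j W') = 0"
        using False cols[OF UW, of s j] cols[OF W', of s j] by (auto simp: e)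
      from H(3)[OF this] show ?thesis
        by (simp add: matrix_mul_assoc[symmetric] column_mult[of j H] e)
    qed
    then show ?case using unitary_mult[OF H(1) U(1)] by blast
  qed
  from this[of UNIV] obtain U where "unitary U" "\<And>j. column j (U ** W) = column j W'" by auto
  moreover from this(2) have "U ** W = W'" by (simp add: vec_eq_iff column_def)
  ultimately show ?thesis by blast
qed

subsection \<open>Positive semidefinite matrices as sums of rank one matrices\<close>

text \<open>Cholesky elimination by induction on an index set supporting the matrix: a positive
  pivot splits off one rank one term and leaves the Schur complement; a zero pivot forces its row
  and column to vanish.\<close>

lemma psd_decomposition_on:
  fixes P :: "complex^'m^'m"
  assumes "finite S" "cstar P = P" "\<And>w. 0 \<le> Re (cip w (P *v w))"
    and "\<And>j k. P$j$k \<noteq> 0 \<Longrightarrow> j \<in> S \<and> k \<in> S"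
  shows "\<exists>x. \<forall>j k. P$j$k = (\<Sum>i\<in>S. x i $ j * cnj (x i $ k))"
  using assms
proof (induction S arbitrary: P)
  case empty
  then show ?case by (intro exI[of _ "\<lambda>_. 0"]) auto
next
  case (insert s S)
  define p where "p = Re (P$s$s)"
  have herm: "P$j$k = cnj (P$k$j)" for j k
    using insert.prems(1) by (metis cstar_nth)
  have pp: "P$s$s = of_real p"
    using herm[of s s] unfolding p_def by (metis Reals_cnj_iff of_real_Re)
  \<comment> \<open>The form along the line w + t e_s, as a quadratic polynomial in t; both cases
    below choose t in it.\<close>
  have shift: "Re (cip (w + t *s axis s 1) (P *v (w + t *s axis s 1)))
      = Re (cip w (P *v w)) + 2 * Re (cnj t * (P *v w) $ s) + (norm t)\<^sup>2 * p" for w t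
  proof -
    have c: "cip w (column s P) = cnj ((P *v w) $ s)"
      using cip_adj[of P w "axis s 1"] insert.prems(1) 
      by (simp add: mv_axis flip: cip_axis) (simp add: cip_cnj)
    have "cip (w + t *s axis s 1) (P *v (w + t *s axis s 1))
      = cip w (P *v w) + t * cip w (column s P) + cnj t * (P *v w) $ s + (cnj t * t) * P$s$s"
      by (simp add: matrix_vector_right_distrib mv_scale mv_axis cip_add_left cip_add_right cip_scale_left
          cip_scale_right cip_axis algebra_simps column_def)
    moreover have "cnj t * t = of_real ((norm t)\<^sup>2)" by (simp add: complex_norm_square mult.commute del: of_real_power)
    moreover have "Re (t * cip w (column s P)) = Re (cnj t * (P *v w) $ s)"
      unfolding c by simp
    ultimately show ?thesis by (simp add: pp)
  qed
  have p0: "0 \<le> p"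
    using insert.prems(2)[of "0 + 1 *s axis s 1"] unfolding shift by (simp add: cip_def)
  show ?case
  proof (cases "p = 0")
    case True
    have Ps: "P$s$k = 0" for k
    proof (rule ccontr)
      assume nz: "P$s$k \<noteq> 0"
      define c where "c = Re (cip (axis k 1) (P *v axis k 1))"
      \<comment> \<open>Chosen so that the form would take the value c - (c + 1) = -1.\<close>
      define r where "r = (c + 1) / (2 * (norm (P$s$k))\<^sup>2)"
      have "0 \<le> c + 2 * Re (cnj (- of_real r * P$s$k) * P$s$k)"
        using insert.prems(2)[of "axis k 1 + (- of_real r * P$s$k) *s axis s 1"] True
        unfolding shift c_def by (simp add: mv_axis column_def)
      also have "cnj (- of_real r * P$s$k) * P$s$k = of_real (- r * (norm (P$s$k))\<^sup>2)"
        by (simp add: complex_norm_square mult_ac del: of_real_power)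
      finally have "0 \<le> c - 2 * (r * (norm (P$s$k))\<^sup>2)" by simp
      then show False using nz by (simp add: r_def)
    qed
    have "P$k$s = 0" for k using Ps[of k] herm[of k s] by simp
    then have "P$j$k \<noteq> 0 \<Longrightarrow> j \<in> S \<and> k \<in> S" for j k
      using insert.prems(3)[of j k] Ps by auto
    from insert.IH[OF insert.prems(1,2) this] obtain x where
      x: "\<And>j k. P$j$k = (\<Sum>i\<in>S. x i $ j * cnj (x i $ k))" by blast
    show ?thesis
      using insert.hyps
      by (intro exI[of _ "x(s := 0)"]) (auto simp: x intro!: sum.cong)
  next
    case False
    then have pos: "p > 0" using p0 by simp
    define P' :: "complex^'m^'m" where "P' = (\<chi> j k. P$j$k - P$j$s * cnj (P$k$s) / of_real p)"
    have "cstar P' = P'"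
      by (simp add: vec_eq_iff P'_def mult.commute flip: herm)
    moreover have "0 \<le> Re (cip w (P' *v w))" for w
    proof -
      let ?b = "(P *v w) $ s"
      have b: "?b = (\<Sum>k\<in>UNIV. cnj (P$k$s) * w$k)"
        by (simp add: matrix_vector_mult_def flip: herm)
      have "P' *v w = P *v w - (?b / of_real p) *s column s P"
        unfolding b P'_def by (simp add: vec_eq_iff matrix_vector_mult_def column_def right_diff_distrib
            left_diff_distrib sum_subtractf sum_distrib_left sum_distrib_right sum_divide_distrib mult_ac)
      moreover have "cip w (column s P) = cnj ?b"
        unfolding b by (simp add: cip_def column_def mult.commute)
      ultimately have "cip w (P' *v w) = cip w (P *v w) - of_real ((norm ?b)\<^sup>2 / p)"
        by (simp add: cip_diff_right cip_scale_right complex_norm_square mult_ac del: of_real_power)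
      then have e: "Re (cip w (P' *v w)) = Re (cip w (P *v w)) - (norm ?b)\<^sup>2 / p" by simp
      \<comment> \<open>The minimizer of the form along w + t e_s; the minimum is the Schur
        complement at w.\<close>
      let ?t = "- ?b / of_real p"
      have "cnj ?t * ?b = of_real (- ((norm ?b)\<^sup>2 / p))"
        by (simp add: complex_norm_square mult_ac del: of_real_power)
      then have "Re (cnj ?t * ?b) = - ((norm ?b)\<^sup>2 / p)" by (simp only: Re_complex_of_real)
      moreover have "(norm ?t)\<^sup>2 * p = (norm ?b)\<^sup>2 / p"
        using pos by (simp add: norm_divide power_divide power2_eq_square)
      ultimately show ?thesis
        using insert.prems(2)[of "w + ?t *s axis s 1"] unfolding shift e by linarith
    qed
    moreover have "j \<in> S \<and> k \<in> S" if "P'$j$k \<noteq> 0" for j k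
    proof -
      have Z: "P$j$k = 0" if "j \<notin> insert s S \<or> k \<notin> insert s S" for j k
        using insert.prems(3) that by blast
      have "P'$j$k = 0" if "j \<notin> insert s S \<or> k \<notin> insert s S"
        using that Z[of j k] Z[of j s] Z[of k s] by (elim disjE) (simp_all add: P'_def)
      then have "j \<in> insert s S \<and> k \<in> insert s S" using that by blast
      moreover have "P'$s$k = 0" "P'$j$s = 0"
        unfolding P'_def using pos by (simp_all add: pp flip: herm)
      then have "j \<noteq> s" "k \<noteq> s" using that by auto
      ultimately show ?thesis by auto
    qed
    ultimately obtain x where x: "\<And>j k. P'$j$k = (\<Sum>i\<in>S. x i $ j * cnj (x i $ k))"
      using insert.IH[of P'] by blast
    define y where "y = x(s := (1 / of_real (sqrt p)) *s column s P)"
    have "P$j$k = (\<Sum>i\<in>insert s S. y i $ j * cnj (y i $ k))" for j k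
    proof -
      have "of_real (sqrt p) * of_real (sqrt p) = (of_real p :: complex)"
        using p0 by (metis of_real_mult real_sqrt_mult_self abs_of_nonneg)
      then have "y s $ j * cnj (y s $ k) = P$j$s * cnj (P$k$s) / of_real p"
        by (simp add: y_def column_def)
      moreover have "(\<Sum>i\<in>S. y i $ j * cnj (y i $ k)) = P'$j$k"
        unfolding x using insert.hyps by (auto simp: y_def intro!: sum.cong)
      ultimately show ?thesis using insert.hyps by (simp add: P'_def)
    qed
    then show ?thesis by blast
  qed
qed

lemma psd_decomposition:
  fixes P :: "complex^'m^'m"
  assumes "cstar P = P" "\<And>w. 0 \<le> Re (cip w (P *v w))"
  shows "\<exists>x::'m \<Rightarrow> complex^'m. \<forall>j k. P$j$k = (\<Sum>i\<in>UNIV. x i $ j * cnj (x i $ k))"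
  by (rule psd_decomposition_on) (use assms in auto)

subsection \<open>The closed matrix ball\<close>

text \<open>Operator norm at most one, stated for the adjoint. In this form closedness and
  invariance under unitary matrices are immediate; \<open>closure_Imn\<close> identifies the set
  with the closure of the domain.\<close>

definition Cl :: "(complex^'n^'m) set" where
  "Cl = {z. \<forall>w. norm (cstar z *v w) \<le> norm w}"

definition tens :: "complex^'m \<Rightarrow> complex^'n \<Rightarrow> complex^'n^'m" where
  "tens x y = (\<chi> j a. x$j * y$a)"

definition csm :: "complex \<Rightarrow> complex^'n^'m \<Rightarrow> complex^'n^'m" where
  "csm c z = (\<chi> j a. c * z$j$a)"

definition vcnj :: "complex^'n \<Rightarrow> complex^'n" where
  "vcnj y = (\<chi> a. cnj (y$a))"

lemma csm_tens: "csm c (tens x y) = tens (c *s x) y"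
  by (simp add: csm_def tens_def vec_eq_iff)

lemma mult_csm: "A ** csm c z = csm c (A ** z)" for A :: "complex^'m^'m"
  by (simp add: csm_def matrix_matrix_mult_def vec_eq_iff sum_distrib_left mult_ac)

lemma csm_mult: "csm c z ** B = csm c (z ** B)" for B :: "complex^'n^'n"
  by (simp add: csm_def matrix_matrix_mult_def vec_eq_iff sum_distrib_left mult_ac)

lemma mult_tens: "A ** tens x y = tens (A *v x) y" for A :: "complex^'m^'m"
  by (simp add: tens_def matrix_matrix_mult_def matrix_vector_mult_def vec_eq_iff sum_distrib_left mult_ac)

lemma tens_mult: "tens x y ** B = tens x (y v* B)" for B :: "complex^'n^'n"
  by (simp add: tens_def matrix_matrix_mult_def vector_matrix_mult_def vec_eq_iff sum_distrib_left mult_ac)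

lemma norm_tens: "(norm (tens x y))\<^sup>2 = (norm x)\<^sup>2 * (norm y)\<^sup>2"
  by (simp add: norm_vec_sq tens_def norm_mult power_mult_distrib sum_product sum_distrib_left[symmetric] sum_distrib_right)

lemma norm_vcnj [simp]: "norm (vcnj y) = norm y"
  by (simp add: norm_vec_def vcnj_def)

lemma mv_scaleR: "(c *\<^sub>R A) *v x = c *\<^sub>R (A *v x)" for A :: "complex^'n^'m"
  by (simp add: matrix_vector_mult_def vec_eq_iff scaleR_sum_right)

lemma cstar_tens_mv: "cstar (tens x y) *v w = cip x w *s vcnj y"
  by (simp add: vec_eq_iff cip_def vcnj_def matrix_vector_mult_def tens_def sum_distrib_right sum_distrib_left mult_ac)

lemma Cl_unitary:
  assumes "z \<in> Cl" "unitary A" "unitary B"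
  shows "A ** z ** B \<in> Cl"
proof -
  have "norm (cstar (A ** z ** B) *v w) \<le> norm w" for w
  proof -
    have "cstar (A ** z ** B) *v w = cstar B *v (cstar z *v (cstar A *v w))"
      by (simp add: cstar_mult matrix_vector_mul_assoc matrix_mul_assoc)
    then show ?thesis
      using assms by (simp add: Cl_def unitary_norm_mv) (metis unitary_norm_mv unitary_cstar)
  qed
  then show ?thesis by (simp add: Cl_def)
qed

lemma Cl_unitary_right: "z \<in> Cl \<Longrightarrow> unitary B \<Longrightarrow> z ** B \<in> Cl"
  using Cl_unitary[of z "mat 1" B] by simp

lemma zero_in_Cl [simp]: "(0 :: complex^'n^'m) \<in> Cl"
proof -
  have "cstar (0::complex^'n^'m) = 0" by (simp add: vec_eq_iff)
  then show ?thesis by (simp add: Cl_def)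
qed

lemma compact_Cl: "compact (Cl :: (complex^'n^'m) set)"
proof -
  have "closed {z::complex^'n^'m. norm (cstar z *v w) \<le> norm w}" for w
    unfolding matrix_vector_mult_def by (intro closed_Collect_le continuous_intros)
  then have "closed (\<Inter>w. {z::complex^'n^'m. norm (cstar z *v w) \<le> norm w})"
    by (intro closed_INT) blast
  also have "(\<Inter>w. {z::complex^'n^'m. norm (cstar z *v w) \<le> norm w}) = Cl"
    by (auto simp: Cl_def)
  finally have "closed (Cl :: (complex^'n^'m) set)" .
  moreover have "bounded (Cl :: (complex^'n^'m) set)"
    unfolding bounded_iff
  proof (intro exI ballI)
    fix z :: "complex^'n^'m" assume z: "z \<in> Cl"
    have "norm (z $ j) \<le> 1" for j
    proof -
      have "norm (cstar z *v axis j 1) \<le> norm (axis j (1::complex))" using z unfolding Cl_def by blast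
      moreover have "norm (axis j (1::complex)) = 1"
        by (simp add: norm_axis_unit)
      moreover have "cstar z *v axis j 1 = vcnj (z $ j)"
        by (simp add: mv_axis column_def vcnj_def vec_eq_iff)
      ultimately show ?thesis by simp
    qed
    then have "(\<Sum>j\<in>UNIV. norm (z$j)) \<le> (\<Sum>j\<in>(UNIV::'m set). 1)" by (intro sum_mono)
    moreover have "norm z \<le> (\<Sum>j\<in>UNIV. norm (z$j))"
      by (simp add: norm_vec_def L2_set_le_sum)
    ultimately show "norm z \<le> real CARD('m)" by simp
  qed
  ultimately show ?thesis using compact_eq_bounded_closed by blast
qed

lemma compact_UG: "compact (UG :: (complex^'n^'n) set)"
proof -
  have "UG = {U::complex^'n^'n. cstar U ** U = mat 1}"
    using unitaryI by (auto simp: UG_def unitary_def)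
  moreover have "closed {U::complex^'n^'n. cstar U ** U = mat 1}"
    by (intro closed_Collect_eq continuous_intros)
  ultimately have "closed (UG :: (complex^'n^'n) set)" by simp
  moreover have "bounded (UG :: (complex^'n^'n) set)"
    unfolding bounded_iff
    by (intro exI[of _ "norm (mat 1 :: complex^'n^'n)"] ballI)
      (metis UG_def mem_Collect_eq order_refl unitary_norm_left matrix_mul_rid)
  ultimately show ?thesis using compact_eq_bounded_closed by blast
qed

lemma haar_integrable:
  fixes f :: "complex^'n^'n \<Rightarrow> real"
  assumes "continuous_on UG f"
  shows "integrable haar f"
proof -
  interpret prob_space "haar :: (complex^'n^'n) measure" by (rule prob_space_haar)
  have "bounded (f ` UG)"
    by (intro compact_imp_bounded compact_continuous_image assms compact_UG)
  then obtain K where "\<And>B. B \<in> UG \<Longrightarrow> norm (f B) \<le> K" unfolding bounded_iff by blast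
  moreover have "f \<in> borel_measurable haar"
    using borel_measurable_continuous_on_restrict[OF assms] measurable_cong_sets[OF sets_haar refl] by blast
  ultimately show ?thesis
    by (intro integrable_const_bound[where B=K]) auto
qed

lemma haar_total: "(LINT B|(haar :: (complex^'n^'n) measure). c) = (c::real)"
proof -
  interpret prob_space "haar :: (complex^'n^'n) measure" by (rule prob_space_haar)
  show ?thesis using prob_space by simp
qed

lemma unitary_UG: "B \<in> UG \<longleftrightarrow> unitary B" by (simp add: UG_def)

subsection \<open>Harmonic families\<close>

definition decL :: "complex^'n^'m \<Rightarrow> ('m \<Rightarrow> real) \<Rightarrow> ('m \<Rightarrow> complex^'m) \<Rightarrow> bool" where
  "decL z p x \<longleftrightarrow> (\<forall>j k. (mat 1 - z ** cstar z)$j$k = (\<Sum>i\<in>UNIV. of_real (p i) * (x i $ j * cnj (x i $ k))))"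

text \<open>The coefficient of the column pair (a, b) in \<open>LB\<close> is entry (b, a) of
  \<open>mat 1 - cstar z ** z\<close>; hence the transposed indices.\<close>

definition decR :: "complex^'n^'m \<Rightarrow> ('n \<Rightarrow> real) \<Rightarrow> ('n \<Rightarrow> complex^'n) \<Rightarrow> bool" where
  "decR z q y \<longleftrightarrow> (\<forall>a b. (mat 1 - cstar z ** z)$b$a = (\<Sum>i\<in>UNIV. of_real (q i) * (y i $ a * cnj (y i $ b))))"

text \<open>The real Laplacian on the complex line in direction \<open>v\<close>, that is, four
  times the mixed complex derivative along it.\<close>

definition Lam :: "((complex^'n^'m) list \<Rightarrow> complex^'n^'m \<Rightarrow> real) \<Rightarrow> complex^'n^'m \<Rightarrow> complex^'n^'m \<Rightarrow> real" where
  "Lam X z v = X [v, v] z + X [csm \<i> v, csm \<i> v] z"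

text \<open>\<open>X vs\<close> stands for the iterated directional derivative of a function in the directions \<open>vs\<close>,
  extended to the closed ball. Writing the two coefficient matrices of the operator as sums of rank one
  matrices makes the last condition visibly invariant under \<open>z \<mapsto> A z B\<close> with \<open>A\<close>, \<open>B\<close> unitary.\<close>

definition harm_fam :: "((complex^'n^'m) list \<Rightarrow> complex^'n^'m \<Rightarrow> real) \<Rightarrow> bool" where
  "harm_fam X \<longleftrightarrow>
    (\<forall>vs. length vs \<le> CARD('n) \<longrightarrow> continuous_on Cl (X vs)) \<and>
    (\<forall>ws vs. length ws + length vs < CARD('n) \<longrightarrow> (\<forall>z\<in>Cl. linear (\<lambda>v. X (ws @ v # vs) z))) \<and>
    (\<forall>vs z v T t. length vs < CARD('n) \<longrightarrow> convex T \<longrightarrow> (\<forall>s\<in>T. z + s *\<^sub>R v \<in> Cl) \<longrightarrow> t \<in> T \<longrightarrow>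
       ((\<lambda>s. X vs (z + s *\<^sub>R v)) has_real_derivative X (v # vs) (z + t *\<^sub>R v)) (at t within T)) \<and>
    (\<forall>z p x q y. z \<in> Cl \<longrightarrow> decL z p x \<longrightarrow> decR z q y \<longrightarrow>
       (\<Sum>i\<in>UNIV. \<Sum>l\<in>UNIV. p i * q l * Lam X z (tens (x i) (y l))) = 0)"

lemma hf_cont: "harm_fam (X :: (complex^'n^'m) list \<Rightarrow> _) \<Longrightarrow> length vs \<le> CARD('n) \<Longrightarrow> continuous_on Cl (X vs)"
  unfolding harm_fam_def by blast

lemma hf_linear: "harm_fam (X :: (complex^'n^'m) list \<Rightarrow> _) \<Longrightarrow> length ws + length vs < CARD('n) \<Longrightarrow> z \<in> Cl
  \<Longrightarrow> linear (\<lambda>v. X (ws @ v # vs) z)"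
  unfolding harm_fam_def by blast

text \<open>The derivative is taken within \<open>T\<close>, so that closed segments, one-sided
  endpoints and segments lying in the boundary are all covered.\<close>

lemma hf_deriv: "harm_fam (X :: (complex^'n^'m) list \<Rightarrow> _) \<Longrightarrow> length vs < CARD('n) \<Longrightarrow> convex T
  \<Longrightarrow> (\<And>s. s \<in> T \<Longrightarrow> z + s *\<^sub>R v \<in> Cl) \<Longrightarrow> t \<in> T \<Longrightarrow>
  ((\<lambda>s. X vs (z + s *\<^sub>R v)) has_real_derivative X (v # vs) (z + t *\<^sub>R v)) (at t within T)"
  unfolding harm_fam_def by blast

lemma hf_harm: "harm_fam (X :: (complex^'n^'m) list \<Rightarrow> _) \<Longrightarrow> z \<in> Cl \<Longrightarrow> decL z p x \<Longrightarrow> decR z q y \<Longrightarrow>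
  (\<Sum>i\<in>UNIV. \<Sum>l\<in>UNIV. p i * q l * Lam X z (tens (x i) (y l))) = 0"
  unfolding harm_fam_def by blast

text \<open>The coefficient matrix of A z B is that of z conjugated by A, so the rank one terms move
  by A and the weights stay.\<close>

lemma decL_unitary:
  assumes "unitary A" "unitary B" "decL z p x"
  shows "decL (A ** z ** B) p (\<lambda>i. A *v x i)"
proof -
  have a: "A ** cstar A = mat 1" and b: "B ** cstar B = mat 1"
    using assms by (auto simp: unitary_def)
  have "A ** z ** B ** cstar (A ** z ** B) = A ** z ** (B ** cstar B) ** cstar z ** cstar A"
    by (simp add: cstar_mult matrix_mul_assoc)
  also have "\<dots> = A ** z ** cstar z ** cstar A" by (simp only: b matrix_mul_rid)
  finally have e: "mat 1 - A ** z ** B ** cstar (A ** z ** B) = A ** (mat 1 - z ** cstar z) ** cstar A"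
    by (simp add: mm_distribs a matrix_mul_assoc)
  have "(A ** (mat 1 - z ** cstar z) ** cstar A) $ j $ k
     = (\<Sum>c\<in>UNIV. (\<Sum>d\<in>UNIV. A$j$d * (mat 1 - z ** cstar z)$d$c) * cnj (A$k$c))" for j k
    by (simp add: matrix_matrix_mult_def del: vector_minus_component)
  also have "\<dots> j k = (\<Sum>c\<in>UNIV. \<Sum>d\<in>UNIV. \<Sum>i\<in>UNIV. of_real (p i) * (A$j$d * x i $ d * cnj (A$k$c * x i $ c)))" for j k
    using assms(3) unfolding decL_def
    by (simp add: sum_distrib_left sum_distrib_right mult_ac del: vector_minus_component)
  also have "\<dots> j k = (\<Sum>i\<in>UNIV. \<Sum>c\<in>UNIV. \<Sum>d\<in>UNIV. of_real (p i) * (A$j$d * x i $ d * cnj (A$k$c * x i $ c)))" for j k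
    by (subst (2) sum.swap, subst sum.swap) simp
  also have "\<dots> j k = (\<Sum>i\<in>UNIV. of_real (p i) * ((A *v x i) $ j * cnj ((A *v x i) $ k)))" for j k
  proof (intro sum.cong refl)
    fix i
    have "(A *v x i) $ j * cnj ((A *v x i) $ k) = (\<Sum>d\<in>UNIV. \<Sum>c\<in>UNIV. A$j$d * x i $ d * cnj (A$k$c * x i $ c))"
      by (simp add: matrix_vector_mult_def sum_product)
    also have "\<dots> = (\<Sum>c\<in>UNIV. \<Sum>d\<in>UNIV. A$j$d * x i $ d * cnj (A$k$c * x i $ c))"
      by (rule sum.swap)
    finally show "(\<Sum>c\<in>UNIV. \<Sum>d\<in>UNIV. of_real (p i) * (A$j$d * x i $ d * cnj (A$k$c * x i $ c)))
      = of_real (p i) * ((A *v x i) $ j * cnj ((A *v x i) $ k))"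
      by (simp only: sum_distrib_left)
  qed
  finally show ?thesis unfolding decL_def e by blast
qed

lemma decR_cstar: "decR z q y \<longleftrightarrow> decL (cstar z) q (\<lambda>i. vcnj (y i))"
  by (simp add: decR_def decL_def vcnj_def mult.commute del: vector_minus_component) blast

lemma decR_unitary:
  assumes "unitary A" "unitary B" "decR z q y"
  shows "decR (A ** z ** B) q (\<lambda>i. y i v* B)"
proof -
  have "vcnj (w v* B) = cstar B *v vcnj w" for w
    by (simp add: vcnj_def vector_matrix_mult_def matrix_vector_mult_def vec_eq_iff mult.commute)
  moreover have "decL (cstar B ** cstar z ** cstar A) q (\<lambda>i. cstar B *v vcnj (y i))"
    using assms by (intro decL_unitary) (auto simp: decR_cstar)
  ultimately show ?thesis by (simp add: decR_cstar cstar_mult matrix_mul_assoc)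
qed

text \<open>The map z \<mapsto> A z B preserves the ball, commutes with multiplication by \<i> and
  sends rank one directions to rank one directions in the way the coefficients transform.\<close>

lemma hf_translate:
  assumes X: "harm_fam (X :: (complex^'n^'m) list \<Rightarrow> complex^'n^'m \<Rightarrow> real)" and A: "unitary A" and B: "unitary B"
  shows "harm_fam (\<lambda>vs z. X (map (\<lambda>v. A ** v ** B) vs) (A ** z ** B))"
proof -
  let ?f = "\<lambda>z::complex^'n^'m. A ** z ** B"
  have bl: "bounded_linear ?f"
    using bounded_linear_compose[OF bounded_linear_mm_left bounded_linear_mm_right] by blast
  have lin: "linear ?f" using bl by (rule bounded_linear.linear)
  have Cl: "?f z \<in> Cl" if "z \<in> Cl" for z using that A B by (rule Cl_unitary)
  have cs: "?f (csm \<i> v) = csm \<i> (?f v)" for v by (simp add: mult_csm csm_mult)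
  have tn: "?f (tens x y) = tens (A *v x) (y v* B)" for x y by (simp add: mult_tens tens_mult)
  show ?thesis
    unfolding harm_fam_def
  proof (intro conjI allI impI ballI)
    fix vs :: "(complex^'n^'m) list" assume "length vs \<le> CARD('n)"
    then have "continuous_on Cl (X (map ?f vs))" by (intro hf_cont X) simp
    then show "continuous_on Cl (\<lambda>z. X (map ?f vs) (?f z))"
      by (rule continuous_on_compose2) (use Cl linear_continuous_on[OF bl] in auto)
  next
    fix ws vs :: "(complex^'n^'m) list" and z :: "complex^'n^'m" assume "length ws + length vs < CARD('n)" "z \<in> Cl"
    then have "linear (\<lambda>v. X (map ?f ws @ v # map ?f vs) (?f z))"
      by (intro hf_linear X Cl) auto
    from linear_compose[OF lin this] show "linear (\<lambda>v. X (map ?f (ws @ v # vs)) (?f z))"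
      by (simp add: o_def)
  next
    fix vs :: "(complex^'n^'m) list" and z v :: "complex^'n^'m" and T t
    assume *: "length vs < CARD('n)" "convex T" "\<forall>s\<in>T. z + s *\<^sub>R v \<in> Cl" "t \<in> T"
    have e: "?f (z + s *\<^sub>R v) = ?f z + s *\<^sub>R ?f v" for s
      using linear_add[OF lin, of z "s *\<^sub>R v"] linear_scale[OF lin, of s v] by simp
    have "((\<lambda>s. X (map ?f vs) (?f z + s *\<^sub>R ?f v)) has_real_derivative X (?f v # map ?f vs) (?f z + t *\<^sub>R ?f v)) (at t within T)"
      using * Cl by (intro hf_deriv X) (auto simp flip: e)
    then show "((\<lambda>s. X (map ?f vs) (?f (z + s *\<^sub>R v))) has_real_derivative X (map ?f (v # vs)) (?f (z + t *\<^sub>R v))) (at t within T)"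
      by (simp add: e)
  next
    fix z :: "complex^'n^'m" and p x q y assume "z \<in> Cl" "decL z p x" "decR z q y"
    then show "(\<Sum>i\<in>UNIV. \<Sum>l\<in>UNIV. p i * q l * Lam (\<lambda>vs z. X (map ?f vs) (?f z)) z (tens (x i) (y l))) = 0"
      using hf_harm[OF X Cl[of z] decL_unitary[OF A B, of z p x] decR_unitary[OF A B, of z q y]]
      by (simp add: Lam_def cs tn)
  qed
qed

lemma hf_uminus:
  assumes X: "harm_fam (X :: (complex^'n^'m) list \<Rightarrow> complex^'n^'m \<Rightarrow> real)"
  shows "harm_fam (\<lambda>vs z. - X vs z)"
  unfolding harm_fam_def
proof (intro conjI allI impI ballI)
  fix z :: "complex^'n^'m" and p x q y assume "z \<in> Cl" "decL z p x" "decR z q y"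
  from hf_harm[OF X this] 
  have "- (\<Sum>i\<in>UNIV. \<Sum>l\<in>UNIV. p i * q l * Lam X z (tens (x i) (y l))) = 0" by simp
  then show "(\<Sum>i\<in>UNIV. \<Sum>l\<in>UNIV. p i * q l * Lam (\<lambda>vs z. - X vs z) z (tens (x i) (y l))) = 0"
    by (simp add: Lam_def sum_negf[symmetric] algebra_simps)
qed (auto intro!: hf_cont[OF X] hf_linear[OF X] hf_deriv[OF X] continuous_intros derivative_intros linear_compose_neg)

lemma hf_expand:
  assumes X: "harm_fam (X :: (complex^'n^'m) list \<Rightarrow> complex^'n^'m \<Rightarrow> real)"
    and l: "length ws + length vs < CARD('n)" and z: "z \<in> Cl"
  shows "X (ws @ v # vs) z = (\<Sum>e\<in>Basis. (v \<bullet> e) * X ((ws @ [e]) @ vs) z)"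
proof -
  note lin = hf_linear[OF X l z]
  have "X (ws @ v # vs) z = X (ws @ (\<Sum>e\<in>Basis. (v \<bullet> e) *\<^sub>R e) # vs) z"
    by (simp add: euclidean_representation)
  also have "\<dots> = (\<Sum>e\<in>Basis. (v \<bullet> e) *\<^sub>R X (ws @ e # vs) z)"
    using linear_sum[OF lin, of "\<lambda>e. (v \<bullet> e) *\<^sub>R e" Basis] linear_scale[OF lin] by simp
  finally show ?thesis by simp
qed

text \<open>Each derivative is continuous only for fixed directions; expanding moving directions in
  a basis by linearity, slot by slot, gives joint continuity.\<close>

lemma hf_joint_continuous:
  fixes T :: "'t::topological_space set" and f :: "'t \<Rightarrow> complex^'n^'m"
  assumes X: "harm_fam X"
    and f: "continuous_on T f" "\<And>t. t \<in> T \<Longrightarrow> f t \<in> Cl"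
    and "\<And>g. g \<in> set gs \<Longrightarrow> continuous_on T g" "length ws + length gs \<le> CARD('n)"
  shows "continuous_on T (\<lambda>t. X (ws @ map (\<lambda>g. g t) gs) (f t))"
  using assms(4,5)
proof (induction gs arbitrary: ws)
  case Nil
  have "continuous_on T (\<lambda>t. X ws (f t))"
    by (rule continuous_on_compose2[OF hf_cont[OF X, of ws] f(1)]) (use Nil f(2) in auto)
  then show ?case by simp
next
  case (Cons g gs)
  have "continuous_on T (\<lambda>t. \<Sum>e\<in>Basis. (g t \<bullet> e) * X ((ws @ [e]) @ map (\<lambda>g. g t) gs) (f t))"
    using Cons.prems by (intro continuous_intros Cons.IH) auto
  moreover have "X (ws @ map (\<lambda>g. g t) (g # gs)) (f t) = (\<Sum>e\<in>Basis. (g t \<bullet> e) * X ((ws @ [e]) @ map (\<lambda>g. g t) gs) (f t))"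
    if "t \<in> T" for t
    using hf_expand[OF X, of ws "map (\<lambda>g. g t) gs" "f t" "g t"] Cons.prems f(2)[OF that] by simp
  ultimately show ?case using continuous_on_cong[OF refl] by fastforce
qed

section \<open>Weighted Haar averages of harmonic families\<close>

definition haar_avg :: "((complex^'n^'m) list \<Rightarrow> complex^'n^'m \<Rightarrow> real) \<Rightarrow> (complex^'n^'n \<Rightarrow> real)
    \<Rightarrow> (complex^'n^'m) list \<Rightarrow> complex^'n^'m \<Rightarrow> real" where
  "haar_avg X q vs z = (LINT B|haar. X (map (\<lambda>v. v ** B) vs) (z ** B) * q B)"

lemma hf_UG_continuous:
  assumes X: "harm_fam (X :: (complex^'n^'m) list \<Rightarrow> complex^'n^'m \<Rightarrow> real)"
    and "length vs \<le> CARD('n)" "z \<in> Cl"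
  shows "continuous_on UG (\<lambda>B. X (map (\<lambda>v. v ** B) vs) (z ** B))"
proof -
  have "continuous_on UG (\<lambda>B. X ([] @ map (\<lambda>g. g B) (map (\<lambda>v B. v ** B) vs)) (z ** B))"
    using assms Cl_unitary_right
    by (intro hf_joint_continuous[OF X]) (auto simp: unitary_UG intro!: continuous_intros)
  then show ?thesis by (simp add: o_def)
qed

text \<open>By compactness one constant serves all points and all group elements; it is the
  dominating function below.\<close>

lemma hf_UG_bounded:
  assumes X: "harm_fam (X :: (complex^'n^'m) list \<Rightarrow> complex^'n^'m \<Rightarrow> real)"
    and "length vs \<le> CARD('n)" and q: "continuous_on UG q"
  obtains K where "\<And>z B. z \<in> Cl \<Longrightarrow> B \<in> UG \<Longrightarrow> \<bar>X (map (\<lambda>v. v ** B) vs) (z ** B) * q B\<bar> \<le> K"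
proof -
  have "continuous_on (Cl \<times> UG) (\<lambda>t. X ([] @ map (\<lambda>g. g t) (map (\<lambda>v t. v ** snd t) vs)) (fst t ** snd t))"
    using assms Cl_unitary_right
    by (intro hf_joint_continuous[OF X]) (auto simp: unitary_UG intro!: continuous_intros)
  then have "continuous_on (Cl \<times> UG) (\<lambda>t. X (map (\<lambda>v. v ** snd t) vs) (fst t ** snd t) * q (snd t))"
    by (intro continuous_intros continuous_on_compose2[OF q]) (auto simp: o_def intro!: continuous_intros)
  then have "bounded ((\<lambda>t. X (map (\<lambda>v. v ** snd t) vs) (fst t ** snd t) * q (snd t)) ` (Cl \<times> UG))"
    by (intro compact_imp_bounded compact_continuous_image compact_Times compact_Cl compact_UG)
  then obtain K where K: "\<forall>r\<in>(\<lambda>t. X (map (\<lambda>v. v ** snd t) vs) (fst t ** snd t) * q (snd t)) ` (Cl \<times> UG). norm r \<le> K"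
    unfolding bounded_iff by blast
  show ?thesis
  proof (rule that[of K])
    fix z :: "complex^'n^'m" and B :: "complex^'n^'n" assume "z \<in> Cl" "B \<in> UG"
    then show "\<bar>X (map (\<lambda>v. v ** B) vs) (z ** B) * q B\<bar> \<le> K"
      using K[rule_format, OF imageI, of "(z, B)"] by simp
  qed
qed

lemma hf_avg_integrable:
  assumes X: "harm_fam (X :: (complex^'n^'m) list \<Rightarrow> complex^'n^'m \<Rightarrow> real)"
    and "length vs \<le> CARD('n)" "z \<in> Cl" and q: "continuous_on UG q"
  shows "integrable haar (\<lambda>B. X (map (\<lambda>v. v ** B) vs) (z ** B) * q B)"
  by (intro haar_integrable continuous_intros hf_UG_continuous assms)

lemma haar_dominated:
  fixes s :: "nat \<Rightarrow> complex^'n^'n \<Rightarrow> real"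
  assumes "\<And>i. integrable haar (s i)" "integrable haar f"
    and "\<And>B. B \<in> UG \<Longrightarrow> (\<lambda>i. s i B) \<longlonglongrightarrow> f B" "\<And>i B. B \<in> UG \<Longrightarrow> \<bar>s i B\<bar> \<le> K"
  shows "(\<lambda>i. LINT B|haar. s i B) \<longlonglongrightarrow> (LINT B|haar. f B)"
proof (rule integral_dominated_convergence)
  show "integrable haar (\<lambda>B::complex^'n^'n. K)" by (intro haar_integrable continuous_intros)
qed (use assms in \<open>auto intro!: AE_I2\<close>)

text \<open>Every limit passes under the integral by dominated convergence with a constant bound.
  The equation is linear and holds for each translate by \<open>hf_translate\<close>. The hypothesis
  on \<open>CARD('n)\<close> keeps the second derivatives in \<open>Lam\<close> among the controlled
  orders.\<close>

lemma hf_avg: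
  assumes X: "harm_fam (X :: (complex^'n^'m) list \<Rightarrow> complex^'n^'m \<Rightarrow> real)" and q: "continuous_on UG q"
    and n2: "2 \<le> CARD('n)"
  shows "harm_fam (haar_avg X q)"
  unfolding harm_fam_def
proof (intro conjI allI impI ballI)
  note int = hf_avg_integrable[OF X _ _ q]
  fix vs :: "(complex^'n^'m) list" assume l: "length vs \<le> CARD('n)"
  obtain K where K: "\<And>z B. z \<in> Cl \<Longrightarrow> B \<in> UG \<Longrightarrow> \<bar>X (map (\<lambda>v. v ** B) vs) (z ** B) * q B\<bar> \<le> K"
    using hf_UG_bounded[OF X l q] by blast
  show "continuous_on Cl (haar_avg X q vs)"
    unfolding continuous_on_sequentially
  proof (intro allI ballI impI, elim conjE)
    fix x and a :: "complex^'n^'m" assume a: "a \<in> Cl" and x: "\<forall>n. x n \<in> Cl" "x \<longlonglongrightarrow> a"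
    show "(haar_avg X q vs \<circ> x) \<longlonglongrightarrow> haar_avg X q vs a"
      unfolding haar_avg_def o_def
    proof (rule haar_dominated[where K=K])
      fix B :: "complex^'n^'n" assume B: "B \<in> UG"
      have "continuous_on Cl (X (map (\<lambda>v. v ** B) vs))" using l by (intro hf_cont X) simp
      moreover have "(\<lambda>i. x i ** B) \<longlonglongrightarrow> a ** B" by (intro tendsto_intros x)
      ultimately have "(\<lambda>i. X (map (\<lambda>v. v ** B) vs) (x i ** B)) \<longlonglongrightarrow> X (map (\<lambda>v. v ** B) vs) (a ** B)"
        by (rule continuous_on_tendsto_compose) (use x a B in \<open>auto simp: unitary_UG Cl_unitary_right\<close>)
      then show "(\<lambda>i. X (map (\<lambda>v. v ** B) vs) (x i ** B) * q B) \<longlonglongrightarrow> X (map (\<lambda>v. v ** B) vs) (a ** B) * q B"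
        by (intro tendsto_intros)
    qed (use int l a x K in auto)
  qed
next
  note int = hf_avg_integrable[OF X _ _ q]
  fix ws vs :: "(complex^'n^'m) list" and z :: "complex^'n^'m" assume l: "length ws + length vs < CARD('n)" and z: "z \<in> Cl"
  have lin: "linear (\<lambda>v. X (map (\<lambda>v. v ** B) (ws @ v # vs)) (z ** B))" if "B \<in> UG" for B
    using linear_compose[OF bounded_linear.linear[OF bounded_linear_mm_left[of B]]
      hf_linear[OF X, of "map (\<lambda>v. v ** B) ws" "map (\<lambda>v. v ** B) vs" "z ** B"]] l z that
    by (simp add: o_def unitary_UG Cl_unitary_right)
  show "linear (\<lambda>v. haar_avg X q (ws @ v # vs) z)"
  proof (rule linearI)
    fix v w
    have "haar_avg X q (ws @ (v + w) # vs) z = (LINT B|haar. X (map (\<lambda>v. v ** B) (ws @ v # vs)) (z ** B) * q B + X (map (\<lambda>v. v ** B) (ws @ w # vs)) (z ** B) * q B)"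
      unfolding haar_avg_def using linear_add[OF lin]
      by (intro Bochner_Integration.integral_cong) (simp_all add: distrib_right)
    then show "haar_avg X q (ws @ (v + w) # vs) z = haar_avg X q (ws @ v # vs) z + haar_avg X q (ws @ w # vs) z"
      unfolding haar_avg_def using l z by (subst (asm) Bochner_Integration.integral_add) (auto intro!: int simp del: map_append list.map)
  next
    fix c v
    have "haar_avg X q (ws @ (c *\<^sub>R v) # vs) z = (LINT B|haar. c * (X (map (\<lambda>v. v ** B) (ws @ v # vs)) (z ** B) * q B))"
      unfolding haar_avg_def using linear_scale[OF lin]
      by (intro Bochner_Integration.integral_cong) (simp_all)
    then show "haar_avg X q (ws @ (c *\<^sub>R v) # vs) z = c *\<^sub>R haar_avg X q (ws @ v # vs) z"
      unfolding haar_avg_def by simp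
  qed
next
  note int = hf_avg_integrable[OF X _ _ q]
  fix vs :: "(complex^'n^'m) list" and z v :: "complex^'n^'m" and T t
  assume l: "length vs < CARD('n)" and T: "convex T" and seg: "\<forall>s\<in>T. z + s *\<^sub>R v \<in> Cl" and t: "t \<in> T"
  obtain K where K: "\<And>z B. z \<in> Cl \<Longrightarrow> B \<in> UG \<Longrightarrow> \<bar>X (map (\<lambda>v. v ** B) (v # vs)) (z ** B) * q B\<bar> \<le> K"
    using hf_UG_bounded[OF X _ q, of "v # vs"] l by auto
  define g where "g s B = X (map (\<lambda>v. v ** B) vs) ((z + s *\<^sub>R v) ** B) * q B" for s B
  define g' where "g' s B = X (map (\<lambda>v. v ** B) (v # vs)) ((z + s *\<^sub>R v) ** B) * q B" for s B
  have der: "((\<lambda>s. g s B) has_real_derivative g' s B) (at s within T)" if "B \<in> UG" "s \<in> T" for B s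
  proof -
    have e: "(z + s *\<^sub>R v) ** B = z ** B + s *\<^sub>R (v ** B)" for s by (simp add: mm_distribs)
    show ?thesis
      unfolding g_def g'_def e list.map using that l T seg
      by (intro DERIV_cmult_right hf_deriv X) (auto simp: unitary_UG simp flip: e intro: Cl_unitary_right)
  qed
  have g_int: "integrable haar (g s)" if "s \<in> T" for s
    unfolding g_def using that l seg by (intro int) auto
  have "((\<lambda>s. LINT B|haar. g s B) has_real_derivative (LINT B|haar. g' t B)) (at t within T)"
    unfolding has_field_derivative_iff tendsto_at_iff_sequentially
  proof (intro allI impI)
    fix S assume S: "\<forall>i. S i \<in> T - {t}" "S \<longlonglongrightarrow> t"
    have "(\<lambda>i. LINT B|haar. (g (S i) B - g t B) / (S i - t)) \<longlonglongrightarrow> (LINT B|haar. g' t B)"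
    proof (rule haar_dominated)
      fix B :: "complex^'n^'n" assume B: "B \<in> UG"
      show "(\<lambda>i. (g (S i) B - g t B) / (S i - t)) \<longlonglongrightarrow> g' t B"
        using der[OF B t] S unfolding has_field_derivative_iff tendsto_at_iff_sequentially by (auto simp: o_def)
      fix i
      \<comment> \<open>The mean value inequality bounds the difference quotients by the bound on
        the derivative.\<close>
      have "norm (g (S i) B - g t B) \<le> K * norm (S i - t)"
        using S t seg B by (intro field_differentiable_bound[OF T der[OF B]]) (auto simp: g'_def intro!: K simp del: list.map)
      then show "\<bar>(g (S i) B - g t B) / (S i - t)\<bar> \<le> K"
        using S(1) by (simp add: abs_divide divide_le_eq)
    next
      show "integrable haar (g' t)" unfolding g'_def using l seg t by (intro int) auto
      show "integrable haar (\<lambda>B. (g (S i) B - g t B) / (S i - t))" for i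
        using S(1) t by (intro integrable_divide_zero Bochner_Integration.integrable_diff g_int) auto
    qed
    moreover have "(LINT B|haar. (g (S i) B - g t B) / (S i - t)) = ((LINT B|haar. g (S i) B) - (LINT B|haar. g t B)) / (S i - t)" for i
      using S(1) t by (simp add: Bochner_Integration.integral_diff[OF g_int g_int])
    ultimately show "((\<lambda>s. ((LINT B|haar. g s B) - (LINT B|haar. g t B)) / (s - t)) \<circ> S) \<longlonglongrightarrow> (LINT B|haar. g' t B)"
      unfolding o_def by (simp only:)
  qed
  then show "((\<lambda>s. haar_avg X q vs (z + s *\<^sub>R v)) has_real_derivative haar_avg X q (v # vs) (z + t *\<^sub>R v)) (at t within T)"
    by (simp add: haar_avg_def g_def g'_def)
next
  note int = hf_avg_integrable[OF X _ _ q]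
  fix z :: "complex^'n^'m" and p x q' y assume z: "z \<in> Cl" "decL z p x" "decR z q' y"
  show "(\<Sum>i\<in>UNIV. \<Sum>l\<in>UNIV. p i * q' l * Lam (haar_avg X q) z (tens (x i) (y l))) = 0"
  proof -
    define L where "L B i l = Lam (\<lambda>vs z. X (map (\<lambda>v. v ** B) vs) (z ** B)) z (tens (x i) (y l)) * q B" for B i l
    have i: "integrable haar (\<lambda>B. X (map (\<lambda>v. v ** B) [v, v]) (z ** B) * q B)" for v
      using z n2 by (intro int) auto
    have Le: "(\<lambda>B. L B i l) = (\<lambda>B. X (map (\<lambda>v. v ** B) [tens (x i) (y l), tens (x i) (y l)]) (z ** B) * q B
      + X (map (\<lambda>v. v ** B) [csm \<i> (tens (x i) (y l)), csm \<i> (tens (x i) (y l))]) (z ** B) * q B)" for i l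
      by (simp add: L_def Lam_def distrib_right)
    have Lint: "integrable haar (\<lambda>B. L B i l)" for i l
      unfolding Le by (intro Bochner_Integration.integrable_add i)
    have "Lam (haar_avg X q) z (tens (x i) (y l)) = (LINT B|haar. L B i l)" for i l
      unfolding Le by (subst Bochner_Integration.integral_add[OF i i]) (simp add: Lam_def haar_avg_def)
    then have "(\<Sum>i\<in>UNIV. \<Sum>l\<in>UNIV. p i * q' l * Lam (haar_avg X q) z (tens (x i) (y l)))
       = (LINT B|haar. (\<Sum>i\<in>UNIV. \<Sum>l\<in>UNIV. p i * q' l * L B i l))"
      by (subst Bochner_Integration.integral_sum, (intro Bochner_Integration.integrable_sum integrable_mult_right Lint),
          subst Bochner_Integration.integral_sum, (intro integrable_mult_right Lint), simp)
    also have "\<dots> = (LINT B|(haar :: (complex^'n^'n) measure). 0)"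
    proof (rule Bochner_Integration.integral_cong[OF refl])
      fix B :: "complex^'n^'n" assume "B \<in> space haar"
      then have "unitary B" by (simp add: unitary_UG)
      from hf_translate[OF X unitary_mat this]
      have "harm_fam (\<lambda>vs z. X (map (\<lambda>v. v ** B) vs) (z ** B))" by simp
      from hf_harm[OF this z]
      have "(\<Sum>i\<in>UNIV. \<Sum>l\<in>UNIV. p i * q' l * Lam (\<lambda>vs z. X (map (\<lambda>v. v ** B) vs) (z ** B)) z (tens (x i) (y l))) * q B = 0"
        by simp
      then show "(\<Sum>i\<in>UNIV. \<Sum>l\<in>UNIV. p i * q' l * L B i l) = 0"
        by (simp add: L_def sum_distrib_right mult.assoc)
    qed
    finally show ?thesis by simp
  qed
qed

subsection \<open>The maximum principle\<close>

lemma second_derivative_at_max: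
  fixes f :: "real \<Rightarrow> real"
  assumes d: "d > 0" and f: "\<And>t. \<bar>t\<bar> < d \<Longrightarrow> (f has_real_derivative f' t) (at t)"
    and f'': "(f' has_real_derivative D) (at 0)" and max: "\<And>t. \<bar>t\<bar> < d \<Longrightarrow> f t \<le> f 0"
  shows "D \<le> 0"
proof (rule ccontr)
  assume "\<not> D \<le> 0"
  have "f' 0 = 0"
    by (rule DERIV_local_max[OF f[of 0] d]) (use d max in auto)
  then obtain e where e: "e > 0" "\<And>h. 0 < h \<Longrightarrow> h < e \<Longrightarrow> 0 < f' h"
    using DERIV_pos_inc_right[OF f''] \<open>\<not> D \<le> 0\<close> by force
  define h where "h = min d e / 2"
  have h: "0 < h" "h < d" "h < e" using d e by (auto simp: h_def)
  have "\<exists>z. 0 < z \<and> z < h \<and> f h - f 0 = (h - 0) * f' z"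
    using h by (intro MVT2) (auto intro: f)
  then obtain z where "0 < z" "z < h" "f h - f 0 = h * f' z" by auto
  moreover from this have "0 < h * f' z" using e(2) h by simp
  ultimately show False using max[of h] h by simp
qed

lemma cip_decomposition:
  fixes M :: "complex^'m^'m" and x :: "'m \<Rightarrow> complex^'m"
  assumes "\<And>j k. M$j$k = (\<Sum>i\<in>UNIV. x i $ j * cnj (x i $ k))"
  shows "Re (cip w (M *v w)) = (\<Sum>i\<in>UNIV. (norm (cip (x i) w))\<^sup>2)"
proof -
  have "cip w (M *v w) = (\<Sum>j\<in>UNIV. \<Sum>k\<in>UNIV. \<Sum>i\<in>UNIV. cnj (w$j) * x i $ j * (cnj (x i $ k) * w $ k))"
    by (simp add: cip_def matrix_vector_mult_def assms sum_distrib_left sum_distrib_right mult_ac)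
  also have "\<dots> = (\<Sum>j\<in>UNIV. \<Sum>i\<in>UNIV. \<Sum>k\<in>UNIV. cnj (w$j) * x i $ j * (cnj (x i $ k) * w $ k))"
    by (intro sum.cong refl sum.swap)
  also have "\<dots> = (\<Sum>i\<in>UNIV. \<Sum>j\<in>UNIV. \<Sum>k\<in>UNIV. cnj (w$j) * x i $ j * (cnj (x i $ k) * w $ k))"
    by (rule sum.swap)
  also have "\<dots> = (\<Sum>i\<in>UNIV. cip w (x i) * cip (x i) w)"
    by (simp add: cip_def sum_product)
  also have "\<dots> = (\<Sum>i\<in>UNIV. of_real ((norm (cip (x i) w))\<^sup>2))"
    by (intro sum.cong refl) (metis cip_cnj complex_norm_square mult.commute)
  finally show ?thesis by (simp del: of_real_power)
qed

lemma cip_defect: "Re (cip w ((mat 1 - z ** cstar z) *v w)) = (norm w)\<^sup>2 - (norm (cstar z *v w))\<^sup>2"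
  for z :: "complex^'n^'m"
proof -
  have "cip w ((z ** cstar z) *v w) = cip (cstar z *v w) (cstar z *v w)"
    by (simp add: cip_adj flip: matrix_vector_mul_assoc)
  then show ?thesis
    by (simp add: matrix_vector_mult_diff_rdistrib cip_diff_right cip_self del: of_real_power)
qed

text \<open>Expanding the square of |w - z^* z w| gives 0 \<le> |w|^2 - 2 |z w|^2 + |z^* z w|^2, and
  the last term is at most |z w|^2.\<close>

lemma Cl_cstar:
  fixes z :: "complex^'n^'m"
  assumes "z \<in> Cl" shows "cstar z \<in> Cl"
proof -
  have "norm (z *v w) \<le> norm w" for w
  proof -
    have "0 \<le> (norm (z *v w))\<^sup>2 - (norm (cstar z *v (z *v w)))\<^sup>2" "0 \<le> (norm (w - cstar z *v (z *v w)))\<^sup>2"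
      using assms by (auto simp: Cl_def)
    moreover have "of_real ((norm (w - cstar z *v (z *v w)))\<^sup>2)
      = (of_real ((norm w)\<^sup>2 - 2 * (norm (z *v w))\<^sup>2 + (norm (cstar z *v (z *v w)))\<^sup>2) :: complex)"
    proof -
      have "cip (cstar z *v (z *v w)) w = cip (z *v w) (z *v w)" by (rule cip_adj)
      moreover from this have "cip w (cstar z *v (z *v w)) = cip (z *v w) (z *v w)"
        by (metis cip_cnj)
      ultimately show ?thesis
        unfolding cip_self[symmetric] of_real_add of_real_diff of_real_mult by (simp add: cip_diff_left cip_diff_right)
    qed
    then have "(norm (w - cstar z *v (z *v w)))\<^sup>2 = (norm w)\<^sup>2 - 2 * (norm (z *v w))\<^sup>2 + (norm (cstar z *v (z *v w)))\<^sup>2"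
      by (simp only: of_real_eq_iff)
    ultimately have "(norm (z *v w))\<^sup>2 \<le> (norm w)\<^sup>2" by linarith
    then show ?thesis by (rule power2_le_imp_le) simp
  qed
  then show ?thesis by (simp add: Cl_def)
qed

lemma decL_exists:
  fixes z :: "complex^'n^'m"
  assumes "z \<in> Cl"
  shows "\<exists>x. decL z (\<lambda>_. 1) x"
proof -
  have "0 \<le> Re (cip w ((mat 1 - z ** cstar z) *v w))" for w
    using assms unfolding cip_defect by (simp add: Cl_def)
  moreover have "cstar (mat 1 - z ** cstar z) = mat 1 - z ** cstar z"
    by (simp add: cstar_diff cstar_mult)
  ultimately show ?thesis
    using psd_decomposition[of "mat 1 - z ** cstar z"] by (simp add: decL_def)
qed

lemma decR_exists:
  fixes z :: "complex^'n^'m"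
  assumes "z \<in> Cl"
  shows "\<exists>y. decR z (\<lambda>_. 1) y"
proof -
  obtain x where "decL (cstar z) (\<lambda>_. 1) x" using decL_exists[OF Cl_cstar[OF assms]] by blast
  moreover have "vcnj (vcnj v) = v" for v :: "complex^'n" by (simp add: vcnj_def vec_eq_iff)
  ultimately have "decR z (\<lambda>_. 1) (\<lambda>i. vcnj (x i))" by (simp add: decR_cstar)
  then show ?thesis by blast
qed

lemma decL_bound:
  assumes "decL z (\<lambda>_. 1) x"
  shows "(norm (cip (x i) w))\<^sup>2 \<le> (norm w)\<^sup>2 - (norm (cstar z *v w))\<^sup>2"
proof -
  have "(norm w)\<^sup>2 - (norm (cstar z *v w))\<^sup>2 = (\<Sum>i\<in>UNIV. (norm (cip (x i) w))\<^sup>2)"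
    using cip_decomposition[of "mat 1 - z ** cstar z" x w] assms unfolding cip_defect decL_def by simp
  then show ?thesis using member_le_sum[of i UNIV "\<lambda>i. (norm (cip (x i) w))\<^sup>2"] by simp
qed

lemma decL_trace:
  fixes z :: "complex^'n^'m"
  assumes "decL z (\<lambda>_. 1) x"
  shows "(\<Sum>i\<in>UNIV. (norm (x i))\<^sup>2) = CARD('m) - (norm z)\<^sup>2"
proof -
  have "of_real (1 - (norm (z $ j))\<^sup>2) = (of_real (\<Sum>i\<in>UNIV. (norm (x i $ j))\<^sup>2) :: complex)" for j
  proof -
    have "of_real (\<Sum>i\<in>UNIV. (norm (x i $ j))\<^sup>2) = (mat 1 - z ** cstar z)$j$j"
      using assms unfolding decL_def by (simp add: complex_norm_square del: of_real_power)
    then show ?thesis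
      by (simp add: mat_def matrix_matrix_mult_def norm_vec_sq complex_norm_square del: of_real_power)
  qed
  then have "1 - (norm (z $ j))\<^sup>2 = (\<Sum>i\<in>UNIV. (norm (x i $ j))\<^sup>2)" for j
    by (simp only: of_real_eq_iff)
  then have "(\<Sum>j\<in>UNIV. 1 - (norm (z $ j))\<^sup>2) = (\<Sum>j\<in>UNIV. \<Sum>i\<in>UNIV. (norm (x i $ j))\<^sup>2)" by simp
  also have "\<dots> = (\<Sum>i\<in>UNIV. (norm (x i))\<^sup>2)" unfolding norm_vec_sq by (rule sum.swap)
  finally show ?thesis by (simp add: sum_subtractf norm_vec_sq[of z])
qed

lemma decR_trace:
  fixes z :: "complex^'n^'m"
  assumes "decR z (\<lambda>_. 1) y"
  shows "(\<Sum>i\<in>UNIV. (norm (y i))\<^sup>2) = CARD('n) - (norm z)\<^sup>2"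
  using decL_trace[of "cstar z" "\<lambda>i. vcnj (y i)"] assms by (simp add: decR_cstar)

text \<open>If x and y are dominated by the two defects of z, the rank one perturbation stays in the
  closed ball even when z is a boundary point. The maximum principle needs exactly such directions,
  since they are those occurring in the operator.\<close>

lemma Cl_perturb:
  fixes z :: "complex^'n^'m"
  assumes x: "\<And>w. (norm (cip x w))\<^sup>2 \<le> (norm w)\<^sup>2 - (norm (cstar z *v w))\<^sup>2"
    and y: "\<And>w. (norm (cip (vcnj y) w))\<^sup>2 \<le> (norm w)\<^sup>2 - (norm (z *v w))\<^sup>2"
    and t: "\<bar>t\<bar> < 1/3"
  shows "z + t *\<^sub>R tens x y \<in> Cl"
proof -
  have y1: "norm y \<le> 1"
  proof -
    have "((norm y)\<^sup>2)\<^sup>2 \<le> (norm y)\<^sup>2 - (norm (z *v vcnj y))\<^sup>2"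
      using y[of "vcnj y"] by (simp add: cip_self del: of_real_power)
    also have "\<dots> \<le> (norm y)\<^sup>2 * 1" by simp
    finally have q: "(norm y)\<^sup>2 * (norm y)\<^sup>2 \<le> (norm y)\<^sup>2 * 1"
      by (simp only: power2_eq_square[of "(norm y)\<^sup>2"])
    have "(norm y)\<^sup>2 \<le> 1"
    proof (rule ccontr)
      assume "\<not> ?thesis"
      then have "1 < (norm y)\<^sup>2" by linarith
      moreover from this have "0 < (norm y)\<^sup>2" by linarith
      ultimately have "(norm y)\<^sup>2 * 1 < (norm y)\<^sup>2 * (norm y)\<^sup>2" by (rule mult_strict_left_mono)
      then show False using q by linarith
    qed
    then show ?thesis by (simp add: abs_square_le_1)
  qed
  have "norm (cstar (z + t *\<^sub>R tens x y) *v w) \<le> norm w" for w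
  proof -
    define v where "v = cstar z *v w"
    define D where "D = (norm w)\<^sup>2 - (norm v)\<^sup>2"
    define a where "a = cip x w"
    define b where "b = cip (vcnj y) v"
    have a: "(norm a)\<^sup>2 \<le> D" using x[of w] by (simp add: a_def D_def v_def)
    have "of_real ((norm (w - z *v v))\<^sup>2)
      = (of_real ((norm w)\<^sup>2 - 2 * (norm v)\<^sup>2 + (norm (z *v v))\<^sup>2) :: complex)"
    proof -
      have "cip w (z *v v) = cip v v" by (simp add: v_def flip: cip_adj)
      moreover from this have "cip (z *v v) w = cip v v" by (metis cip_cnj)
      ultimately show ?thesis
        unfolding cip_self[symmetric] of_real_add of_real_diff of_real_mult by (simp add: cip_diff_left cip_diff_right)
    qed
    then have "(norm (w - z *v v))\<^sup>2 = (norm w)\<^sup>2 - 2 * (norm v)\<^sup>2 + (norm (z *v v))\<^sup>2"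
      by (simp only: of_real_eq_iff)
    then have "(norm v)\<^sup>2 - (norm (z *v v))\<^sup>2 \<le> D"
      \<comment> \<open>The square of |w - z v| transfers the defect of \<open>z\<close> at v = z^*
        w to the defect of \<open>cstar z\<close> at w, so that x and y are compared with the same
        \<open>D\<close>.\<close>
      using zero_le_power2[of "norm (w - z *v v)"] unfolding D_def by linarith
    then have b: "(norm b)\<^sup>2 \<le> D" using y[of v] unfolding b_def by linarith
    have ab: "norm a * norm b \<le> D"
      using sum_squares_bound[of "norm a" "norm b"] a b by linarith
    have D0: "0 \<le> D" using a zero_le_power2[of "norm a"] by linarith
    have "cstar (z + t *\<^sub>R tens x y) *v w = v + t *\<^sub>R (a *s vcnj y)"
      by (simp add: cstar_add cstar_scaleR matrix_vector_mult_add_rdistrib mv_scaleR cstar_tens_mv v_def a_def)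
    also have "\<dots> = v + (of_real t * a) *s vcnj y"
      by (simp add: vec_eq_iff) (simp add: scaleR_conv_of_real)
    finally have e: "cstar (z + t *\<^sub>R tens x y) *v w = v + (of_real t * a) *s vcnj y" .
    have "cip (v + (of_real t * a) *s vcnj y) (v + (of_real t * a) *s vcnj y)
      = cip v v + of_real t * a * cnj b + of_real t * cnj a * b + of_real (t\<^sup>2 * (norm a)\<^sup>2 * (norm y)\<^sup>2)"
    proof -
      have "cip v (vcnj y) = cnj b" by (simp add: b_def cip_cnj)
      moreover have "cip (vcnj y) (vcnj y) = of_real ((norm y)\<^sup>2)" by (simp add: cip_self)
      moreover have "a * cnj a = of_real ((norm a)\<^sup>2)" by (rule complex_norm_square[symmetric])
      ultimately show ?thesis
        by (simp add: cip_add_left cip_add_right cip_scale_left cip_scale_right power2_eq_square algebra_simps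
            del: of_real_power flip: b_def)
    qed
    then have "Re (cip (v + (of_real t * a) *s vcnj y) (v + (of_real t * a) *s vcnj y))
      = (norm v)\<^sup>2 + 2 * t * Re (cnj a * b) + t\<^sup>2 * (norm a)\<^sup>2 * (norm y)\<^sup>2"
      by (simp add: cip_self algebra_simps del: of_real_power)
    then have "(norm (cstar (z + t *\<^sub>R tens x y) *v w))\<^sup>2 = (norm v)\<^sup>2 + 2 * t * Re (cnj a * b) + t\<^sup>2 * (norm a)\<^sup>2 * (norm y)\<^sup>2"
      unfolding e cip_self by (simp only: Re_complex_of_real)
    \<comment> \<open>With |t| < 1/3 the surplus over |v|^2 is at most 7/9 of \<open>D\<close>,
      while |w|^2 - |v|^2 is all of \<open>D\<close>.\<close>
    also have "\<dots> \<le> (norm v)\<^sup>2 + 2/3 * D + 1/9 * D"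
    proof (intro add_mono order_refl)
      have "2 * t * Re (cnj a * b) \<le> 2 * (\<bar>t\<bar> * \<bar>Re (cnj a * b)\<bar>)"
        using abs_ge_self[of "t * Re (cnj a * b)"] by (simp add: abs_mult)
      also have "\<dots> \<le> 2 * (1/3 * D)"
      proof (intro mult_left_mono mult_mono)
        have "\<bar>Re (cnj a * b)\<bar> \<le> norm (cnj a * b)" by (rule abs_Re_le_cmod)
        then show "\<bar>Re (cnj a * b)\<bar> \<le> D" using ab by (simp add: norm_mult)
      qed (use t in auto)
      finally show "2 * t * Re (cnj a * b) \<le> 2/3 * D" by simp
      have "(norm y)\<^sup>2 \<le> 1" using y1 by (simp add: power_le_one)
      moreover have "t\<^sup>2 \<le> 1/9" using t power_mono[of "\<bar>t\<bar>" "1/3" 2] by (simp add: power2_eq_square)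
      ultimately have "t\<^sup>2 * (norm a)\<^sup>2 * (norm y)\<^sup>2 \<le> 1/9 * D * 1"
        using a D0 by (intro mult_mono) auto
      then show "t\<^sup>2 * (norm a)\<^sup>2 * (norm y)\<^sup>2 \<le> 1/9 * D" by simp
    qed
    also have "\<dots> \<le> (norm w)\<^sup>2" using D0 D_def by linarith
    finally show ?thesis by (rule power2_le_imp_le) simp
  qed
  then show ?thesis by (simp add: Cl_def)
qed

lemma hf_second_deriv:
  fixes X :: "(complex^'n^'m) list \<Rightarrow> complex^'n^'m \<Rightarrow> real"
  assumes X: "harm_fam X" and n2: "2 \<le> CARD('n)" and seg: "\<And>t. \<bar>t\<bar> < d \<Longrightarrow> z + t *\<^sub>R v \<in> Cl"
  shows "\<bar>t\<bar> < d \<Longrightarrow> ((\<lambda>s. X [] (z + s *\<^sub>R v)) has_real_derivative X [v] (z + t *\<^sub>R v)) (at t)"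
    and "\<bar>t\<bar> < d \<Longrightarrow> ((\<lambda>s. X [v] (z + s *\<^sub>R v)) has_real_derivative X [v, v] (z + t *\<^sub>R v)) (at t)"
proof -
  have T: "convex {-d<..<d}" "open {-d<..<d}" by auto
  { assume t: "\<bar>t\<bar> < d"
    then have t': "t \<in> {-d<..<d}" by auto
    show "((\<lambda>s. X [] (z + s *\<^sub>R v)) has_real_derivative X [v] (z + t *\<^sub>R v)) (at t)"
      using hf_deriv[OF X _ T(1) _ t', of "[]" z v] at_within_open[OF t' T(2)] seg n2 by (auto simp: abs_less_iff)
    show "((\<lambda>s. X [v] (z + s *\<^sub>R v)) has_real_derivative X [v, v] (z + t *\<^sub>R v)) (at t)"
      using hf_deriv[OF X _ T(1) _ t', of "[v]" z v] at_within_open[OF t' T(2)] seg n2 by (auto simp: abs_less_iff) }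
qed

text \<open>The term e |z|^2 makes the operator strictly positive. At a maximum of \<open>F\<close>,
  the second derivatives along \<open>tens (x i) (y l)\<close> and \<i> times it are at most 0,
  boundary points included by \<open>Cl_perturb\<close>. Summed, they give 4 e times the product of
  the traces of the two defects, so the maximum lies on the Shilov boundary.\<close>

lemma max_principle_le:
  fixes X :: "(complex^'n^'m) list \<Rightarrow> complex^'n^'m \<Rightarrow> real"
  assumes X: "harm_fam X" and n2: "2 \<le> CARD('n)" and mn: "CARD('m) \<le> CARD('n)"
    and bd: "\<And>z. z \<in> Cl \<Longrightarrow> z ** cstar z = mat 1 \<Longrightarrow> X [] z = c" and z: "z \<in> Cl"
  shows "X [] z \<le> c"
proof -
  have main: "X [] z \<le> c + e * CARD('m)" if e: "e > 0" for e :: real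
  proof -
    define F where "F z = X [] z + e * (norm z)\<^sup>2" for z
    have "continuous_on Cl F"
      unfolding F_def by (intro continuous_intros hf_cont X) simp
    then obtain z0 where z0: "z0 \<in> Cl" "\<And>y. y \<in> Cl \<Longrightarrow> F y \<le> F z0"
      using continuous_attains_sup[OF compact_Cl] zero_in_Cl by (metis empty_iff)
    have tr: "(norm z0)\<^sup>2 \<le> CARD('m)"
    proof -
      obtain x where "decL z0 (\<lambda>_. 1) x" using decL_exists[OF z0(1)] by blast
      from decL_trace[OF this] show ?thesis
        using sum_nonneg[of UNIV "\<lambda>i. (norm (x i))\<^sup>2"] by simp
    qed
    have "z0 ** cstar z0 = mat 1"
    proof (rule ccontr)
      assume ne: "z0 ** cstar z0 \<noteq> mat 1"
      obtain x where x: "decL z0 (\<lambda>_. 1) x" using decL_exists[OF z0(1)] by blast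
      obtain y where y: "decR z0 (\<lambda>_. 1) y" using decR_exists[OF z0(1)] by blast
      have neg: "X [v, v] z0 + 2 * e * (norm v)\<^sup>2 \<le> 0" if v: "v = tens (a *s x i) (y l)" "norm a = 1" for v a i l
      proof -
        have seg: "z0 + t *\<^sub>R v \<in> Cl" if "\<bar>t\<bar> < 1/3" for t
          unfolding v(1)
        proof (rule Cl_perturb[OF _ _ that])
          show "(norm (cip (a *s x i) w))\<^sup>2 \<le> (norm w)\<^sup>2 - (norm (cstar z0 *v w))\<^sup>2" for w
            using decL_bound[OF x, of i w] v(2) by (simp add: cip_scale_left norm_mult)
          show "(norm (cip (vcnj (y l)) w))\<^sup>2 \<le> (norm w)\<^sup>2 - (norm (z0 *v w))\<^sup>2" for w
            using decL_bound[of "cstar z0" "\<lambda>i. vcnj (y i)" l w] y by (simp add: decR_cstar)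
        qed
        have n: "(norm (z0 + s *\<^sub>R v))\<^sup>2 = (norm z0)\<^sup>2 + 2 * s * (z0 \<bullet> v) + s\<^sup>2 * (norm v)\<^sup>2" for s
          by (simp only: power2_norm_eq_inner) (simp add: inner_add_left inner_add_right inner_commute[of v z0] power2_eq_square algebra_simps)
        show ?thesis
        proof (rule second_derivative_at_max)
          show "(0::real) < 1/3" by simp
          show "((\<lambda>s. F (z0 + s *\<^sub>R v)) has_real_derivative X [v] (z0 + t *\<^sub>R v) + e * (2 * (z0 \<bullet> v) + 2 * t * (norm v)\<^sup>2)) (at t)"
            if "\<bar>t\<bar> < 1/3" for t
            unfolding F_def n
            by (auto intro!: derivative_eq_intros hf_second_deriv(1)[OF X n2 seg that])
          show "((\<lambda>t. X [v] (z0 + t *\<^sub>R v) + e * (2 * (z0 \<bullet> v) + 2 * t * (norm v)\<^sup>2)) has_real_derivative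
            X [v, v] z0 + 2 * e * (norm v)\<^sup>2) (at 0)"
            using hf_second_deriv(2)[OF X n2 seg, of "1/3" 0] by (auto intro!: derivative_eq_intros)
          show "F (z0 + t *\<^sub>R v) \<le> F (z0 + 0 *\<^sub>R v)" if "\<bar>t\<bar> < 1/3" for t
            using z0(2) seg[OF that] by simp
        qed
      qed
      have le: "Lam X z0 (tens (x i) (y l)) + 4 * e * ((norm (x i))\<^sup>2 * (norm (y l))\<^sup>2) \<le> 0" for i l
      proof -
        have i: "norm (\<i> *s x i) = norm (x i)" by (simp add: norm_vec_def norm_mult)
        have "Lam X z0 (tens (x i) (y l)) + 2 * (2 * e * ((norm (x i))\<^sup>2 * (norm (y l))\<^sup>2)) \<le> 0"
          using neg[of "tens (1 *s x i) (y l)" 1 i l] neg[of "tens (\<i> *s x i) (y l)" \<i> i l]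
          by (simp add: Lam_def csm_tens norm_tens i)
        then show ?thesis by simp
      qed
      have "(\<Sum>i\<in>UNIV. \<Sum>l\<in>UNIV. 1 * 1 * Lam X z0 (tens (x i) (y l)) + 4 * e * ((norm (x i))\<^sup>2 * (norm (y l))\<^sup>2)) \<le> 0"
        using le by (intro sum_nonpos) simp
      then have "(\<Sum>i\<in>UNIV. \<Sum>l\<in>UNIV. 4 * e * ((norm (x i))\<^sup>2 * (norm (y l))\<^sup>2)) \<le> 0"
        using hf_harm[OF X z0(1) x y] by (simp only: sum.distrib)
      then have "4 * e * ((\<Sum>i\<in>UNIV. (norm (x i))\<^sup>2) * (\<Sum>l\<in>UNIV. (norm (y l))\<^sup>2)) \<le> 0"
        unfolding sum_product by (simp only: sum_distrib_left)
      then have le0: "(\<Sum>i\<in>UNIV. (norm (x i))\<^sup>2) * (\<Sum>l\<in>UNIV. (norm (y l))\<^sup>2) \<le> 0"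
        using e by (simp add: mult_le_0_iff)
      have pos: "0 < (\<Sum>i\<in>UNIV. (norm (x i))\<^sup>2)"
      proof (rule ccontr)
        assume "\<not> ?thesis"
        then have "(\<Sum>i\<in>UNIV. (norm (x i))\<^sup>2) = 0"
          using sum_nonneg[of UNIV "\<lambda>i. (norm (x i))\<^sup>2"] by simp
        then have "x i = 0" for i by (simp add: sum_nonneg_eq_0_iff)
        then have "mat 1 - z0 ** cstar z0 = 0"
          using x unfolding decL_def by (simp add: vec_eq_iff)
        then show False using ne by simp
      qed
      \<comment> \<open>The traces are m - |z0|^2 and n - |z0|^2, so m \<le> n makes the second
        positive along with the first.\<close>
      moreover have "(\<Sum>i\<in>UNIV. (norm (x i))\<^sup>2) \<le> (\<Sum>l\<in>UNIV. (norm (y l))\<^sup>2)"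
        unfolding decL_trace[OF x] decR_trace[OF y] using mn by simp
      ultimately show False using le0 by (smt (verit) mult_pos_pos)
    qed
    then have "F z0 = c + e * (norm z0)\<^sup>2" using bd z0(1) by (simp add: F_def)
    then have "X [] z + e * (norm z)\<^sup>2 \<le> c + e * (norm z0)\<^sup>2"
      using z0(2)[OF z] by (simp add: F_def)
    moreover have "0 \<le> e * (norm z)\<^sup>2" "e * (norm z0)\<^sup>2 \<le> e * CARD('m)" using e tr by auto
    ultimately show ?thesis by linarith
  qed
  have "X [] z \<le> c + d" if "d > 0" for d :: real
    using that main[of "d / CARD('m)"] by simp
  then show ?thesis by (rule field_le_epsilon)
qed

lemma max_principle:
  fixes X :: "(complex^'n^'m) list \<Rightarrow> complex^'n^'m \<Rightarrow> real"
  assumes X: "harm_fam X" and n2: "2 \<le> CARD('n)" and mn: "CARD('m) \<le> CARD('n)"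
    and bd: "\<And>z. z \<in> Cl \<Longrightarrow> z ** cstar z = mat 1 \<Longrightarrow> X [] z = c" and z: "z \<in> Cl"
  shows "X [] z = c"
  using max_principle_le[OF X n2 mn bd z] max_principle_le[OF hf_uminus[OF X] n2 mn _ z, of "-c"] bd by force

subsection \<open>Two ordinary differential equations with regular singular points\<close>

lemma constant_on_unit_interval:
  fixes f :: "real \<Rightarrow> real"
  assumes "continuous_on {0..1} f" "\<And>r. 0 < r \<Longrightarrow> r < 1 \<Longrightarrow> f r = c" "r \<in> {0..1}"
  shows "f r = c"
proof -
  have "closure {0<..<1::real} = {0..1}" by simp
  then show ?thesis
    using continuous_constant_on_closure[of "{0<..<1}" f c r] assms by auto
qed

lemma zero_derivative_constant:
  fixes f :: "real \<Rightarrow> real"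
  assumes "\<And>r. 0 < r \<Longrightarrow> r < 1 \<Longrightarrow> (f has_real_derivative 0) (at r)"
  shows "\<exists>c. \<forall>r. 0 < r \<longrightarrow> r < 1 \<longrightarrow> f r = c"
proof -
  have "\<exists>c. \<forall>r\<in>{0<..<1}. f r = c"
    by (rule has_field_derivative_zero_constant) (auto intro: assms has_field_derivative_at_within)
  then show ?thesis by auto
qed

text \<open>A polynomial vanishes at 0 to an integer order, so a bound of order N - 1/2 improves to
  order N. The induction splits off one factor x at a time.\<close>

lemma poly_small_near_0:
  fixes q :: "real poly"
  assumes "\<And>x. 0 < x \<Longrightarrow> x < 1 \<Longrightarrow> \<bar>poly q x\<bar> \<le> C * x ^ N / sqrt x"
  shows "\<exists>M. \<forall>x. 0 < x \<longrightarrow> x < 1 \<longrightarrow> \<bar>poly q x\<bar> \<le> M * x ^ N"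
  using assms
proof (induction N arbitrary: q)
  case 0
  have "compact (poly q ` {0..1})" by (intro compact_continuous_image continuous_intros) auto
  then obtain M where "\<And>y. y \<in> poly q ` {0..1} \<Longrightarrow> norm y \<le> M"
    using compact_imp_bounded bounded_iff by metis
  then have "\<bar>poly q x\<bar> \<le> M" if "0 < x" "x < 1" for x using that by fastforce
  then show ?case by auto
next
  case (Suc N)
  have s: "C * x ^ Suc N / sqrt x = C * x ^ N * sqrt x" if "0 < x" for x
    using that by (simp add: field_simps)
  have "poly q 0 = 0"
  proof -
    have "(poly q \<longlongrightarrow> poly q 0) (at_right 0)"
      by (intro tendsto_intros filterlim_ident)
    moreover have "(poly q \<longlongrightarrow> 0) (at_right 0)"
    proof (rule Lim_null_comparison)
      show "\<forall>\<^sub>F x in at_right 0. norm (poly q x) \<le> C * x ^ N * sqrt x"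
        unfolding eventually_at_right_field using Suc.prems s by (intro exI[of _ 1]) auto
      have "((\<lambda>x. C * x ^ N * sqrt x) \<longlongrightarrow> C * 0 ^ N * sqrt 0) (at_right 0)"
        by (intro tendsto_intros)
      then show "((\<lambda>x. C * x ^ N * sqrt x) \<longlongrightarrow> 0) (at_right 0)" by simp
    qed
    ultimately show ?thesis using tendsto_unique[OF trivial_limit_at_right_real] by blast
  qed
  then obtain q' where q': "q = [:0, 1:] * q'" by (metis dvd_def poly_eq_0_iff_dvd minus_zero)
  then have pq: "poly q x = x * poly q' x" for x by simp
  have "\<bar>poly q' x\<bar> \<le> C * x ^ N / sqrt x" if "0 < x" "x < 1" for x
  proof -
    have "x * \<bar>poly q' x\<bar> \<le> x * (C * x ^ N / sqrt x)"
      using Suc.prems[OF that] that(1) by (simp add: pq abs_mult mult_ac)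
    then show ?thesis using that(1) by (simp only: mult_le_cancel_left_pos)
  qed
  from Suc.IH[OF this] obtain M where "\<And>x. 0 < x \<Longrightarrow> x < 1 \<Longrightarrow> \<bar>poly q' x\<bar> \<le> M * x ^ N" by blast
  then have "\<bar>poly q x\<bar> \<le> M * x ^ Suc N" if "0 < x" "x < 1" for x
    using mult_left_mono[of "\<bar>poly q' x\<bar>" "M * x ^ N" x] that by (simp add: pq abs_mult mult_ac)
  then show ?case by blast
qed

text \<open>Trades the logarithm for half a power, which \<open>poly_small_near_0\<close> then
  removes.\<close>

lemma neg_ln_le: "- ln s / 2 \<le> 1 / sqrt s" if "0 < s" for s :: real
proof -
  have "- ln s / 2 = ln (1 / sqrt s)" using that by (simp add: ln_div ln_sqrt)
  also have "\<dots> \<le> 1 / sqrt s" using ln_le_minus_one[of "1 / sqrt s"] that by simp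
  finally show ?thesis .
qed

text \<open>A logarithmic term \<open>s ^ N * ln s\<close>, where \<open>s = 1 - (1 - x)\<^sup>2\<close>, is not a polynomial up to an
  error of order \<open>x ^ N\<close>.\<close>

lemma log_term_vanishes:
  fixes q :: "real poly"
  assumes "\<And>x. 0 < x \<Longrightarrow> x < 1 \<Longrightarrow> \<bar>poly q x - L * (x * (2 - x)) ^ N * ln (x * (2 - x))\<bar> \<le> M * x ^ N"
  shows "L = 0"
proof -
  have s: "x \<le> x * (2 - x)" "x * (2 - x) \<le> 2 * x" "x * (2 - x) < 1" if "0 < x" "x < 1" for x :: real
  proof -
    show "x \<le> x * (2 - x)" "x * (2 - x) \<le> 2 * x" using that by (auto simp: algebra_simps mult_left_le)
    have "0 < (1 - x)\<^sup>2" using that by simp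
    then show "x * (2 - x) < 1" by (simp add: power2_eq_square algebra_simps)
  qed
  have abs_log: "\<bar>L * s ^ N * ln s\<bar> = \<bar>L\<bar> * s ^ N * \<bar>ln s\<bar>" if "0 < s" for s :: real
    using that by (simp add: abs_mult)
  have M0: "0 \<le> M"
    using assms[of "1/2"] by (smt (verit) zero_le_mult_iff zero_less_power half_gt_zero_iff divide_less_eq_1)
  \<comment> \<open>With the logarithm bounded by a multiple of 1 / sqrt x, \<open>q\<close> is
    O(x^N / sqrt x), hence O(x^N).\<close>
  have "\<bar>poly q x\<bar> \<le> (M + \<bar>L\<bar> * 2 ^ N * 2) * x ^ N / sqrt x" if x: "0 < x" "x < 1" for x
  proof -
    let ?s = "x * (2 - x)"
    note s' = s[OF x]
    have sx: "0 < sqrt x" "sqrt x \<le> 1" using x by auto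
    have s0: "0 < ?s" using s'(1) x(1) by linarith
    have "- ln ?s / 2 \<le> 1 / sqrt ?s" using s0 by (rule neg_ln_le)
    also have "\<dots> \<le> 1 / sqrt x" using s' sx by (intro divide_left_mono) auto
    finally have "\<bar>ln ?s\<bar> \<le> 2 / sqrt x" using s0 s'(3) by simp
    moreover have "?s ^ N \<le> 2 ^ N * x ^ N"
      using power_mono[OF s'(2), of N] s0 by (simp add: power_mult_distrib)
    ultimately have "\<bar>L\<bar> * ?s ^ N * \<bar>ln ?s\<bar> \<le> \<bar>L\<bar> * (2 ^ N * x ^ N) * (2 / sqrt x)"
      using s0 x by (intro mult_mono) auto
    moreover have "M * x ^ N \<le> M * x ^ N / sqrt x"
      using sx M0 x by (simp add: le_divide_eq mult_left_le)
    moreover have "\<bar>poly q x\<bar> \<le> M * x ^ N + \<bar>L\<bar> * ?s ^ N * \<bar>ln ?s\<bar>"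
    proof -
      show ?thesis using assms[OF x] abs_log[OF s0] by linarith
    qed
    moreover have "(M + \<bar>L\<bar> * 2 ^ N * 2) * x ^ N / sqrt x = M * x ^ N / sqrt x + \<bar>L\<bar> * (2 ^ N * x ^ N) * (2 / sqrt x)"
      unfolding distrib_right add_divide_distrib by simp
    ultimately show ?thesis by linarith
  qed
  then obtain M' where M': "\<And>x. 0 < x \<Longrightarrow> x < 1 \<Longrightarrow> \<bar>poly q x\<bar> \<le> M' * x ^ N"
    using poly_small_near_0[of q _ N] by meson
  \<comment> \<open>Since both \<open>q\<close> and the error are O(x^N), so is the logarithmic
    term; dividing by x^N leaves a bounded multiple of the logarithm.\<close>
  have bd: "\<bar>L\<bar> * - ln (2 * x) \<le> M + M'" if x: "0 < x" "x < 1" for x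
  proof -
    let ?s = "x * (2 - x)"
    note s' = s[OF x]
    have s0: "0 < ?s" using s'(1) x(1) by linarith
    have "\<bar>L * ?s ^ N * ln ?s\<bar> = \<bar>L\<bar> * \<bar>ln ?s\<bar> * ?s ^ N" unfolding abs_log[OF s0] by (simp only: mult_ac)
    moreover have "\<bar>L\<bar> * \<bar>ln ?s\<bar> * x ^ N \<le> \<bar>L\<bar> * \<bar>ln ?s\<bar> * ?s ^ N"
      using s'(1) x by (intro mult_left_mono power_mono mult_nonneg_nonneg abs_ge_zero) auto
    ultimately have "(\<bar>L\<bar> * \<bar>ln ?s\<bar>) * x ^ N \<le> (M + M') * x ^ N"
      using assms[OF x] M'[OF x] unfolding distrib_right by linarith
    then have "\<bar>L\<bar> * \<bar>ln ?s\<bar> \<le> M + M'" using x by (simp only: mult_le_cancel_right_pos zero_less_power)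
    moreover have "- ln (2 * x) \<le> \<bar>ln ?s\<bar>"
      using ln_mono[of ?s "2 * x"] s'(2) s0 x by linarith
    ultimately show ?thesis using mult_left_mono[of "- ln (2 * x)" "\<bar>ln ?s\<bar>" "\<bar>L\<bar>"] by linarith
  qed
  show "L = 0"
  proof (rule ccontr)
    assume "L \<noteq> 0"
    \<comment> \<open>One more than the bound allows; \<open>x\<close> is then chosen with - ln (2
      x) = |t|.\<close>
    define t where "t = (M + M') / \<bar>L\<bar> + 1"
    define x where "x = exp (- \<bar>t\<bar>) / 2"
    have "x < 1" using exp_le_one_iff[of "- \<bar>t\<bar>"] abs_ge_zero[of t] unfolding x_def by linarith
    then have "\<bar>L\<bar> * \<bar>t\<bar> \<le> M + M'" using bd[of x] by (simp add: x_def)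
    moreover have "\<bar>L\<bar> * t = M + M' + \<bar>L\<bar>" using \<open>L \<noteq> 0\<close> by (simp add: t_def field_simps)
    moreover have "\<bar>L\<bar> * t \<le> \<bar>L\<bar> * \<bar>t\<bar>" by (intro mult_left_mono) auto
    ultimately show False using \<open>L \<noteq> 0\<close> by linarith
  qed
qed

text \<open>The equation can be integrated twice. With s = 1 - r^2 this gives v r^(2N) = K p(s) + c
  s^N - K L s^N ln s for a polynomial p. Smoothness of order N at r = 1 excludes the logarithm, so K
  = 0, and r = 0 gives c = 0.\<close>

lemma hypergeometric_boundary_value:
  fixes f :: "nat \<Rightarrow> real \<Rightarrow> real"
  assumes N: "2 \<le> N"
    and der: "\<And>i r. i < N \<Longrightarrow> r \<in> {0..1} \<Longrightarrow> (f i has_real_derivative f (Suc i) r) (at r within {0..1})"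
    and bd: "continuous_on {0..1} (f N)"
    and ode: "\<And>r. 0 < r \<Longrightarrow> r < 1 \<Longrightarrow>
      (1 - r\<^sup>2) * (f 2 r + f 1 r / r) + 2 * (real N - 1) * f 1 r / r - 4 * real N * f 0 r / r\<^sup>2 = 0"
  shows "f 0 1 = 0"
proof -
  have der': "(f i has_real_derivative f (Suc i) r) (at r)" if "i < N" "0 < r" "r < 1" for i r
    using der[of i r] at_within_Icc_at[of 0 r 1] that by simp
  have cont: "continuous_on {0..1} (f i)" if "i < N" for i
    using der[OF that] DERIV_continuous_on by blast
  define v v1 v2 where "v = f 0" and "v1 = f 1" and "v2 = f 2"
  have d: "(v has_real_derivative v1 r) (at r)" "(v1 has_real_derivative v2 r) (at r)" if "0 < r" "r < 1" for r
    using der'[of 0 r] der'[of 1 r] N that by (simp_all add: numeral_2_eq_2 v_def v1_def v2_def)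
  \<comment> \<open>The first integral: its derivative is the left side of the equation divided by
    r.\<close>
  have "((\<lambda>r. ((1 - r\<^sup>2) * r * v1 r + 2 * real N * v r) / r\<^sup>2) has_real_derivative 0) (at r)" if r: "0 < r" "r < 1" for r
  proof -
    have "((\<lambda>r. ((1 - r\<^sup>2) * r * v1 r + 2 * real N * v r) / r\<^sup>2) has_real_derivative
      ((((- 2 * r) * r + (1 - r\<^sup>2)) * v1 r + (1 - r\<^sup>2) * r * v2 r + 2 * real N * v1 r) * r\<^sup>2
        - ((1 - r\<^sup>2) * r * v1 r + 2 * real N * v r) * (2 * r)) / (r\<^sup>2 * r\<^sup>2)) (at r)"
      using r by (auto intro!: derivative_eq_intros d simp: field_simps power2_eq_square)
    moreover have "(((- 2 * r) * r + (1 - r\<^sup>2)) * v1 r + (1 - r\<^sup>2) * r * v2 r + 2 * real N * v1 r) * r\<^sup>2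
        - ((1 - r\<^sup>2) * r * v1 r + 2 * real N * v r) * (2 * r)
      = r ^ 3 * ((1 - r\<^sup>2) * (v2 r + v1 r / r) + 2 * (real N - 1) * v1 r / r - 4 * real N * v r / r\<^sup>2)"
      using r by (simp add: field_simps power2_eq_square power3_eq_cube)
    ultimately show ?thesis using ode[OF r] by (simp add: v_def v1_def v2_def)
  qed
  from zero_derivative_constant[OF this] obtain K where
    K': "\<And>r. 0 < r \<Longrightarrow> r < 1 \<Longrightarrow> ((1 - r\<^sup>2) * r * v1 r + 2 * real N * v r) / r\<^sup>2 = K" by blast
  have K: "(1 - r\<^sup>2) * r * v1 r + 2 * real N * v r = K * r\<^sup>2" if "0 < r" "r < 1" for r
    using K'[OF that] that by (simp add: divide_eq_eq)
  \<comment> \<open>Termwise antiderivative of -(1 - s)^N / (2 s^(N+1)): the binomial terms i < N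
    give p(s) / s^N and the term i = N gives - L ln s.\<close>
  define p where "p s = (\<Sum>i<N. real (N choose i) * (-1) ^ i * s ^ i / (2 * real (N - i)))" for s :: real
  define p' where "p' s = (\<Sum>i<N. real (N choose i) * (-1) ^ i * (real i * s ^ (i - 1)) / (2 * real (N - i)))" for s :: real
  define L where "L = (-1) ^ N / (2::real)"
  define F where "F s = p s / s ^ N - L * ln s" for s :: real
  have dp: "(p has_real_derivative p' s) (at s)" for s
    unfolding p_def p'_def by (auto intro!: derivative_eq_intros sum.cong)
  have pp': "p' s * s - real N * p s = - ((1 - s) ^ N - (- s) ^ N) / 2" for s
  proof -
    have frac: "A * (a * S) / (2 * (n - a)) - n * (A * S / (2 * (n - a))) = - (A * S) / 2" if "n - a \<noteq> 0" for A S a n :: real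
    proof -
      have "A * ((n - d) * S) / (2 * d) - n * (A * S / (2 * d)) = - (A * S) / 2" if "d \<noteq> 0" for d
        using that by (simp add: field_simps)
      from this[of "n - a"] show ?thesis using that by simp
    qed
    have "p' s * s - real N * p s = (\<Sum>i<N. - (real (N choose i) * (- s) ^ i) / 2)"
      unfolding p_def p'_def sum_distrib_left sum_distrib_right sum_subtractf[symmetric]
    proof (intro sum.cong refl)
      fix i assume "i \<in> {..<N}"
      then have i: "real (N - i) = real N - real i" "real N - real i \<noteq> 0" by auto
      have "real i * s ^ (i - 1) * s = real i * s ^ i" by (cases i) auto
      then have "real (N choose i) * (-1) ^ i * (real i * s ^ (i - 1)) / (2 * real (N - i)) * s
         = real (N choose i) * (-1) ^ i * (real i * s ^ i) / (2 * real (N - i))"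
        by (metis mult.assoc times_divide_eq_left)
      moreover have "(- s) ^ i = (-1) ^ i * s ^ i" by (rule power_minus)
      ultimately show "real (N choose i) * (-1) ^ i * (real i * s ^ (i - 1)) / (2 * real (N - i)) * s -
         real N * (real (N choose i) * (-1) ^ i * s ^ i / (2 * real (N - i)))
         = - (real (N choose i) * (- s) ^ i) / 2"
        using frac[OF i(2), of "real (N choose i) * (-1) ^ i" "s ^ i"] unfolding i(1)
        by (simp only: mult.assoc)
    qed
    also have "\<dots> = - (\<Sum>i<N. real (N choose i) * (- s) ^ i) / 2"
      by (simp add: sum_divide_distrib sum_negf)
    also have "(\<Sum>i<N. real (N choose i) * (- s) ^ i) = (1 - s) ^ N - (- s) ^ N"
      using binomial_ring[of "- s" 1 N] by (simp add: lessThan_Suc_atMost[symmetric])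
    finally show ?thesis .
  qed
  obtain M where M: "N = Suc M" using N by (cases N) auto
  have dF: "(F has_real_derivative - ((1 - s) ^ N / s ^ Suc N) / 2) (at s)" if s: "0 < s" for s
  proof -
    have "(F has_real_derivative (p' s * s ^ N - p s * (real N * s ^ (N - 1))) / (s ^ N * s ^ N) - L * (1 / s)) (at s)"
      unfolding F_def using s by (auto intro!: derivative_eq_intros dp)
    moreover have "(p' s * s ^ N - p s * (real N * s ^ (N - 1))) / (s ^ N * s ^ N) = (p' s * s - real N * p s) / s ^ Suc N"
      using s unfolding M by (simp add: field_simps)
    moreover have "L * (1 / s) = (- s) ^ N / s ^ Suc N / 2"
      using s by (simp add: L_def power_minus[of s] field_simps)
    ultimately show ?thesis
      unfolding pp' by (simp add: diff_divide_distrib[symmetric] add_divide_distrib[symmetric] field_simps)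
  qed
  have s0: "0 < 1 - r\<^sup>2" if "0 < r" "r < 1" for r :: real
    using that by (simp add: power_less_one_iff abs_square_less_1)
  \<comment> \<open>The factor r^(2N) / (1 - r^2)^N turns the first integral into an exact
    derivative.\<close>
  have "((\<lambda>r. v r * r ^ (2 * N) / (1 - r\<^sup>2) ^ N - K * F (1 - r\<^sup>2)) has_real_derivative 0) (at r)" if r: "0 < r" "r < 1" for r
  proof -
    let ?s = "1 - r\<^sup>2"
    have "((\<lambda>r. F (1 - r\<^sup>2)) has_real_derivative - ((1 - ?s) ^ N / ?s ^ Suc N) / 2 * (- 2 * r)) (at r)"
      by (rule DERIV_chain2[where f=F and g="\<lambda>r. 1 - r\<^sup>2" and x=r, OF dF[OF s0[OF r]]]) (auto intro!: derivative_eq_intros)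
    then have 1: "((\<lambda>r. F (1 - r\<^sup>2)) has_real_derivative r ^ (2 * N) * r / ?s ^ Suc N) (at r)"
      by (simp add: power_mult)
    have "((\<lambda>r. v r * r ^ (2 * N) / (1 - r\<^sup>2) ^ N) has_real_derivative
      ((v1 r * r ^ (2 * N) + v r * (real (2 * N) * r ^ (2 * N - 1))) * ?s ^ N
       - v r * r ^ (2 * N) * (real N * ?s ^ (N - 1) * (- 2 * r))) / (?s ^ N * ?s ^ N)) (at r)"
      using r s0[OF r] by (auto intro!: derivative_eq_intros d)
    moreover have "((v1 r * r ^ (2 * N) + v r * (real (2 * N) * r ^ (2 * N - 1))) * ?s ^ N
       - v r * r ^ (2 * N) * (real N * ?s ^ (N - 1) * (- 2 * r))) / (?s ^ N * ?s ^ N)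
       = r ^ (2 * N - 1) * (?s * r * v1 r + 2 * real N * v r) / ?s ^ Suc N"
    proof -
      have e: "r ^ (2 * N) = r * r ^ (2 * N - 1)" "?s ^ N = ?s * ?s ^ (N - 1)" "?s ^ Suc N = ?s * ?s * ?s ^ (N - 1)"
        unfolding M by simp_all
      have "((v1 r * (r * A) + v r * (real (2 * N) * A)) * (s * B) - v r * (r * A) * (real N * B * (- 2 * r))) / (s * B * (s * B))
         = A * (s * r * v1 r + 2 * real N * v r) / (s * s * B)" if "s \<noteq> 0" "B \<noteq> 0" "s + r\<^sup>2 = 1" for A B s
      proof -
        have "(v1 r * (r * A) + v r * (real (2 * N) * A)) * (s * B) - v r * (r * A) * (real N * B * (- 2 * r))
         = B * (A * (s * r * v1 r + 2 * real N * v r * (s + r\<^sup>2)))"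
          by (simp add: algebra_simps power2_eq_square)
        then show ?thesis using that by simp
      qed
      from this[of ?s "?s ^ (N - 1)" "r ^ (2 * N - 1)"] show ?thesis
        using s0[OF r] unfolding e by simp
    qed
    also have "r ^ (2 * N - 1) * (?s * r * v1 r + 2 * real N * v r) / ?s ^ Suc N = K * (r ^ (2 * N) * r / ?s ^ Suc N)"
      unfolding K[OF r] unfolding M by (simp add: power2_eq_square)
    finally have "((\<lambda>r. v r * r ^ (2 * N) / (1 - r\<^sup>2) ^ N) has_real_derivative K * (r ^ (2 * N) * r / ?s ^ Suc N)) (at r)" .
    from DERIV_diff[OF this DERIV_cmult[OF 1, of K]] show ?thesis by simp
  qed
  from zero_derivative_constant[OF this] obtain c where
    c': "\<And>r. 0 < r \<Longrightarrow> r < 1 \<Longrightarrow> v r * r ^ (2 * N) / (1 - r\<^sup>2) ^ N - K * F (1 - r\<^sup>2) = c" by blast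
  have c: "v r * r ^ (2 * N) = K * p (1 - r\<^sup>2) + c * (1 - r\<^sup>2) ^ N - K * L * (1 - r\<^sup>2) ^ N * ln (1 - r\<^sup>2)"
    if r: "0 < r" "r < 1" for r
    using c'[OF r] s0[OF r] by (simp add: F_def field_simps)
  obtain B where "\<forall>y\<in>f N ` {0..1}. norm y \<le> B"
    using compact_imp_bounded[OF compact_continuous_image[OF bd compact_Icc]] unfolding bounded_iff by blast
  then have B: "\<bar>f N r\<bar> \<le> B" if "r \<in> {0..1}" for r using that by simp
  \<comment> \<open>Taylor polynomial of \<open>v\<close> at r = 1 in x = 1 - r. Its degree is N -
    1, so boundedness of \<open>f N\<close> makes the error O(x^N). As s = x (2 - x), all terms of
    \<open>c\<close> other than the logarithm become the polynomial \<open>q\<close>.\<close>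
  define T where "T x = (\<Sum>i\<le>M. f i 1 * (- x) ^ i / fact i)" for x
  define q where "q = (\<Sum>i\<le>M. smult (f i 1 / fact i) ([:0, -1:] ^ i)) * [:1, -1:] ^ (2 * N)
    - smult K (\<Sum>i<N. smult (real (N choose i) * (-1) ^ i / (2 * real (N - i))) ([:0, 2, -1:] ^ i)) - smult c ([:0, 2, -1:] ^ N)"
  have q: "poly q x = T x * (1 - x) ^ (2 * N) - K * p (x * (2 - x)) - c * (x * (2 - x)) ^ N" for x
    unfolding q_def T_def p_def by (simp add: poly_sum poly_power)
  have "\<bar>poly q x - (- (K * L)) * (x * (2 - x)) ^ N * ln (x * (2 - x))\<bar> \<le> B / fact M * x ^ N" if x: "0 < x" "x < 1" for x
  proof -
    have s: "1 - (1 - x)\<^sup>2 = x * (2 - x)" by (simp add: power2_eq_square algebra_simps)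
    have "norm (f 0 (1 - x) - (\<Sum>i\<le>M. f i 1 * ((1 - x) - 1) ^ i / fact i)) \<le> B * norm ((1 - x) - 1) ^ Suc M / fact M"
      using x by (intro field_Taylor[of "{0..1}"] der) (use B in \<open>auto simp: M\<close>)
    then have E: "\<bar>v (1 - x) - T x\<bar> \<le> B / fact M * x ^ N"
      using x by (simp add: v_def T_def M)
    have eq: "poly q x - (- (K * L)) * (x * (2 - x)) ^ N * ln (x * (2 - x)) = (T x - v (1 - x)) * (1 - x) ^ (2 * N)"
      using c[of "1 - x"] x unfolding q s by (simp add: left_diff_distrib)
    have "\<bar>(T x - v (1 - x)) * (1 - x) ^ (2 * N)\<bar> \<le> \<bar>v (1 - x) - T x\<bar> * 1"
      using x by (simp add: abs_mult power_abs abs_minus_commute mult_left_le power_le_one)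
    from order_trans[OF this[unfolded mult_1_right] E] show ?thesis unfolding eq .
  qed
  from log_term_vanishes[OF this] have "K = 0" by (simp add: L_def)
  have fc: "v r * r ^ (2 * N) - c * (1 - r\<^sup>2) ^ N = 0" if "r \<in> {0..1}" for r
  proof (rule constant_on_unit_interval[OF _ _ that])
    show "continuous_on {0..1} (\<lambda>r. v r * r ^ (2 * N) - c * (1 - r\<^sup>2) ^ N)"
      unfolding v_def using N by (intro continuous_intros cont) simp
  qed (use c \<open>K = 0\<close> in simp)
  have "c = 0" using fc[of 0] N by (simp add: power_0_left)
  then show ?thesis using fc[of 1] by (simp add: v_def)
qed

text \<open>Odd and even parts decouple: u'' + u'/r - u/r^2 = 0 with solutions r and 1/r, and e'' +
  e'/r = 0 with solutions 1 and ln r. Continuity at 0 discards the singular ones, so e' = 0 and u is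
  a multiple of r, whence f'(1) = u(1).\<close>

lemma disc_radial_derivative:
  fixes f :: "nat \<Rightarrow> real \<Rightarrow> real"
  assumes der: "\<And>i r. i < 2 \<Longrightarrow> r \<in> {-1..1} \<Longrightarrow> (f i has_real_derivative f (Suc i) r) (at r within {-1..1})"
    and ode: "\<And>r. r \<noteq> 0 \<Longrightarrow> \<bar>r\<bar> < 1 \<Longrightarrow> f 2 r + f 1 r / r - (f 0 r - f 0 (-r)) / (2 * r\<^sup>2) = 0"
  shows "f 1 1 = (f 0 1 - f 0 (-1)) / 2"
proof -
  have der': "(f i has_real_derivative f (Suc i) r) (at r)" if "i < 2" "\<bar>r\<bar> < 1" for i r
    using der[of i r] at_within_Icc_at[of "-1" r 1] that by (simp add: abs_less_iff)
  have cont: "continuous_on {-1..1} (f i)" if "i < 2" for i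
    using der[OF that] DERIV_continuous_on by blast
  have contm: "continuous_on {0..1} (\<lambda>r. f i r)" "continuous_on {0..1} (\<lambda>r. f i (- r))" if "i < 2" for i
    by (rule continuous_on_compose2[OF cont[OF that]]; auto intro!: continuous_intros)+
  have dm: "((\<lambda>r. f i (- r)) has_real_derivative - f (Suc i) (- r)) (at r)" if "i < 2" "\<bar>r\<bar> < 1" for i r
    using der'[of i "- r"] that by (simp add: DERIV_mirror[symmetric])
  \<comment> \<open>\<open>u i\<close> and \<open>e i\<close> are the derivatives of order
    \<open>i\<close> of the odd and the even part; each differentiation of f(-r) contributes a
    sign.\<close>
  define u where "u i r = (f i r - (-1) ^ i * f i (- r)) / 2" for i r
  define e where "e i r = (f i r + (-1) ^ i * f i (- r)) / 2" for i r
  have ud: "(u i has_real_derivative u (Suc i) r) (at r)" "(e i has_real_derivative e (Suc i) r) (at r)"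
    if "i < 2" "0 < r" "r < 1" for i r
    unfolding u_def e_def using that
    by (auto intro!: derivative_eq_intros der' dm)
  have uc: "continuous_on {0..1} (u i)" "continuous_on {0..1} (e i)" if "i < 2" for i
    unfolding u_def e_def using that by (auto intro!: continuous_intros contm)
  have ou: "u 2 r + u 1 r / r - u 0 r / r\<^sup>2 = 0" and oe: "e 2 r + e 1 r / r = 0" if "0 < r" "r < 1" for r
  proof -
    have "f 2 r + f 1 r / r - (f 0 r - f 0 (-r)) / (2 * r\<^sup>2) = 0"
      "f 2 (-r) - f 1 (-r) / r + (f 0 r - f 0 (-r)) / (2 * r\<^sup>2) = 0"
      using ode[of r] ode[of "-r"] that by (simp_all add: diff_divide_distrib)
    then show "u 2 r + u 1 r / r - u 0 r / r\<^sup>2 = 0" "e 2 r + e 1 r / r = 0"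
      unfolding u_def e_def by (simp_all add: add_divide_distrib diff_divide_distrib)
  qed
  have "((\<lambda>r. u 1 r + u 0 r / r) has_real_derivative 0) (at r)" if r: "0 < r" "r < 1" for r
  proof -
    have "((\<lambda>r. u 1 r + u 0 r / r) has_real_derivative u 2 r + (u 1 r * r - u 0 r * 1) / (r * r)) (at r)"
      using r ud(1)[of 0 r] ud(1)[of 1 r] by (intro derivative_intros) (auto simp: numeral_2_eq_2)
    moreover have "u 2 r + (u 1 r * r - u 0 r * 1) / (r * r) = 0"
      using ou[OF r] r by (simp add: diff_divide_distrib power2_eq_square)
    ultimately show ?thesis by simp
  qed
  from zero_derivative_constant[OF this] obtain c where c: "\<And>r. 0 < r \<Longrightarrow> r < 1 \<Longrightarrow> u 1 r + u 0 r / r = c" by blast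
  have "((\<lambda>r. r * u 0 r - c * r\<^sup>2 / 2) has_real_derivative 0) (at r)" if r: "0 < r" "r < 1" for r
  proof -
    have "((\<lambda>r. r * u 0 r - c * r\<^sup>2 / 2) has_real_derivative (u 0 r + r * u 1 r) - c * r) (at r)"
      using ud(1)[of 0 r] r by (auto intro!: derivative_eq_intros)
    moreover have "(u 0 r + r * u 1 r) - c * r = 0"
      using c[OF r] r by (simp add: field_simps)
    ultimately show ?thesis by simp
  qed
  from zero_derivative_constant[OF this] obtain k where k: "\<And>r. 0 < r \<Longrightarrow> r < 1 \<Longrightarrow> r * u 0 r - c * r\<^sup>2 / 2 = k" by blast
  have k': "r * u 0 r - c * r\<^sup>2 / 2 = k" if "r \<in> {0..1}" for r
    by (rule constant_on_unit_interval[OF _ k that]) (auto intro!: continuous_intros uc)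
  from k'[of 0] have "k = 0" by simp
  then have u0: "u 0 1 = c / 2" using k'[of 1] by simp
  have "r * u 1 r + u 0 r - c * r = 0" if "r \<in> {0..1}" for r
    by (rule constant_on_unit_interval[OF _ _ that]) (use c in \<open>auto intro!: continuous_intros uc simp: field_simps\<close>)
  from this[of 1] have u1: "u 1 1 = c / 2" using u0 by simp
  have "((\<lambda>r. r * e 1 r) has_real_derivative 0) (at r)" if r: "0 < r" "r < 1" for r
  proof -
    have "((\<lambda>r. r * e 1 r) has_real_derivative 1 * e 1 r + e 2 r * r) (at r)"
      using ud(2)[of 1 r] r by (intro derivative_intros) (auto simp: numeral_2_eq_2)
    moreover have "1 * e 1 r + e 2 r * r = 0" using oe[OF r] r by (simp add: field_simps)
    ultimately show ?thesis by simp
  qed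
  from zero_derivative_constant[OF this] obtain k2 where k2: "\<And>r. 0 < r \<Longrightarrow> r < 1 \<Longrightarrow> r * e 1 r = k2" by blast
  have k2': "r * e 1 r = k2" if "r \<in> {0..1}" for r
    by (rule constant_on_unit_interval[OF _ k2 that]) (auto intro!: continuous_intros uc)
  have "e 1 1 = 0" using k2'[of 0] k2'[of 1] by simp
  then show ?thesis using u0 u1 unfolding u_def e_def by simp
qed

subsection \<open>Weighted averages\<close>

abbreviation ax :: "'n \<Rightarrow> complex^'n" where "ax i \<equiv> axis i 1"

lemma ax_nth: "ax i $ j = (if j = i then 1 else 0)"
  by (simp add: axis_def)

lemma cip_ax_ax: "cip (ax i) (ax j) = (if i = j then 1 else 0)"
  by (simp add: cip_axis ax_nth)

lemma cip_zero_right [simp]: "cip x 0 = 0" by (simp add: cip_def)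

definition colw :: "'n \<Rightarrow> complex^'n \<Rightarrow> complex^'n^'n \<Rightarrow> real" where
  "colw c x B = (cmod (cip x (column c B)))\<^sup>2"

definition wavg :: "((complex^'n^'m) list \<Rightarrow> complex^'n^'m \<Rightarrow> real) \<Rightarrow> 'n \<Rightarrow> complex^'n \<Rightarrow> complex^'n^'m \<Rightarrow> real" where
  "wavg X c x = haar_avg X (colw c x) []"

lemma continuous_on_colw [continuous_intros]: "continuous_on S (colw c x)"
  unfolding colw_def cip_def column_def by (intro continuous_intros)

lemma haar_left:
  fixes f :: "complex^'n^'n \<Rightarrow> real"
  shows "unitary U \<Longrightarrow> continuous_on UG f \<Longrightarrow> (LINT B|haar. f (U ** B)) = (LINT B|haar. f B)"
  using haar_invariant[of U "mat 1" f] by simp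

lemma haar_right:
  fixes f :: "complex^'n^'n \<Rightarrow> real"
  shows "unitary U \<Longrightarrow> continuous_on UG f \<Longrightarrow> (LINT B|haar. f (B ** U)) = (LINT B|haar. f B)"
  using haar_invariant[of "mat 1" U f] by simp

lemma cstar_mult_self: "unitary C \<Longrightarrow> cstar C ** (C ** B) = B"
  by (simp add: unitary_def matrix_mul_assoc)

lemma colw_shift: "colw c x (cstar C ** B) = colw c (C *v x) B"
  using cip_adj[of "cstar C" x "column c B"] by (simp add: colw_def column_mult)

lemma hf_cont0:
  assumes X: "harm_fam (X :: (complex^'n^'m) list \<Rightarrow> complex^'n^'m \<Rightarrow> real)" and "z \<in> Cl"
  shows "continuous_on UG (\<lambda>B. X [] (z ** B))"
  using hf_UG_continuous[OF X, of "[]" z] assms by simp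

text \<open>Left invariance of the Haar measure absorbs the translation of the point, which
  reappears as a motion of the weight vector.\<close>

lemma wavg_shift:
  assumes X: "harm_fam (X :: (complex^'n^'m) list \<Rightarrow> complex^'n^'m \<Rightarrow> real)" and z: "z \<in> Cl" and C: "unitary C"
  shows "wavg X c x (z ** C) = wavg X c (C *v x) z"
proof -
  have "continuous_on UG (\<lambda>B. X [] (z ** B) * colw c (C *v x) B)"
    by (intro continuous_intros hf_cont0[OF X z])
  from haar_left[OF C this] show ?thesis
    by (simp add: wavg_def haar_avg_def matrix_mul_assoc flip: colw_shift) (simp add: cstar_mult_self C flip: matrix_mul_assoc)
qed

lemma wavg_fixed:
  assumes "harm_fam (X :: (complex^'n^'m) list \<Rightarrow> complex^'n^'m \<Rightarrow> real)" "z \<in> Cl" "unitary C" "z ** C = z"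
  shows "wavg X c (C *v x) z = wavg X c x z"
  using wavg_shift[OF assms(1-3)] assms(4) by metis

lemma wavg_integrable:
  assumes X: "harm_fam (X :: (complex^'n^'m) list \<Rightarrow> complex^'n^'m \<Rightarrow> real)" and z: "z \<in> Cl" and q: "continuous_on UG q"
  shows "integrable haar (\<lambda>B. X [] (z ** B) * q B)"
  by (intro haar_integrable continuous_intros hf_cont0[OF X z] q)

lemma cmod_parallelogram: "(cmod (a + b))\<^sup>2 + (cmod (a - b))\<^sup>2 = 2 * (cmod a)\<^sup>2 + 2 * (cmod b)\<^sup>2"
  unfolding cmod_power2 plus_complex.simps minus_complex.simps
  by (simp add: power2_eq_square algebra_simps)

text \<open>Together with \<open>wavg_scale\<close> this makes the average, at a fixed point, a
  quadratic form in the weight vector.\<close>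

lemma wavg_parallelogram:
  assumes X: "harm_fam (X :: (complex^'n^'m) list \<Rightarrow> complex^'n^'m \<Rightarrow> real)" and z: "z \<in> Cl"
  shows "wavg X c (x + y) z + wavg X c (x - y) z = 2 * wavg X c x z + 2 * wavg X c y z"
proof -
  note int = wavg_integrable[OF X z continuous_on_colw]
  have "colw c (x + y) B + colw c (x - y) B = 2 * colw c x B + 2 * colw c y B" for B
    unfolding colw_def cip_add_left cip_diff_left by (rule cmod_parallelogram)
  then have e: "X [] (z ** B) * colw c (x + y) B + X [] (z ** B) * colw c (x - y) B
     = 2 * (X [] (z ** B) * colw c x B) + 2 * (X [] (z ** B) * colw c y B)" for B
    by (metis distrib_left mult.left_commute)
  have "wavg X c (x + y) z + wavg X c (x - y) z
    = (LINT B|haar. X [] (z ** B) * colw c (x + y) B + X [] (z ** B) * colw c (x - y) B)"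
    unfolding wavg_def haar_avg_def using int by simp
  also have "\<dots> = (LINT B|haar. 2 * (X [] (z ** B) * colw c x B) + 2 * (X [] (z ** B) * colw c y B))"
    unfolding e ..
  also have "\<dots> = 2 * wavg X c x z + 2 * wavg X c y z"
    unfolding wavg_def haar_avg_def using int by simp
  finally show ?thesis .
qed

lemma wavg_scale: "wavg X c (a *s x) z = (cmod a)\<^sup>2 * wavg X c x z"
proof -
  have "X [] (z ** B) * colw c (a *s x) B = (cmod a)\<^sup>2 * (X [] (z ** B) * colw c x B)" for B
    by (simp only: colw_def cip_scale_left norm_mult power_mult_distrib complex_mod_cnj mult_ac)
  then have "(\<lambda>B. X [] (z ** B) * colw c (a *s x) B) = (\<lambda>B. (cmod a)\<^sup>2 * (X [] (z ** B) * colw c x B))"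
    by (rule ext)
  then show ?thesis
    unfolding wavg_def haar_avg_def list.map by (simp only: integral_mult_right_zero)
qed

lemma wavg_neg: "wavg X c (- x) z = wavg X c x z"
proof -
  have "(-1) *s x = - x" by (simp add: vec_eq_iff)
  then show ?thesis using wavg_scale[of X c "-1" x z] by simp
qed

text \<open>A symmetry of z that fixes x and negates y gives x + y and x - y the same average; the
  parallelogram law then says that x and y are orthogonal for the form.\<close>

lemma wavg_add:
  assumes X: "harm_fam (X :: (complex^'n^'m) list \<Rightarrow> complex^'n^'m \<Rightarrow> real)" and z: "z \<in> Cl"
    and D: "unitary D" "z ** D = z" "D *v x = x" "D *v y = - y"
  shows "wavg X c (x + y) z = wavg X c x z + wavg X c y z"
proof -
  have "D *v (x + y) = x - y" using D by (simp add: matrix_vector_right_distrib)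
  then have "wavg X c (x + y) z = wavg X c (x - y) z"
    using wavg_fixed[OF X z D(1,2), of c "x + y"] by simp
  then show ?thesis using wavg_parallelogram[OF X z, of c x y] by simp
qed

lemma unitary_col_norm: "unitary B \<Longrightarrow> norm (column c B) = 1"
  using unitary_norm_mv[of B "ax c"] by (simp add: mv_axis)

lemma sum_colw: "unitary B \<Longrightarrow> (\<Sum>k\<in>UNIV. colw c (ax k) B) = 1"
  using unitary_col_norm[of B c] by (simp add: colw_def cip_axis norm_vec_sq[symmetric])

definition total :: "((complex^'n^'m) list \<Rightarrow> complex^'n^'m \<Rightarrow> real) \<Rightarrow> complex^'n^'m \<Rightarrow> real" where
  "total X z = (LINT B|haar. X [] (z ** B))"

text \<open>The columns of a unitary matrix are unit vectors, so the weights of all axes add up to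
  1.\<close>

lemma sum_wavg:
  assumes X: "harm_fam (X :: (complex^'n^'m) list \<Rightarrow> complex^'n^'m \<Rightarrow> real)" and z: "z \<in> Cl"
  shows "(\<Sum>k\<in>UNIV. wavg X c (ax k) z) = total X z"
proof -
  have "(\<Sum>k\<in>UNIV. wavg X c (ax k) z) = (LINT B|haar. (\<Sum>k\<in>UNIV. X [] (z ** B) * colw c (ax k) B))"
    unfolding wavg_def haar_avg_def
    by (subst Bochner_Integration.integral_sum) (auto intro: wavg_integrable[OF X z continuous_on_colw])
  also have "\<dots> = total X z"
    unfolding total_def
    by (intro Bochner_Integration.integral_cong refl) (simp add: sum_colw unitary_UG flip: sum_distrib_left)
  finally show ?thesis .
qed

lemma total_shift:
  assumes X: "harm_fam (X :: (complex^'n^'m) list \<Rightarrow> complex^'n^'m \<Rightarrow> real)" and z: "z \<in> Cl" and C: "unitary C"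
  shows "total X (z ** C) = total X z"
  using haar_left[OF C hf_cont0[OF X z]] by (simp add: total_def matrix_mul_assoc)

subsection \<open>Unitary matrices acting in a coordinate plane\<close>

text \<open>Columns of an element of SU(2) in the plane of the axes k and l, parametrized so that
  right multiplication sends axis k to \<alpha> e_k + \<beta> e_l
  (\<open>plane_row\<close>).\<close>

definition pcol :: "'n \<Rightarrow> 'n \<Rightarrow> complex \<Rightarrow> complex \<Rightarrow> 'n \<Rightarrow> complex^'n" where
  "pcol k l \<alpha> \<beta> i = (if i = k then \<alpha> *s ax k - cnj \<beta> *s ax l
     else if i = l then \<beta> *s ax k + cnj \<alpha> *s ax l else ax i)"

definition plane :: "'n \<Rightarrow> 'n \<Rightarrow> complex \<Rightarrow> complex \<Rightarrow> complex^'n^'n" where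
  "plane k l \<alpha> \<beta> = (\<chi> a i. pcol k l \<alpha> \<beta> i $ a)"

lemma column_plane: "column i (plane k l \<alpha> \<beta>) = pcol k l \<alpha> \<beta> i"
  by (simp add: column_def plane_def vec_eq_iff)

lemma unitary_plane:
  assumes "k \<noteq> l" "(cmod \<alpha>)\<^sup>2 + (cmod \<beta>)\<^sup>2 = 1"
  shows "unitary (plane k l \<alpha> \<beta>)"
proof (rule unitaryI)
  have "\<alpha> * cnj \<alpha> + \<beta> * cnj \<beta> = of_real ((cmod \<alpha>)\<^sup>2 + (cmod \<beta>)\<^sup>2)"
    by (simp add: complex_norm_square[symmetric])
  then have ab: "\<alpha> * cnj \<alpha> + \<beta> * cnj \<beta> = 1" using assms by simp
  have "(cstar (plane k l \<alpha> \<beta>) ** plane k l \<alpha> \<beta>) $ i $ j = cip (pcol k l \<alpha> \<beta> i) (pcol k l \<alpha> \<beta> j)" for i j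
    by (simp add: matrix_matrix_mult_def cip_def plane_def)
  moreover have "cip (pcol k l \<alpha> \<beta> i) (pcol k l \<alpha> \<beta> j) = mat 1 $ i $ j" for i j
    using assms(1) ab unfolding pcol_def
    by (auto simp: cip_add_left cip_add_right cip_diff_left cip_diff_right cip_scale_left cip_scale_right
        cip_ax_ax mat_def mult.commute add.commute)
  ultimately show "cstar (plane k l \<alpha> \<beta>) ** plane k l \<alpha> \<beta> = mat 1"
    by (simp add: vec_eq_iff)
qed

lemma plane_mv:
  "k \<noteq> l \<Longrightarrow> plane k l \<alpha> \<beta> *v ax k = \<alpha> *s ax k - cnj \<beta> *s ax l"
  "k \<noteq> l \<Longrightarrow> plane k l \<alpha> \<beta> *v ax l = \<beta> *s ax k + cnj \<alpha> *s ax l"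
  "i \<noteq> k \<Longrightarrow> i \<noteq> l \<Longrightarrow> plane k l \<alpha> \<beta> *v ax i = ax i"
  by (simp_all add: mv_axis column_plane pcol_def)

lemma vm_ax: "ax i v* A = A $ i"
  by (simp add: vector_matrix_mult_def vec_eq_iff ax_nth if_distrib[of "\<lambda>x. x * _"] cong: if_cong)

lemma plane_row:
  "k \<noteq> l \<Longrightarrow> plane k l \<alpha> \<beta> $ k = \<alpha> *s ax k + \<beta> *s ax l"
  "i \<noteq> k \<Longrightarrow> i \<noteq> l \<Longrightarrow> plane k l \<alpha> \<beta> $ i = ax i"
  by (auto simp: plane_def pcol_def vec_eq_iff ax_nth)

definition flip :: "'n set \<Rightarrow> complex^'n^'n" where
  "flip K = (\<chi> i j. if i = j then (if i \<in> K then -1 else 1) else 0)"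

lemma unitary_flip: "unitary (flip K)"
  by (rule unitaryI) (auto simp: vec_eq_iff matrix_matrix_mult_def flip_def mat_def if_distrib[of cnj]
      if_distrib[of "\<lambda>x. x * _"] cong: if_cong)

lemma flip_row: "flip K $ i = (if i \<in> K then - ax i else ax i)"
  by (auto simp: flip_def vec_eq_iff ax_nth)

lemma flip_mv: "(flip K *v x) $ i = (if i \<in> K then - x $ i else x $ i)"
  by (simp add: flip_def matrix_vector_mult_def if_distrib[of "\<lambda>x. x * _"] cong: if_cong)

subsection \<open>Balls in the boundary\<close>

text \<open>For \<open>w\<close> of norm at most 1 and orthogonal to the axes
  \<open>\<iota> j\<close> with j \<noteq> j0, these points form a ball of complex dimension n - m +
  1. It lies in the boundary when m > 1, and \<open>zeta0 \<iota>\<close> is a point of its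
  sphere.\<close>

definition zrow :: "('m \<Rightarrow> 'n) \<Rightarrow> 'm \<Rightarrow> complex^'n \<Rightarrow> complex^'n^'m" where
  "zrow \<iota> j0 w = (\<chi> j. if j = j0 then w else ax (\<iota> j))"

definition zeta0 :: "('m \<Rightarrow> 'n) \<Rightarrow> complex^'n^'m" where
  "zeta0 \<iota> = (\<chi> j. ax (\<iota> j))"

lemma zrow_zeta0: "zrow \<iota> j0 (ax (\<iota> j0)) = zeta0 \<iota>"
  by (simp add: zrow_def zeta0_def vec_eq_iff)

lemma zrow_add: "zrow \<iota> j0 w + s *\<^sub>R tens (ax j0) v = zrow \<iota> j0 (w + s *\<^sub>R v)"
  by (auto simp: zrow_def tens_def vec_eq_iff ax_nth)

lemma row_mult: "(A ** B) $ j = A $ j v* B" for A :: "complex^'n^'m"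
  by (simp add: matrix_matrix_mult_def vector_matrix_mult_def vec_eq_iff mult.commute)

lemma zrow_mult:
  assumes "\<And>j. j \<noteq> j0 \<Longrightarrow> C $ \<iota> j = ax (\<iota> j)"
  shows "zrow \<iota> j0 w ** C = zrow \<iota> j0 (w v* C)"
  using assms by (simp add: zrow_def row_mult vm_ax vec_eq_iff[of "zrow _ _ _ ** C"]) (simp add: vec_eq_iff zrow_def row_mult vm_ax)

text \<open>The other rows are orthonormal and orthogonal to \<open>w\<close>. On the ball the
  operator therefore differentiates in row j0 only.\<close>

lemma zrow_defect:
  fixes \<iota> :: "'m::finite \<Rightarrow> 'n::finite"
  assumes "inj \<iota>" and w: "\<And>j. j \<noteq> j0 \<Longrightarrow> w $ \<iota> j = 0"
  shows "(mat 1 - zrow \<iota> j0 w ** cstar (zrow \<iota> j0 w)) $ j $ k = (if j = j0 \<and> k = j0 then of_real (1 - (norm w)\<^sup>2) else 0)"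
proof -
  have "(zrow \<iota> j0 w ** cstar (zrow \<iota> j0 w)) $ j $ k = cip (zrow \<iota> j0 w $ k) (zrow \<iota> j0 w $ j)"
    by (simp add: matrix_matrix_mult_def cip_def mult.commute)
  also have "\<dots> = (if j = j0 \<and> k = j0 then of_real ((norm w)\<^sup>2) else if j = k then 1 else 0)"
  proof -
    have "cip w (ax (\<iota> i)) = 0" if "i \<noteq> j0" for i
      using w[OF that] cip_cnj[of "ax (\<iota> i)" w] by (simp add: cip_axis)
    then show ?thesis
      using w inj_eq[OF assms(1)] by (auto simp: zrow_def cip_ax_ax cip_axis cip_self ax_nth)
  qed
  finally show ?thesis by (auto simp: mat_def)
qed

lemma zrow_decL:
  assumes "inj \<iota>" "\<And>j. j \<noteq> j0 \<Longrightarrow> w $ \<iota> j = 0"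
  shows "decL (zrow \<iota> j0 w) (\<lambda>i. if i = j0 then 1 - (norm w)\<^sup>2 else 0) ax"
proof -
  have d: "(mat 1 - zrow \<iota> j0 w ** cstar (zrow \<iota> j0 w)) $ j $ k = (if j = j0 \<and> k = j0 then of_real (1 - (norm w)\<^sup>2) else 0)" for j k
    using assms by (rule zrow_defect)
  show ?thesis
    unfolding decL_def d ax_nth
    by (auto simp: if_distrib[of of_real] if_distrib[of "\<lambda>x. x * _"] cong: if_cong)
qed

lemma zrow_Cl:
  fixes \<iota> :: "'m::finite \<Rightarrow> 'n::finite"
  assumes "inj \<iota>" "\<And>j. j \<noteq> j0 \<Longrightarrow> w $ \<iota> j = 0" "norm w \<le> 1"
  shows "zrow \<iota> j0 w \<in> Cl"
proof -
  let ?z = "zrow \<iota> j0 w"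
  have d: "(mat 1 - ?z ** cstar ?z) $ j $ k = (if j = j0 \<and> k = j0 then of_real (1 - (norm w)\<^sup>2) else 0)" for j k
    using assms(1,2) by (rule zrow_defect)
  have "norm (cstar ?z *v x) \<le> norm x" for x
  proof -
    have "(mat 1 - ?z ** cstar ?z) *v x = (of_real (1 - (norm w)\<^sup>2) * x $ j0) *s ax j0"
      unfolding matrix_vector_mult_def d
      by (auto simp: vec_eq_iff ax_nth if_distrib[of "\<lambda>x. x * _"] cong: if_cong)
    then have "cip x ((mat 1 - ?z ** cstar ?z) *v x) = of_real (1 - (norm w)\<^sup>2) * (x $ j0 * cip x (ax j0))"
      by (simp add: cip_scale_right)
    also have "cip x (ax j0) = cnj (x $ j0)" using cip_cnj[of "ax j0" x] by (simp add: cip_axis)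
    also have "x $ j0 * cnj (x $ j0) = of_real ((cmod (x $ j0))\<^sup>2)" by (rule complex_norm_square[symmetric])
    finally have "Re (cip x ((mat 1 - ?z ** cstar ?z) *v x)) = (1 - (norm w)\<^sup>2) * (cmod (x $ j0))\<^sup>2"
      by (simp only: Re_complex_of_real of_real_mult[symmetric])
    moreover have "0 \<le> (1 - (norm w)\<^sup>2) * (cmod (x $ j0))\<^sup>2"
      using assms(3) by (intro mult_nonneg_nonneg) (auto simp: power_le_one)
    ultimately have "(norm (cstar ?z *v x))\<^sup>2 \<le> (norm x)\<^sup>2" unfolding cip_defect by linarith
    then show ?thesis by (rule power2_le_imp_le) simp
  qed
  then show ?thesis by (simp add: Cl_def)
qed

text \<open>Up to the factor 1 - r^2 from \<open>zrow_decL\<close>, the operator at a point of the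
  axis is thus 1 - r^2 times the Laplacian in direction \<open>\<iota> j0\<close> plus the
  Laplacians in the directions outside \<open>range \<iota>\<close>.\<close>

lemma zrow_decR:
  fixes \<iota> :: "'m::finite \<Rightarrow> 'n::finite"
  assumes "inj \<iota>"
  shows "decR (zrow \<iota> j0 (r *\<^sub>R ax (\<iota> j0)))
    (\<lambda>i. if i = \<iota> j0 then 1 - r\<^sup>2 else if i \<in> range \<iota> then 0 else 1) ax"
  unfolding decR_def
proof (intro allI)
  fix a b
  let ?z = "zrow \<iota> j0 (r *\<^sub>R ax (\<iota> j0))"
  have ent: "?z $ l $ a = (if a = \<iota> l then (if l = j0 then of_real r else 1) else 0)" for l a
    by (auto simp: zrow_def ax_nth) (simp add: scaleR_conv_of_real)
  have "(cstar ?z ** ?z) $ b $ a = (\<Sum>l\<in>UNIV. if a = \<iota> l \<and> b = \<iota> l then (if l = j0 then of_real (r\<^sup>2) else 1) else 0)"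
    unfolding matrix_matrix_mult_def cstar_nth vec_lambda_beta ent
    by (intro sum.cong refl) (auto simp: power2_eq_square)
  also have "\<dots> = (if a = b then (if a = \<iota> j0 then of_real (r\<^sup>2) else if a \<in> range \<iota> then 1 else 0) else 0)"
  proof (cases "a = b \<and> a \<in> range \<iota>")
    case True
    then obtain l0 where l0: "a = \<iota> l0" "b = \<iota> l0" by auto
    then have "(a = \<iota> l \<and> b = \<iota> l) = (l = l0)" for l using inj_eq[OF assms] by auto
    then show ?thesis using l0 inj_eq[OF assms] by (simp cong: if_cong)
  qed (auto intro!: sum.neutral)
  finally show "(mat 1 - cstar ?z ** ?z) $ b $ a = (\<Sum>i\<in>UNIV. of_real (if i = \<iota> j0 then 1 - r\<^sup>2 else if i \<in> range \<iota> then 0 else 1)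
     * (ax i $ a * cnj (ax i $ b)))"
    by (auto simp: ax_nth mat_def if_distrib[of "\<lambda>x. _ * x"] if_distrib[of cnj] cong: if_cong)
qed

text \<open>For small t the radius sqrt (r^2 + t^2) has derivative t / R, so \<psi>' (t) / t = k'
  (R) / R; hence only one derivative of \<open>k\<close> is required.\<close>

lemma radial_second_derivative:
  fixes \<psi> k :: "real \<Rightarrow> real"
  assumes r: "0 < r" and d: "0 < d"
    and \<psi>: "\<And>t. \<bar>t\<bar> < d \<Longrightarrow> (\<psi> has_real_derivative \<psi>1 t) (at t)" "(\<psi>1 has_real_derivative D) (at 0)"
    and eq: "\<And>t. \<bar>t\<bar> < d \<Longrightarrow> \<psi> t = k (sqrt (r\<^sup>2 + t\<^sup>2))"
    and k: "\<And>R. r \<le> R \<Longrightarrow> R < sqrt (r\<^sup>2 + d\<^sup>2) \<Longrightarrow> (k has_real_derivative k1 R) (at R)" "isCont k1 r"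
  shows "D = k1 r / r"
proof -
  let ?R = "\<lambda>t. sqrt (r\<^sup>2 + t\<^sup>2)"
  have pos: "0 < r\<^sup>2 + t\<^sup>2" for t using r by (simp add: add_pos_nonneg)
  have R1: "r \<le> ?R t" for t using r by (intro real_le_rsqrt) simp
  have R2: "?R t < ?R d" if "\<bar>t\<bar> < d" for t
    using power_strict_mono[OF that, of 2] by simp
  have e: "\<psi>1 t = k1 (?R t) * (t / ?R t)" if t: "\<bar>t\<bar> < d" for t
  proof -
    have "(?R has_real_derivative (inverse (?R t) / 2) * (2 * t)) (at t)"
      by (rule DERIV_chain2[where f=sqrt and g="\<lambda>t. r\<^sup>2 + t\<^sup>2" and x=t, OF DERIV_real_sqrt[OF pos]])
        (auto intro!: derivative_eq_intros)
    then have "(?R has_real_derivative t / ?R t) (at t)" by (simp add: field_simps)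
    then have "((\<lambda>t. k (?R t)) has_real_derivative k1 (?R t) * (t / ?R t)) (at t)"
      by (rule DERIV_chain2[where f=k and g="?R" and x=t, OF k(1)[OF R1 R2[OF t]]])
    moreover have "eventually (\<lambda>s. \<bar>s\<bar> < d) (nhds t)"
      using t by (intro eventually_nhds_in_open[of "{s. \<bar>s\<bar> < d}", simplified] open_Collect_less continuous_intros) auto
    then have "eventually (\<lambda>s. \<psi> s = k (?R s)) (nhds t)" by (rule eventually_mono) (rule eq)
    ultimately have "(\<psi> has_real_derivative k1 (?R t) * (t / ?R t)) (at t)"
      using DERIV_cong_ev[of t t \<psi> "\<lambda>t. k (?R t)" "k1 (?R t) * (t / ?R t)" "k1 (?R t) * (t / ?R t)"] by simp
    then show ?thesis using \<psi>(1)[OF t] DERIV_unique by blast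
  qed
  have "((\<lambda>t. (\<psi>1 t - \<psi>1 0) / (t - 0)) \<longlongrightarrow> D) (at 0)"
    using \<psi>(2) by (simp add: has_field_derivative_iff)
  moreover have "((\<lambda>t. (\<psi>1 t - \<psi>1 0) / (t - 0)) \<longlongrightarrow> k1 r / r) (at 0)"
  proof -
    have "isCont (\<lambda>t. k1 (?R t)) 0"
      using k(2) r by (intro isCont_o2[where f="?R" and g=k1] continuous_intros) simp
    then have "isCont (\<lambda>t. k1 (?R t) / ?R t) 0"
      using r by (intro continuous_intros) simp_all
    then have "((\<lambda>t. k1 (?R t) / ?R t) \<longlongrightarrow> k1 r / r) (at 0)"
      using r by (simp add: isCont_def)
    moreover have "eventually (\<lambda>t. k1 (?R t) / ?R t = (\<psi>1 t - \<psi>1 0) / (t - 0)) (at 0)"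
      unfolding eventually_at using d by (intro exI[of _ d]) (auto simp: e dist_real_def)
    ultimately show ?thesis by (rule Lim_transform_eventually)
  qed
  ultimately show ?thesis using LIM_unique by blast
qed

lemma scaleR_vm: "(c *\<^sub>R x) v* A = c *\<^sub>R (x v* A)" for A :: "complex^'n^'m"
  by (simp add: vector_matrix_mult_def vec_eq_iff scaleR_sum_right)

lemma csm_tens_right: "csm c (tens x y) = tens x (c *s y)"
  by (simp add: csm_def tens_def vec_eq_iff mult_ac)

lemma hf_radial_second:
  fixes Y :: "(complex^'n^'m) list \<Rightarrow> complex^'n^'m \<Rightarrow> real"
  assumes Y: "harm_fam Y" and n2: "2 \<le> CARD('n)" and r: "0 < r" and d: "0 < d"
    and seg: "\<And>t. \<bar>t\<bar> < d \<Longrightarrow> z + t *\<^sub>R v \<in> Cl"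
    and eq: "\<And>t. \<bar>t\<bar> < d \<Longrightarrow> Y [] (z + t *\<^sub>R v) = k (sqrt (r\<^sup>2 + t\<^sup>2))"
    and k: "\<And>R. r \<le> R \<Longrightarrow> R < sqrt (r\<^sup>2 + d\<^sup>2) \<Longrightarrow> (k has_real_derivative k1 R) (at R)" "isCont k1 r"
  shows "Y [v, v] z = k1 r / r"
proof (rule radial_second_derivative[OF r d _ _ eq k])
  show "((\<lambda>t. Y [] (z + t *\<^sub>R v)) has_real_derivative Y [v] (z + t *\<^sub>R v)) (at t)" if "\<bar>t\<bar> < d" for t
    by (rule hf_second_deriv(1)[OF Y n2 seg that])
  show "((\<lambda>t. Y [v] (z + t *\<^sub>R v)) has_real_derivative Y [v, v] z) (at 0)"
    using hf_second_deriv(2)[OF Y n2 seg, of d 0] d by simp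
qed

text \<open>With a weight of trace zero the average on the ball is a radial profile times the
  spherical harmonic N |w_1|^2 / |w|^2 - 1 of bidegree (1,1), up to a constant. The profile is a
  multiple of the difference of the two averages, and the hypergeometric equation makes it vanish on
  the sphere.\<close>

lemma boundary_ball_moments:
  fixes X :: "(complex^'n^'m) list \<Rightarrow> complex^'n^'m \<Rightarrow> real"
  assumes X: "harm_fam X" and n2: "2 \<le> CARD('n)" and \<iota>: "inj \<iota>" and k: "k \<notin> range \<iota>"
  shows "wavg X c (ax (\<iota> j0)) (zeta0 \<iota>) = wavg X c (ax k) (zeta0 \<iota>)"
proof -
  define k0 where "k0 = \<iota> j0"
  define K where "K = - range \<iota>"
  define N where "N = card (insert k0 K)"
  have kK: "k \<in> K" "k0 \<notin> K" using k by (auto simp: K_def k0_def)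
  have N: "N = Suc (card K)" using kK by (simp add: N_def)
  have "0 < card K" using kK by (auto simp: card_gt_0_iff)
  then have N2: "2 \<le> N" using N by simp
  have Nn: "N \<le> CARD('n)" unfolding N_def by (intro card_mono) auto
  \<comment> \<open>Subtracting the sum over \<open>insert k0 K\<close> removes the part of the
    weight that is invariant under rotations of the ball.\<close>
  define q where "q B = real N * colw c (ax k0) B - (\<Sum>l\<in>insert k0 K. colw c (ax l) B)" for B
  have qc: "continuous_on UG q" unfolding q_def by (intro continuous_intros)
  define Y where "Y = haar_avg X q"
  have Y: "harm_fam Y" unfolding Y_def by (rule hf_avg[OF X qc n2])
  have Y0: "Y [] z = real N * wavg X c (ax k0) z - (\<Sum>l\<in>insert k0 K. wavg X c (ax l) z)" if z: "z \<in> Cl" for z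
  proof -
    note int = wavg_integrable[OF X z continuous_on_colw]
    have "Y [] z = (LINT B|haar. real N * (X [] (z ** B) * colw c (ax k0) B) - (\<Sum>l\<in>insert k0 K. X [] (z ** B) * colw c (ax l) B))"
      unfolding Y_def haar_avg_def q_def by (simp add: right_diff_distrib sum_distrib_left mult.left_commute)
    then show ?thesis
      unfolding wavg_def haar_avg_def using int by simp
  qed
  define zr where "zr R = zrow \<iota> j0 (R *\<^sub>R ax k0)" for R :: real
  define a where "a R = wavg X c (ax k0) (zr R)" for R
  define b where "b R = wavg X c (ax k) (zr R)" for R
  define v where "v R = Y [] (zr R)" for R
  have \<iota>K: "\<iota> j \<noteq> l" if "l \<in> K" for j l using that by (auto simp: K_def)
  have zrCl: "zr R \<in> Cl" if "\<bar>R\<bar> \<le> 1" for R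
    unfolding zr_def using that by (intro zrow_Cl \<iota>) (auto simp: k0_def ax_nth inj_eq[OF \<iota>])
  have wl: "wavg X c (ax l) (zr R) = b R" if l: "l \<in> K" and R: "\<bar>R\<bar> \<le> 1" for l R
  \<comment> \<open>For distinct axes, the quarter turn in the plane of k and l fixes
    \<open>zr R\<close> and carries \<open>ax k\<close> to \<open>- ax l\<close>.\<close>
  proof (cases "l = k")
    case False
    define C where "C = plane k l 0 1"
    have C: "unitary C" unfolding C_def using False by (intro unitary_plane) auto
    have "C $ \<iota> j = ax (\<iota> j)" for j
      unfolding C_def using False \<iota>K[OF l, of j] \<iota>K[OF kK(1), of j] by (intro plane_row) auto
    then have "zr R ** C = zr R"
      unfolding zr_def by (subst zrow_mult) (auto simp: k0_def vm_ax scaleR_vm)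
    from wavg_fixed[OF X zrCl[OF R] C this, of c "ax k"] show ?thesis
      unfolding C_def b_def using False by (simp add: plane_mv wavg_neg)
  qed (simp add: b_def)
  have vab: "v R = (real N - 1) * (a R - b R)" if "\<bar>R\<bar> \<le> 1" for R
    unfolding v_def Y0[OF zrCl[OF that]] using kK wl that by (simp add: a_def N algebra_simps)
  \<comment> \<open>Rotating the point by C moves the weight vectors by C; their mixed terms vanish
    because the sign change \<open>flip {l}\<close> fixes \<open>zr R\<close>.\<close>
  have rot: "Y [] (zrow \<iota> j0 (R *\<^sub>R (\<alpha> *s ax k0 + \<beta> *s ax l))) = (real N * (cmod \<alpha>)\<^sup>2 - 1) / (real N - 1) * v R"
    and rotCl: "zrow \<iota> j0 (R *\<^sub>R (\<alpha> *s ax k0 + \<beta> *s ax l)) \<in> Cl"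
    if l: "l \<in> K" and R: "\<bar>R\<bar> \<le> 1" and ab: "(cmod \<alpha>)\<^sup>2 + (cmod \<beta>)\<^sup>2 = 1" for l \<alpha> \<beta> and R :: real
  proof -
    define C where "C = plane k0 l \<alpha> \<beta>"
    have lk: "k0 \<noteq> l" using l kK by auto
    have C: "unitary C" unfolding C_def using lk ab by (rule unitary_plane)
    have row: "C $ \<iota> j = ax (\<iota> j)" if "j \<noteq> j0" for j
      unfolding C_def using \<iota>K[OF l, of j] that by (intro plane_row) (auto simp: k0_def inj_eq[OF \<iota>])
    have "C $ k0 = \<alpha> *s ax k0 + \<beta> *s ax l" unfolding C_def using lk by (rule plane_row)
    then have zC: "zrow \<iota> j0 (R *\<^sub>R (\<alpha> *s ax k0 + \<beta> *s ax l)) = zr R ** C"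
      unfolding zr_def by (subst zrow_mult) (auto simp: row vm_ax scaleR_vm)
    have Cl': "zr R ** C \<in> Cl" using zrCl[OF R] C by (rule Cl_unitary_right)
    then show "zrow \<iota> j0 (R *\<^sub>R (\<alpha> *s ax k0 + \<beta> *s ax l)) \<in> Cl" unfolding zC .
    have fl: "zr R ** flip {l} = zr R"
      unfolding zr_def by (subst zrow_mult) (use \<iota>K[OF l] lk in \<open>auto simp: flip_row vm_ax scaleR_vm\<close>)
    have add: "wavg X c (x *s ax k0 + y *s ax l) (zr R) = (cmod x)\<^sup>2 * a R + (cmod y)\<^sup>2 * b R" for x y
    proof -
      have "wavg X c (x *s ax k0 + y *s ax l) (zr R) = wavg X c (x *s ax k0) (zr R) + wavg X c (y *s ax l) (zr R)"
        by (rule wavg_add[OF X zrCl[OF R] unitary_flip fl])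
          (use lk in \<open>auto simp: vec_eq_iff flip_mv ax_nth\<close>)
      then show ?thesis using wl[OF l R] by (simp add: wavg_scale a_def)
    qed
    have Ck0: "wavg X c (C *v ax k0) (zr R) = (cmod \<alpha>)\<^sup>2 * a R + (cmod \<beta>)\<^sup>2 * b R"
      using add[of \<alpha> "- cnj \<beta>"] lk by (simp add: C_def plane_mv)
    have Cl0: "wavg X c (C *v ax l) (zr R) = (cmod \<beta>)\<^sup>2 * a R + (cmod \<alpha>)\<^sup>2 * b R"
      using add[of \<beta> "cnj \<alpha>"] lk by (simp add: C_def plane_mv)
    have Ci: "wavg X c (C *v ax i) (zr R) = b R" if "i \<in> K - {l}" for i
    proof -
      have "i \<noteq> k0" "i \<noteq> l" using that kK by auto
      then show ?thesis using that wl[of i R] R by (simp add: C_def plane_mv)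
    qed
    have "(\<Sum>i\<in>insert k0 K. wavg X c (C *v ax i) (zr R)) = wavg X c (C *v ax k0) (zr R) + (wavg X c (C *v ax l) (zr R) + (\<Sum>i\<in>K - {l}. wavg X c (C *v ax i) (zr R)))"
      using kK sum.remove[OF _ l, of "\<lambda>i. wavg X c (C *v ax i) (zr R)"] by simp
    also have "(\<Sum>i\<in>K - {l}. wavg X c (C *v ax i) (zr R)) = (real N - 2) * b R"
      using l Ci N N2 by (simp add: of_nat_diff)
    finally have S: "(\<Sum>i\<in>insert k0 K. wavg X c (C *v ax i) (zr R)) = (cmod \<alpha>)\<^sup>2 * a R + (cmod \<beta>)\<^sup>2 * b R + ((cmod \<beta>)\<^sup>2 * a R + (cmod \<alpha>)\<^sup>2 * b R + (real N - 2) * b R)"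
      unfolding Ck0 Cl0 by simp
    have b2: "(cmod \<beta>)\<^sup>2 = 1 - (cmod \<alpha>)\<^sup>2" using ab by simp
    have "Y [] (zr R ** C) = real N * wavg X c (C *v ax k0) (zr R) - (\<Sum>i\<in>insert k0 K. wavg X c (C *v ax i) (zr R))"
      unfolding Y0[OF Cl'] using wavg_shift[OF X zrCl[OF R] C] by simp
    also have "\<dots> = (real N * (cmod \<alpha>)\<^sup>2 - 1) * (a R - b R)"
      unfolding S Ck0 b2 by (simp add: algebra_simps)
    also have "\<dots> = (real N * (cmod \<alpha>)\<^sup>2 - 1) / (real N - 1) * v R"
      unfolding vab[OF R] using N2 by simp
    finally show "Y [] (zrow \<iota> j0 (R *\<^sub>R (\<alpha> *s ax k0 + \<beta> *s ax l))) = (real N * (cmod \<alpha>)\<^sup>2 - 1) / (real N - 1) * v R"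
      unfolding zC .
  qed
  define V where "V l = tens (ax j0) (ax l :: complex^'n)" for l :: 'n
  define f where "f i r = Y (replicate i (V k0)) (zr r)" for i r
  have zr_path: "zr R = zrow \<iota> j0 0 + R *\<^sub>R V k0" for R
    unfolding zr_def V_def zrow_add by simp
  have der: "(f i has_real_derivative f (Suc i) r) (at r within {0..1})" if "i < N" "r \<in> {0..1}" for i r
  proof -
    have "((\<lambda>s. Y (replicate i (V k0)) (zrow \<iota> j0 0 + s *\<^sub>R V k0)) has_real_derivative
       Y (V k0 # replicate i (V k0)) (zrow \<iota> j0 0 + r *\<^sub>R V k0)) (at r within {0..1})"
      using that Nn zrCl by (intro hf_deriv[OF Y]) (auto simp flip: zr_path)
    then show ?thesis unfolding f_def by (simp flip: zr_path)
  qed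
  have cf: "continuous_on {0..1} (f N)"
  proof -
    have "continuous_on {0..1} (\<lambda>r. Y (replicate N (V k0)) (zrow \<iota> j0 0 + r *\<^sub>R V k0))"
      using zrCl Nn by (intro continuous_on_compose2[OF hf_cont[OF Y, of "replicate N (V k0)"]] continuous_intros)
        (auto simp flip: zr_path)
    then show ?thesis unfolding f_def by (simp flip: zr_path)
  qed
  have v0: "v = f 0" by (simp add: fun_eq_iff v_def f_def)
  have der': "(f i has_real_derivative f (Suc i) R) (at R)" if "i < N" "0 < R" "R < 1" for i R
    using der[of i R] at_within_Icc_at[of 0 R 1] that by simp
  have d1: "(v has_real_derivative f 1 R) (at R)" and d2: "isCont (f 1) R" if "0 < R" "R < 1" for R
    using der'[of 0 R] DERIV_isCont[OF der'[of 1 R]] that N2 by (auto simp: v0)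
  have ode: "(1 - r\<^sup>2) * (f 2 r + f 1 r / r) + 2 * (real N - 1) * f 1 r / r - 4 * real N * f 0 r / r\<^sup>2 = 0"
    if r: "0 < r" "r < 1" for r
  proof -
    define d where "d = sqrt (1 - r\<^sup>2)"
    have r2: "r\<^sup>2 < 1" using r by (simp add: abs_square_less_1)
    then have d: "0 < d" "r\<^sup>2 + d\<^sup>2 = 1" by (simp_all add: d_def)
    have Rt: "0 < sqrt (r\<^sup>2 + t\<^sup>2)" "sqrt (r\<^sup>2 + t\<^sup>2) < 1" if "\<bar>t\<bar> < d" for t
    proof -
      have "t\<^sup>2 < d\<^sup>2" using power_strict_mono[OF that, of 2] by simp
      then show "sqrt (r\<^sup>2 + t\<^sup>2) < 1" using d(2) by (simp add: real_sqrt_lt_1_iff)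
      show "0 < sqrt (r\<^sup>2 + t\<^sup>2)" using r by (simp add: add_pos_nonneg)
    qed
    have Lk: "Y [tens (ax j0) (\<omega> *s ax l), tens (ax j0) (\<omega> *s ax l)] (zr r) = f 1 r / r - 2 * real N * v r / ((real N - 1) * r\<^sup>2)"
      if l: "l \<in> K" and w: "cmod \<omega> = 1" for l \<omega>
    proof -
      \<comment> \<open>On the tangential path the point of norm R has \<alpha> = r / R, so
        \<open>h\<close> is the angular factor. It is 1 at R = r, and its slope there produces the
        term in v.\<close>
      define h where "h R = (real N * (r\<^sup>2 / R\<^sup>2) - 1) / (real N - 1)" for R
      define k1 where "k1 R = (real N * (- 2 * r\<^sup>2 / R ^ 3)) / (real N - 1) * v R + h R * f 1 R" for R
      let ?v = "tens (ax j0) (\<omega> *s ax l)"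
      have path: "zr r + t *\<^sub>R ?v = zrow \<iota> j0 (sqrt (r\<^sup>2 + t\<^sup>2) *\<^sub>R
          (of_real (r / sqrt (r\<^sup>2 + t\<^sup>2)) *s ax k0 + (of_real (t / sqrt (r\<^sup>2 + t\<^sup>2)) * \<omega>) *s ax l))" if "\<bar>t\<bar> < d" for t
      proof -
        have "r *\<^sub>R ax k0 + t *\<^sub>R (\<omega> *s ax l) = R *\<^sub>R (of_real (r / R) *s ax k0 + (of_real (t / R) * \<omega>) *s (ax l :: complex^'n))"
          if "R > 0" for R :: real
          using that by (simp add: vec_eq_iff) (simp add: scaleR_conv_of_real field_simps)
        from this[OF Rt(1)[OF that]] show ?thesis unfolding zr_def zrow_add by (rule arg_cong)
      qed
      have un: "(cmod (of_real (r / sqrt (r\<^sup>2 + t\<^sup>2))))\<^sup>2 + (cmod (of_real (t / sqrt (r\<^sup>2 + t\<^sup>2)) * \<omega>))\<^sup>2 = 1" for t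
      proof -
        have "0 < r\<^sup>2 + t\<^sup>2" using r by (simp add: add_pos_nonneg)
        then show ?thesis using w r by (simp add: norm_mult norm_divide power_divide power_mult_distrib flip: add_divide_distrib)
      qed
      have "Y [?v, ?v] (zr r) = k1 r / r"
      proof (rule hf_radial_second[OF Y n2 r(1) d(1), where k="\<lambda>R. h R * v R"])
        show "zr r + t *\<^sub>R ?v \<in> Cl" if "\<bar>t\<bar> < d" for t
          unfolding path[OF that] by (rule rotCl[OF l _ un]) (use Rt[OF that] in auto)
        show "Y [] (zr r + t *\<^sub>R ?v) = h (sqrt (r\<^sup>2 + t\<^sup>2)) * v (sqrt (r\<^sup>2 + t\<^sup>2))" if "\<bar>t\<bar> < d" for t
          unfolding path[OF that] using Rt[OF that]
          by (subst rot[OF l _ un]) (auto simp: h_def norm_divide power_divide)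
        show "((\<lambda>R. h R * v R) has_real_derivative k1 R) (at R)" if "r \<le> R" "R < sqrt (r\<^sup>2 + d\<^sup>2)" for R
        proof -
          have R: "0 < R" "R < 1" using that r d(2) by auto
          have "(h has_real_derivative (real N * (- 2 * r\<^sup>2 / R ^ 3)) / (real N - 1)) (at R)"
          proof -
            have "((\<lambda>R. r\<^sup>2 / R\<^sup>2) has_real_derivative (0 * R\<^sup>2 - r\<^sup>2 * (2 * R)) / (R\<^sup>2 * R\<^sup>2)) (at R)"
              using R by (auto intro!: derivative_eq_intros)
            also have "(0 * R\<^sup>2 - r\<^sup>2 * (2 * R)) / (R\<^sup>2 * R\<^sup>2) = - 2 * r\<^sup>2 / R ^ 3"
              using R by (simp add: field_simps power2_eq_square power3_eq_cube)
            finally have "((\<lambda>R. r\<^sup>2 / R\<^sup>2) has_real_derivative - 2 * r\<^sup>2 / R ^ 3) (at R)" .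
            from DERIV_cdivide[OF DERIV_diff[OF DERIV_cmult[OF this, of "real N"] DERIV_const[of 1]], of "real N - 1"]
            show ?thesis unfolding h_def by simp
          qed
          from DERIV_mult[OF this d1[OF R]] show ?thesis unfolding k1_def by (simp add: mult.commute)
        qed
        show "isCont k1 r"
          unfolding k1_def h_def using r d2[OF r] DERIV_isCont[OF d1[OF r]] N2
          by (intro continuous_intros) auto
      qed
      also have "k1 r / r = f 1 r / r - 2 * real N * v r / ((real N - 1) * r\<^sup>2)"
      proof -
        have "h r = 1" unfolding h_def using r N2 by simp
        then show ?thesis unfolding k1_def using r N2 by (simp add: divide_simps power2_eq_square power3_eq_cube) 
      qed
      finally show ?thesis .
    qed
    \<comment> \<open>A change of phase of coordinate k0 does not change |\<alpha>|, so the angular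
      factor is constantly 1.\<close>
    have L0: "Y [tens (ax j0) (\<i> *s ax k0), tens (ax j0) (\<i> *s ax k0)] (zr r) = f 1 r / r"
    proof (rule hf_radial_second[OF Y n2 r(1) d(1), where k=v])
      let ?v = "tens (ax j0) (\<i> *s ax k0)"
      have path: "zr r + t *\<^sub>R ?v = zrow \<iota> j0 (sqrt (r\<^sup>2 + t\<^sup>2) *\<^sub>R
          ((Complex r t / of_real (sqrt (r\<^sup>2 + t\<^sup>2))) *s ax k0 + 0 *s ax k))" if "\<bar>t\<bar> < d" for t
      proof -
        have "r *\<^sub>R ax k0 + t *\<^sub>R (\<i> *s ax k0) = R *\<^sub>R ((Complex r t / of_real R) *s (ax k0 :: complex^'n) + 0 *s ax k)"
          if "R > 0" for R :: real
          using that by (simp add: vec_eq_iff) (simp add: scaleR_conv_of_real complex_eq_iff ax_nth)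
        from this[OF Rt(1)[OF that]] show ?thesis unfolding zr_def zrow_add by (rule arg_cong)
      qed
      have un: "(cmod (Complex r t / of_real (sqrt (r\<^sup>2 + t\<^sup>2))))\<^sup>2 + (cmod 0)\<^sup>2 = 1" for t
      proof -
        have "0 < r\<^sup>2 + t\<^sup>2" using r by (simp add: add_pos_nonneg)
        then show ?thesis using r by (simp add: norm_divide power_divide cmod_power2)
      qed
      then have un': "(cmod (Complex r t / of_real (sqrt (r\<^sup>2 + t\<^sup>2))))\<^sup>2 = 1" for t by simp
      show "zr r + t *\<^sub>R ?v \<in> Cl" if "\<bar>t\<bar> < d" for t
        unfolding path[OF that] by (rule rotCl[OF kK(1) _ un]) (use Rt[OF that] in auto)
      show "Y [] (zr r + t *\<^sub>R ?v) = v (sqrt (r\<^sup>2 + t\<^sup>2))" if "\<bar>t\<bar> < d" for t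
        unfolding path[OF that] using Rt[OF that] N2
        by (subst rot[OF kK(1) _ un]) (auto simp: un' simp del: of_real_power)
      show "(v has_real_derivative f 1 R) (at R)" if "r \<le> R" "R < sqrt (r\<^sup>2 + d\<^sup>2)" for R
        using that r d(2) by (intro d1) auto
      show "isCont (f 1) r" by (rule d2[OF r])
    qed
    have Lam0: "Lam Y (zr r) (V k0) = f 2 r + f 1 r / r"
      using L0 by (simp add: Lam_def V_def csm_tens_right f_def numeral_2_eq_2)
    have LamK: "Lam Y (zr r) (V l) = 2 * (f 1 r / r - 2 * real N * v r / ((real N - 1) * r\<^sup>2))" if "l \<in> K" for l
    proof -
      have "(1::complex) *s ax l = (ax l :: complex^'n)" by (simp add: vec_eq_iff)
      then show ?thesis using Lk[OF that, of 1] Lk[OF that, of \<i>] by (simp add: Lam_def V_def csm_tens_right)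
    qed
    let ?p = "\<lambda>i. if i = j0 then 1 - (norm (r *\<^sub>R (ax k0 :: complex^'n)))\<^sup>2 else 0"
    let ?q = "\<lambda>i. if i = k0 then 1 - r\<^sup>2 else if i \<in> range \<iota> then 0 else 1"
    have "decL (zr r) ?p ax" unfolding zr_def by (rule zrow_decL[OF \<iota>]) (auto simp: k0_def ax_nth inj_eq[OF \<iota>])
    moreover have "decR (zr r) ?q ax" unfolding zr_def k0_def by (rule zrow_decR[OF \<iota>])
    ultimately have "(\<Sum>i\<in>UNIV. \<Sum>l\<in>UNIV. ?p i * ?q l * Lam Y (zr r) (tens (ax i) (ax l))) = 0"
      using hf_harm[OF Y zrCl[of r]] r by simp
    moreover have "(\<Sum>i\<in>UNIV. \<Sum>l\<in>UNIV. ?p i * ?q l * Lam Y (zr r) (tens (ax i) (ax l)))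
       = (\<Sum>i\<in>UNIV. if i = j0 then (1 - r\<^sup>2) * (\<Sum>l\<in>UNIV. ?q l * Lam Y (zr r) (V l)) else 0)"
      by (intro sum.cong refl) (auto simp: V_def sum_distrib_left mult.assoc simp del: if_image_distrib)
    ultimately have "(1 - r\<^sup>2) * (\<Sum>l\<in>UNIV. ?q l * Lam Y (zr r) (V l)) = 0"
      by simp
    then have S0: "(\<Sum>l\<in>UNIV. ?q l * Lam Y (zr r) (V l)) = 0" using r2 by simp
    have "(\<Sum>l\<in>UNIV. ?q l * Lam Y (zr r) (V l)) = (\<Sum>l\<in>insert k0 K. ?q l * Lam Y (zr r) (V l))"
      by (rule sum.mono_neutral_right) (auto simp: K_def)
    also have "\<dots> = (1 - r\<^sup>2) * Lam Y (zr r) (V k0) + (\<Sum>l\<in>K. Lam Y (zr r) (V l))"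
    proof -
      have "(\<Sum>l\<in>K. ?q l * Lam Y (zr r) (V l)) = (\<Sum>l\<in>K. Lam Y (zr r) (V l))"
        using kK by (intro sum.cong refl) (auto simp: K_def)
      then show ?thesis using kK by simp
    qed
    also have "(\<Sum>l\<in>K. Lam Y (zr r) (V l)) = (real N - 1) * (2 * (f 1 r / r - 2 * real N * v r / ((real N - 1) * r\<^sup>2)))"
      using LamK N by simp
    also have "\<dots> = 2 * (real N - 1) * f 1 r / r - 4 * real N * v r / r\<^sup>2"
      using N2 r by (simp add: field_simps)
    finally show ?thesis using S0 unfolding Lam0 v0 by simp
  qed
  have "f 0 1 = 0" by (rule hypergeometric_boundary_value[OF N2 der cf ode])
  then have "a 1 = b 1" using vab[of 1] N2 by (simp add: v0)
  moreover have "zr 1 = zeta0 \<iota>" by (simp add: zr_def k0_def zrow_zeta0)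
  ultimately show ?thesis by (simp add: a_def b_def k0_def)
qed

subsection \<open>Discs in the boundary of square matrix balls\<close>

definition proj :: "complex^'n \<Rightarrow> complex^'n^'n" where
  "proj b = tens b (vcnj b)"

text \<open>For a unit vector \<open>b\<close>: multiplication by w on the line of b, identity on
  its orthogonal complement. Hence it is multiplicative in w, and a contraction for |w| \<le>
  1.\<close>

definition dm :: "complex^'n \<Rightarrow> complex \<Rightarrow> complex^'n^'n" where
  "dm b w = mat 1 + csm (w - 1) (proj b)"

lemma csm_mv: "csm c A *v x = c *s (A *v x)"
  by (simp add: csm_def matrix_vector_mult_def vec_eq_iff sum_distrib_left mult_ac)

lemma tens_mv: "tens a (vcnj b) *v x = cip b x *s a"
  by (simp add: tens_def vcnj_def cip_def matrix_vector_mult_def vec_eq_iff sum_distrib_left mult_ac)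

lemma dm_mv: "dm b w *v x = x + ((w - 1) * cip b x) *s b"
  by (simp add: dm_def proj_def matrix_vector_mult_add_rdistrib csm_mv tens_mv vec_eq_iff mult_ac)

lemma matrix_eqI: "(\<And>x. A *v x = B *v x) \<Longrightarrow> A = (B :: complex^'n^'m)"
  by (simp add: matrix_eq)

lemma dm_mult:
  assumes "norm b = 1"
  shows "dm b w ** dm b w' = dm b (w * w')"
proof (rule matrix_eqI)
  fix x
  have "cip b b = 1" using assms by (simp add: cip_self)
  then show "(dm b w ** dm b w') *v x = dm b (w * w') *v x"
    by (simp add: dm_mv cip_add_right cip_scale_right vec_eq_iff algebra_simps flip: matrix_vector_mul_assoc)
qed

lemma dm_one [simp]: "dm b 1 = mat 1"
  by (rule matrix_eqI) (simp add: dm_mv vec_eq_iff)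

lemma cstar_dm: "cstar (dm b w) = dm b (cnj w)"
  by (simp add: dm_def csm_def proj_def tens_def vcnj_def vec_eq_iff mat_def)

lemma unitary_dm: "norm b = 1 \<Longrightarrow> cmod u = 1 \<Longrightarrow> unitary (dm b u)"
  by (rule unitaryI) (simp add: cstar_dm dm_mult complex_norm_square[symmetric] mult.commute)

lemma norm_dm_le:
  assumes b: "norm b = 1" and w: "cmod w \<le> 1"
  shows "norm (dm b w *v x) \<le> norm x"
proof -
  have "of_real ((norm (dm b w *v x))\<^sup>2) = cip x (dm b (cnj w * w) *v x)"
    unfolding cip_self[symmetric] dm_mult[OF b, symmetric] cstar_dm[symmetric]
    by (simp add: cip_adj[of "cstar (dm b w)", simplified] flip: matrix_vector_mul_assoc)
  also have "\<dots> = of_real ((norm x)\<^sup>2 - (1 - (cmod w)\<^sup>2) * (cmod (cip b x))\<^sup>2)"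
  proof -
    have w2: "cnj w * w = of_real ((cmod w)\<^sup>2)" by (metis complex_norm_square mult.commute)
    have b2: "cip b x * cip x b = of_real ((cmod (cip b x))\<^sup>2)"
      by (metis complex_norm_square cip_cnj)
    have "cip x (dm b (cnj w * w) *v x) = cip x x + (cnj w * w - 1) * (cip b x * cip x b)"
      by (simp add: dm_mv cip_add_right cip_scale_right)
    also have "\<dots> = of_real ((norm x)\<^sup>2 - (1 - (cmod w)\<^sup>2) * (cmod (cip b x))\<^sup>2)"
      unfolding w2 b2 cip_self by (simp add: algebra_simps)
    finally show ?thesis .
  qed
  finally have "(norm (dm b w *v x))\<^sup>2 = (norm x)\<^sup>2 - (1 - (cmod w)\<^sup>2) * (cmod (cip b x))\<^sup>2"
    by (simp only: of_real_eq_iff)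
  moreover have "0 \<le> (1 - (cmod w)\<^sup>2) * (cmod (cip b x))\<^sup>2"
    using w by (intro mult_nonneg_nonneg) (auto simp: power_le_one)
  ultimately have "(norm (dm b w *v x))\<^sup>2 \<le> (norm x)\<^sup>2" by linarith
  then show ?thesis by (rule power2_le_imp_le) simp
qed

lemma zeta0_isometry:
  fixes \<iota> :: "'m::finite \<Rightarrow> 'n::finite"
  assumes "inj \<iota>"
  shows "zeta0 \<iota> ** cstar (zeta0 \<iota>) = mat 1"
proof -
  have "(zeta0 \<iota> ** cstar (zeta0 \<iota>)) $ j $ k = cip (ax (\<iota> k)) (ax (\<iota> j))" for j k
    by (simp add: matrix_matrix_mult_def cip_def zeta0_def mult.commute)
  then show ?thesis using inj_eq[OF assms] by (auto simp: vec_eq_iff cip_ax_ax mat_def)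
qed

lemma isometry_Cl:
  fixes z :: "complex^'n^'m"
  assumes "z ** cstar z = mat 1" shows "z \<in> Cl"
proof -
  have "(norm (cstar z *v w))\<^sup>2 = (norm w)\<^sup>2" for w
    using cip_defect[of w z] assms by simp
  then have "norm (cstar z *v w) = norm w" for w by (simp add: power2_eq_iff_nonneg)
  then show ?thesis by (simp add: Cl_def)
qed

text \<open>In the sum over u and its conjugate the terms in Im u cancel, leaving an affine function
  of Re u; it is determined by u = 1 and u = -1.\<close>

lemma colw_rotate:
  assumes "cmod u = 1"
  shows "colw c (x + u *s y) B + colw c (x + cnj u *s y) B
    = (1 + Re u) * colw c (x + y) B + (1 - Re u) * colw c (x - y) B"
proof -
  let ?a = "cip x (column c B)" and ?b = "cip y (column c B)"
  have u: "(Re u)\<^sup>2 + (Im u)\<^sup>2 = 1" using assms by (simp add: cmod_power2[symmetric])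
  have "(Re a + (Re v * Re b + Im v * Im b))\<^sup>2 + (Im a + (Re v * Im b - Im v * Re b))\<^sup>2
     = (Re a)\<^sup>2 + (Im a)\<^sup>2 + ((Re v)\<^sup>2 + (Im v)\<^sup>2) * ((Re b)\<^sup>2 + (Im b)\<^sup>2)
       + 2 * Re v * (Re a * Re b + Im a * Im b) + 2 * Im v * (Re a * Im b - Im a * Re b)" for a b v :: complex
    by (simp add: power2_eq_square algebra_simps)
  from this[of ?a u ?b] this[of ?a "cnj u" ?b]
  have "colw c (x + u *s y) B + colw c (x + cnj u *s y) B
    = 2 * ((Re ?a)\<^sup>2 + (Im ?a)\<^sup>2 + ((Re ?b)\<^sup>2 + (Im ?b)\<^sup>2)) + 4 * Re u * (Re ?a * Re ?b + Im ?a * Im ?b)"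
    by (simp add: colw_def cip_add_left cip_scale_left cmod_power2 u)
  also have "\<dots> = (1 + Re u) * colw c (x + y) B + (1 - Re u) * colw c (x - y) B"
    unfolding colw_def cip_add_left cip_diff_left cmod_power2
    by (simp add: power2_eq_square algebra_simps)
  finally show ?thesis .
qed

lemma wavg_rotate:
  assumes X: "harm_fam (X :: (complex^'n^'m) list \<Rightarrow> complex^'n^'m \<Rightarrow> real)" and z: "z \<in> Cl" and u: "cmod u = 1"
  shows "wavg X c (x + u *s y) z + wavg X c (x + cnj u *s y) z
    = (1 + Re u) * wavg X c (x + y) z + (1 - Re u) * wavg X c (x - y) z"
proof -
  note int = wavg_integrable[OF X z continuous_on_colw]
  have e: "X [] (z ** B) * colw c (x + u *s y) B + X [] (z ** B) * colw c (x + cnj u *s y) B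
    = (1 + Re u) * (X [] (z ** B) * colw c (x + y) B) + (1 - Re u) * (X [] (z ** B) * colw c (x - y) B)" for B
    unfolding distrib_left[symmetric] colw_rotate[OF u] by (simp only: distrib_left mult.left_commute)
  have "wavg X c (x + u *s y) z + wavg X c (x + cnj u *s y) z
    = (LINT B|haar. X [] (z ** B) * colw c (x + u *s y) B + X [] (z ** B) * colw c (x + cnj u *s y) B)"
    unfolding wavg_def haar_avg_def using int by simp
  also have "\<dots> = (LINT B|haar. (1 + Re u) * (X [] (z ** B) * colw c (x + y) B) + (1 - Re u) * (X [] (z ** B) * colw c (x - y) B))"
    unfolding e ..
  also have "\<dots> = (1 + Re u) * wavg X c (x + y) z + (1 - Re u) * wavg X c (x - y) z"
    unfolding wavg_def haar_avg_def using int by simp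
  finally show ?thesis .
qed

text \<open>On the disc \<open>zw\<close> the operator is a positive multiple of the Laplacian, and
  a rotation of the disc acts on the weight vector by \<open>dm b u\<close>. The average thus has
  only the angular modes 0, 1 and -1, and on the real diameter the equation involves f(r) and f(-r)
  alone.\<close>

lemma boundary_disc_derivative:
  fixes X :: "(complex^'n^'m) list \<Rightarrow> complex^'n^'m \<Rightarrow> real"
  assumes X: "harm_fam X" and n2: "2 \<le> CARD('n)" and z: "z ** cstar z = mat 1" "cstar z ** z = mat 1"
    and b: "norm b = 1"
  shows "haar_avg X (colw c x) [z ** proj b] z = (wavg X c x z - wavg X c (dm b (-1) *v x) z) / 2"
proof -
  define Y where "Y = haar_avg X (colw c x)"
  have Y: "harm_fam Y" unfolding Y_def by (intro hf_avg X n2 continuous_intros)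
  define V where "V = z ** proj b"
  define zw where "zw w = z ** dm b w" for w
  have zwCl: "zw w \<in> Cl" if "cmod w \<le> 1" for w
  proof -
    have "norm (cstar (zw w) *v y) \<le> norm y" for y
    proof -
      have "norm (cstar (zw w) *v y) \<le> norm (cstar z *v y)"
        using norm_dm_le[OF b, of "cnj w" "cstar z *v y"] that
        by (simp add: zw_def cstar_mult cstar_dm flip: matrix_vector_mul_assoc)
      also have "\<dots> \<le> norm y" using isometry_Cl[OF z(1)] by (simp add: Cl_def)
      finally show ?thesis .
    qed
    then show ?thesis by (simp add: Cl_def)
  qed
  have path: "zw w + t *\<^sub>R csm c V = zw (w + of_real t * c)" for w t c
  proof -
    have "csm (w + of_real t * c - 1) P = csm (w - 1) P + t *\<^sub>R csm c P" for P :: "complex^'n^'n"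
      by (simp add: csm_def vec_eq_iff) (simp add: scaleR_conv_of_real algebra_simps)
    moreover have "z ** csm c P = csm c (z ** P)" for P :: "complex^'n^'n"
      by (simp add: csm_def matrix_matrix_mult_def vec_eq_iff sum_distrib_left mult_ac)
    ultimately show ?thesis
      by (simp add: zw_def dm_def V_def mm_distribs)
  qed
  have csm1: "csm 1 V = V" by (simp add: csm_def vec_eq_iff)
  define f where "f i r = Y (replicate i V) (zw (of_real r))" for i and r :: real
  have zr: "zw (of_real r) = zw 0 + r *\<^sub>R V" for r :: real
    using path[of 0 r 1] by (simp add: csm1)
  have der: "(f i has_real_derivative f (Suc i) r) (at r within {-1..1})" if "i < 2" "r \<in> {-1..1}" for i r
  proof -
    have "((\<lambda>s. Y (replicate i V) (zw 0 + s *\<^sub>R V)) has_real_derivative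
       Y (V # replicate i V) (zw 0 + r *\<^sub>R V)) (at r within {-1..1})"
      using that n2 zwCl by (intro hf_deriv[OF Y]) (auto simp flip: zr)
    then show ?thesis unfolding f_def by (simp flip: zr)
  qed
  have der': "(f i has_real_derivative f (Suc i) r) (at r)" if "i < 2" "\<bar>r\<bar> < 1" for i r
    using der[of i r] at_within_Icc_at[of "-1" r 1] that by (simp add: abs_less_iff)
  have f0: "f 0 r = wavg X c x (zw (of_real r))" for r by (simp add: f_def Y_def wavg_def)
  have zw_mult: "zw (w * u) = zw w ** dm b u" for w u
    by (simp add: zw_def dm_mult[OF b, symmetric] matrix_mul_assoc)
  define p where "p = cip b x *s b"
  have dmx: "dm b u *v x = (x - p) + u *s p" for u
    by (simp add: dm_mv p_def vec_eq_iff algebra_simps)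
  have fm: "wavg X c ((x - p) - p) (zw (of_real R)) = f 0 (- R)" if "\<bar>R\<bar> \<le> 1" for R
  proof -
    have "dm b (-1) *v x = (x - p) - p" unfolding dmx by (simp add: vec_eq_iff)
    moreover have "wavg X c x (zw (of_real R) ** dm b (-1)) = wavg X c (dm b (-1) *v x) (zw (of_real R))"
      using that by (intro wavg_shift[OF X zwCl] unitary_dm b) auto
    moreover have "zw (of_real R) ** dm b (-1) = zw (of_real (- R))"
      using zw_mult[of "of_real R" "-1"] by simp
    ultimately show ?thesis by (simp add: f0)
  qed
  have ode: "f 2 r + f 1 r / r - (f 0 r - f 0 (- r)) / (2 * r\<^sup>2) = 0" if r: "r \<noteq> 0" "\<bar>r\<bar> < 1" for r
  proof -
    define d where "d = sqrt (1 - r\<^sup>2)"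
    have r2: "r\<^sup>2 < 1" using r by (simp add: abs_square_less_1)
    then have d: "0 < d" "r\<^sup>2 + d\<^sup>2 = 1" by (simp_all add: d_def)
    have Rt: "0 < sqrt (r\<^sup>2 + t\<^sup>2)" "sqrt (r\<^sup>2 + t\<^sup>2) < 1" if "\<bar>t\<bar> < d" for t
    proof -
      have "t\<^sup>2 < d\<^sup>2" using power_strict_mono[OF that, of 2] by simp
      then show "sqrt (r\<^sup>2 + t\<^sup>2) < 1" using d(2) by (simp add: real_sqrt_lt_1_iff)
      show "0 < sqrt (r\<^sup>2 + t\<^sup>2)" using r by (simp add: add_pos_nonneg)
    qed
    have iV: "zw (of_real r) + t *\<^sub>R csm \<i> V = zw (Complex r t)" for t
      unfolding path by (rule arg_cong[of _ _ zw]) (simp add: complex_eq_iff)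
    have seg: "zw (of_real r) + t *\<^sub>R csm \<i> V \<in> Cl" if "\<bar>t\<bar> < d" for t
      unfolding iV using Rt[OF that] by (intro zwCl) (simp add: complex_norm)
    define \<psi> where "\<psi> t = Y [] (zw (of_real r) + t *\<^sub>R csm \<i> V)" for t
    define \<psi>1 where "\<psi>1 t = Y [csm \<i> V] (zw (of_real r) + t *\<^sub>R csm \<i> V)" for t
    define D where "D = Y [csm \<i> V, csm \<i> V] (zw (of_real r))"
    have \<psi>d: "(\<psi> has_real_derivative \<psi>1 t) (at t)" if "\<bar>t\<bar> < d" for t
      unfolding \<psi>_def \<psi>1_def by (rule hf_second_deriv(1)[OF Y n2 seg that])
    have \<psi>1d: "(\<psi>1 has_real_derivative D) (at 0)"
      unfolding \<psi>1_def D_def using hf_second_deriv(2)[OF Y n2 seg, of d 0] d by simp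
    \<comment> \<open>The symmetrized average at radius R, where the phase has real part r / R. As r
      may be negative, the starting radius is |r|.\<close>
    define k where "k R = ((1 + r / R) * f 0 R + (1 - r / R) * f 0 (- R)) / 2" for R
    define k1 where "k1 R = ((- r / R\<^sup>2) * f 0 R + (1 + r / R) * f 1 R + (r / R\<^sup>2) * f 0 (- R) - (1 - r / R) * f 1 (- R)) / 2" for R
    have fmd: "((\<lambda>R. f i (- R)) has_real_derivative - f (Suc i) (- R)) (at R)" if "i < 2" "\<bar>R\<bar> < 1" for i R
      using der'[of i "- R"] that by (simp add: DERIV_mirror[symmetric])
      \<comment> \<open>Averaging over t and -t keeps the second derivative at 0 and pairs conjugate
        phases, as \<open>wavg_rotate\<close> requires.\<close>
      have A1: "((\<lambda>t. (\<psi> t + \<psi> (- t)) / 2) has_real_derivative (\<psi>1 t - \<psi>1 (- t)) / 2) (at t)" if "\<bar>t\<bar> < d" for t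
      proof -
        have "((\<lambda>t. \<psi> (- t)) has_real_derivative - \<psi>1 (- t)) (at t)"
          using \<psi>d[of "- t"] that by (simp add: DERIV_mirror[symmetric])
        from DERIV_cdivide[OF DERIV_add[OF \<psi>d[OF that] this], of 2] show ?thesis by simp
      qed
      have A2: "((\<lambda>t. (\<psi>1 t - \<psi>1 (- t)) / 2) has_real_derivative D) (at 0)"
      proof -
        have "((\<lambda>t. \<psi>1 (- t)) has_real_derivative - D) (at 0)"
          using \<psi>1d DERIV_mirror[where f=\<psi>1 and x=0 and y=D] by simp
        from DERIV_cdivide[OF DERIV_diff[OF \<psi>1d this], of 2] show ?thesis by simp
      qed
      have A3: "(\<psi> t + \<psi> (- t)) / 2 = k (sqrt (\<bar>r\<bar>\<^sup>2 + t\<^sup>2))" if t: "\<bar>t\<bar> < d" for t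
      proof -
        define R where "R = sqrt (r\<^sup>2 + t\<^sup>2)"
        have R: "0 < R" "\<bar>R\<bar> \<le> 1" using Rt[OF t] by (simp_all add: R_def)
        have RCl: "zw (of_real R) \<in> Cl" using R by (intro zwCl) simp
        define u where "u = Complex r t / of_real R"
        have u: "cmod u = 1" using R r(1) by (simp add: u_def norm_divide complex_norm R_def)
        have c1: "Complex r t = of_real R * u" "Complex r (- t) = of_real R * cnj u"
          using R by (simp_all add: u_def complex_eq_iff)
        have "\<psi> t = wavg X c ((x - p) + u *s p) (zw (of_real R))"
          unfolding \<psi>_def iV c1 zw_mult Y_def wavg_def[symmetric] dmx[symmetric]
          by (rule wavg_shift[OF X RCl unitary_dm[OF b u]])
        moreover have "\<psi> (- t) = wavg X c ((x - p) + cnj u *s p) (zw (of_real R))"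
          unfolding \<psi>_def iV c1 zw_mult Y_def wavg_def[symmetric] dmx[symmetric]
          by (rule wavg_shift[OF X RCl unitary_dm[OF b]]) (simp add: u)
        moreover have "Re u = r / R" by (simp add: u_def)
        ultimately have "\<psi> t + \<psi> (- t) = (1 + r / R) * f 0 R + (1 - r / R) * f 0 (- R)"
          using wavg_rotate[OF X RCl u, of c "x - p" p] fm[OF R(2)] by (simp add: f0)
        then show ?thesis by (simp add: k_def R_def)
      qed
      have A4: "(k has_real_derivative k1 R) (at R)" if R: "\<bar>r\<bar> \<le> R" "R < sqrt (\<bar>r\<bar>\<^sup>2 + d\<^sup>2)" for R
      proof -
      have R': "0 < R" "\<bar>R\<bar> < 1" using R r d by auto
      have rR: "((\<lambda>R. r / R) has_real_derivative - r / R\<^sup>2) (at R)"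
        using R' by (auto intro!: derivative_eq_intros simp: power2_eq_square)
      have "((\<lambda>R. (1 + r / R) * f 0 R + (1 - r / R) * f 0 (- R)) has_real_derivative
         ((0 + - r / R\<^sup>2) * f 0 R + f 1 R * (1 + r / R)) + ((0 - - r / R\<^sup>2) * f 0 (- R) + - f 1 (- R) * (1 - r / R))) (at R)"
        using der'[of 0 R] fmd[of 0 R] R'
        by (intro DERIV_add DERIV_mult DERIV_diff DERIV_const rR) auto
      from DERIV_cdivide[OF this, of 2] show ?thesis
        unfolding k_def k1_def by (simp add: mult.commute add_diff_eq)
      qed
      have A5: "isCont k1 \<bar>r\<bar>"
        unfolding k1_def using r DERIV_isCont[OF der'[of 0 "\<bar>r\<bar>"]] DERIV_isCont[OF der'[of 1 "\<bar>r\<bar>"]]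
          DERIV_isCont[OF fmd[of 0 "\<bar>r\<bar>"]] DERIV_isCont[OF fmd[of 1 "\<bar>r\<bar>"]]
        by (intro continuous_intros) auto
      have "D = k1 \<bar>r\<bar> / \<bar>r\<bar>"
        by (rule radial_second_derivative[OF _ d(1) A1 A2 A3 A4 A5]) (use r in auto)
    also have "\<dots> = f 1 r / r - (f 0 r - f 0 (- r)) / (2 * r\<^sup>2)"
      using r(1) unfolding k1_def by (cases "0 < r") (simp_all add: field_simps power2_eq_square)
    finally have D: "D = f 1 r / r - (f 0 r - f 0 (- r)) / (2 * r\<^sup>2)" .
    have Lam: "Lam Y (zw (of_real r)) V = f 2 r + D"
      by (simp add: Lam_def D_def f_def numeral_2_eq_2)
    let ?z = "zw (of_real r)"
    \<comment> \<open>Both defects have rank one on the disc, so a single arbitrary index carries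
      the weight.\<close>
    define i0 :: 'm where "i0 = undefined"
    define l0 :: 'n where "l0 = undefined"
    have sq: "dm b (cnj (of_real r)) ** dm b (of_real r) = dm b (of_real (r\<^sup>2))" "dm b (of_real r) ** dm b (cnj (of_real r)) = dm b (of_real (r\<^sup>2))"
      by (simp_all add: dm_mult[OF b] power2_eq_square)
    have ent: "(mat 1 - dm b (of_real (r\<^sup>2))) = csm (of_real (1 - r\<^sup>2)) (proj b)"
      by (simp add: dm_def csm_def vec_eq_iff algebra_simps)
    have "mat 1 - ?z ** cstar ?z = z ** (mat 1 - dm b (of_real (r\<^sup>2))) ** cstar z"
    proof -
      have "?z ** cstar ?z = z ** (dm b (of_real r) ** dm b (cnj (of_real r))) ** cstar z"
        by (simp add: zw_def cstar_mult cstar_dm matrix_mul_assoc)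
      then show ?thesis unfolding sq by (simp add: mm_distribs z)
    qed
    also have "\<dots> = csm (of_real (1 - r\<^sup>2)) (tens (z *v b) (vcnj (z *v b)))"
    proof -
      have c: "z ** csm c P ** cstar z = csm c (z ** P ** cstar z)" for c and P :: "complex^'n^'n"
        by (simp add: csm_def matrix_matrix_mult_def vec_eq_iff sum_distrib_left mult_ac)
      have p: "z ** proj b ** cstar z = tens (z *v b) (vcnj (z *v b))"
        by (rule matrix_eqI) (simp add: proj_def tens_mv mv_scale cip_adj[of "cstar z", simplified] flip: matrix_vector_mul_assoc)
      show ?thesis unfolding ent c p ..
    qed
    finally have "decL ?z (\<lambda>i. if i = i0 then 1 - r\<^sup>2 else 0) (\<lambda>_. z *v b)"
      unfolding decL_def by (simp add: csm_def tens_def vcnj_def if_distrib[of of_real] if_distrib[of "\<lambda>x. x * _"] cong: if_cong)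
    moreover have "decR ?z (\<lambda>i. if i = l0 then 1 - r\<^sup>2 else 0) (\<lambda>_. vcnj b)"
    proof -
      have "cstar ?z ** ?z = dm b (cnj (of_real r)) ** (cstar z ** z) ** dm b (of_real r)"
        by (simp add: zw_def cstar_mult cstar_dm matrix_mul_assoc)
      then have e: "cstar ?z ** ?z = dm b (of_real (r\<^sup>2))"
        unfolding z matrix_mul_rid sq .
      have "mat 1 - cstar ?z ** ?z = csm (of_real (1 - r\<^sup>2)) (proj b)"
        unfolding e ent ..
      then show ?thesis
        unfolding decR_def by (simp add: proj_def csm_def tens_def vcnj_def if_distrib[of of_real] if_distrib[of "\<lambda>x. x * _"] cong: if_cong)
    qed
    ultimately have "(\<Sum>i\<in>UNIV. \<Sum>l\<in>UNIV. (if i = i0 then 1 - r\<^sup>2 else 0) * (if l = l0 then 1 - r\<^sup>2 else 0) * Lam Y ?z (tens (z *v b) (vcnj b))) = 0"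
      using hf_harm[OF Y zwCl] r by fastforce
    moreover have "tens (z *v b) (vcnj b) = V"
      by (rule matrix_eqI) (simp add: V_def proj_def tens_mv mv_scale flip: matrix_vector_mul_assoc)
    moreover have "(\<Sum>i\<in>UNIV. \<Sum>l\<in>UNIV. (if i = i0 then 1 - r\<^sup>2 else 0) * (if l = l0 then 1 - r\<^sup>2 else 0) * L)
       = (1 - r\<^sup>2) * (1 - r\<^sup>2) * L" for L :: real
      by (simp add: if_distrib[of "\<lambda>x. x * _"] if_distrib[of "\<lambda>x. _ * x"] cong: if_cong)
    ultimately have "Lam Y ?z V = 0" using r2 by simp
    then show ?thesis unfolding Lam D by simp
  qed
  have "f 1 1 = (f 0 1 - f 0 (- 1)) / 2" by (rule disc_radial_derivative[OF der ode])
  moreover have "zw 1 = z" by (simp add: zw_def)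
  moreover have "f 0 (-1) = wavg X c (dm b (-1) *v x) z"
    using fm[of 1] \<open>zw 1 = z\<close> unfolding dmx by (simp add: vec_eq_iff)
  ultimately show ?thesis by (simp add: f_def Y_def V_def wavg_def)
qed

subsection \<open>Averages on the Shilov boundary and in the interior\<close>

text \<open>The projections onto (e_k + e_l) / sqrt 2 and (e_k - e_l) / sqrt 2 have the same sum as
  those onto e_k and e_l. With weight vector e_k the radial derivative is half the difference of the
  two averages for each of the first pair and 0 for each of the second; linearity forces the
  difference to vanish.\<close>

lemma wavg_square:
  fixes X :: "(complex^'n^'m) list \<Rightarrow> complex^'n^'m \<Rightarrow> real"
  assumes X: "harm_fam X" and n2: "2 \<le> CARD('n)" and z: "z ** cstar z = mat 1" "cstar z ** z = mat 1" and kl: "k \<noteq> l"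
  shows "wavg X c (ax k) z = wavg X c (ax l) z"
proof -
  define Y where "Y = haar_avg X (colw c (ax k))"
  have Y: "harm_fam Y" unfolding Y_def by (intro hf_avg X n2 continuous_intros)
  define s :: complex where "s = of_real (1 / sqrt 2)"
  have s2: "s * s = 1 / 2" by (simp add: s_def flip: of_real_mult)
  have cs: "cnj s = s" by (simp add: s_def)
  define bp where "bp = s *s (ax k + ax l)"
  define bm where "bm = s *s (ax k - ax l)"
  have "cip bp bp = 1" "cip bm bm = 1"
    using kl s2 by (simp_all add: bp_def bm_def cip_scale_left cip_scale_right cip_add_left cip_add_right
        cip_diff_left cip_diff_right cip_ax_ax cs mult_ac)
  then have "(norm bp)\<^sup>2 = 1" "(norm bm)\<^sup>2 = 1" unfolding cip_self using of_real_eq_1_iff by blast+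
  then have n: "norm bp = 1" "norm bm = 1"
    using power2_eq_iff_nonneg[of "norm bp" 1] power2_eq_iff_nonneg[of "norm bm" 1] by simp_all
  have c: "cip bp (ax k) = s" "cip bm (ax k) = s"
    using kl by (simp_all add: bp_def bm_def cip_scale_left cip_add_left cip_diff_left cip_ax_ax cs)
  have d: "Y [z ** proj b] z = (wavg X c (ax k) z - wavg X c (dm b (-1) *v ax k) z) / 2" if "norm b = 1" for b
    unfolding Y_def by (rule boundary_disc_derivative[OF X n2 z that])
  have ss: "(-2 * s) *s (s *s w) = - w" for w :: "complex^'n"
  proof -
    have "(-2 * s) * s = -2 * (s * s)" by simp
    then have "(-2 * s) * s = -1" unfolding s2 by simp
    then show ?thesis unfolding vector_smult_assoc by (simp add: vec_eq_iff)
  qed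
  have "dm bp (-1) *v ax k = ax k + (-2 * s) *s bp" "dm bm (-1) *v ax k = ax k + (-2 * s) *s bm"
    by (simp_all add: dm_mv c)
  then have "dm bp (-1) *v ax k = - ax l" "dm bm (-1) *v ax k = ax l"
    unfolding bp_def bm_def ss by simp_all
  moreover have "dm (ax k) (-1) *v ax k = - ax k" "dm (ax l) (-1) *v ax k = ax k"
    using kl by (simp_all add: dm_mv cip_ax_ax vec_eq_iff)
  ultimately have e: "Y [z ** proj bp] z = (wavg X c (ax k) z - wavg X c (ax l) z) / 2"
    "Y [z ** proj bm] z = (wavg X c (ax k) z - wavg X c (ax l) z) / 2"
    "Y [z ** proj (ax k)] z = 0" "Y [z ** proj (ax l)] z = 0"
    using d[OF n(1)] d[OF n(2)] d[of "ax k"] d[of "ax l"] by (simp_all add: wavg_neg)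
  have "proj bp + proj bm = proj (ax k) + proj (ax l)"
  proof (rule matrix_eqI)
    fix x
    have cx: "cip bp x = s * (x $ k + x $ l)" "cip bm x = s * (x $ k - x $ l)"
      by (simp_all add: bp_def bm_def cip_scale_left cip_add_left cip_diff_left cip_axis cs distrib_left right_diff_distrib)
    have sAB: "s * A * (s * B) = A * B / 2" for A B
    proof -
      have "s * A * (s * B) = (s * s) * (A * B)" by (simp only: mult_ac)
      then show ?thesis by (simp add: s2)
    qed
    have m1: "((proj bp + proj bm) *v x) $ i = cip bp x * (s * (ax k $ i + ax l $ i)) + cip bm x * (s * (ax k $ i - ax l $ i))" for i
    proof -
      have "bp $ i = s * (ax k $ i + ax l $ i)" "bm $ i = s * (ax k $ i - ax l $ i)"
        by (simp_all add: bp_def bm_def distrib_left right_diff_distrib)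
      then show ?thesis by (simp only: proj_def matrix_vector_mult_add_rdistrib tens_mv vector_add_component vector_smult_component)
    qed
    have m2: "((proj (ax k) + proj (ax l)) *v x) $ i = x $ k * ax k $ i + x $ l * ax l $ i" for i
      by (simp add: proj_def matrix_vector_mult_add_rdistrib tens_mv cip_axis)
    show "(proj bp + proj bm) *v x = (proj (ax k) + proj (ax l)) *v x"
      unfolding vec_eq_iff m1 m2 cx sAB by (simp add: field_simps)
  qed
  then have "z ** proj bp + z ** proj bm = z ** proj (ax k) + z ** proj (ax l)"
    by (simp flip: mm_distribs)
  moreover have lin: "linear (\<lambda>v. Y [v] z)"
    using hf_linear[OF Y, of "[]" "[]" z] isometry_Cl[OF z(1)] n2 by simp
  ultimately have "Y [z ** proj bp] z + Y [z ** proj bm] z = Y [z ** proj (ax k)] z + Y [z ** proj (ax l)] z"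
    by (metis linear_add[OF lin])
  then show ?thesis unfolding e by simp
qed

text \<open>If \<open>\<iota>\<close> is onto, the point is unitary on both sides and
  \<open>wavg_square\<close> applies; otherwise every axis is compared with one outside the range.
  \<open>sum_wavg\<close> then gives the common value.\<close>

lemma wavg_coordinates:
  fixes X :: "(complex^'n^'m) list \<Rightarrow> complex^'n^'m \<Rightarrow> real" and \<iota> :: "'m \<Rightarrow> 'n"
  assumes X: "harm_fam X" and n2: "2 \<le> CARD('n)" and \<iota>: "inj \<iota>"
  shows "wavg X c (ax k) (zeta0 \<iota>) = total X (zeta0 \<iota>) / CARD('n)"
proof -
  have Cl: "zeta0 \<iota> \<in> Cl" by (rule isometry_Cl[OF zeta0_isometry[OF \<iota>]])
  have eq: "wavg X c (ax k) (zeta0 \<iota>) = wavg X c (ax l) (zeta0 \<iota>)" for k l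
  proof (cases "range \<iota> = UNIV")
    case True
    have "(cstar (zeta0 \<iota>) ** zeta0 \<iota>) $ a $ b = mat 1 $ a $ b" for a b
    proof -
      obtain j where j: "a = \<iota> j" using True by blast
      have "(cstar (zeta0 \<iota>) ** zeta0 \<iota>) $ a $ b = (\<Sum>i\<in>UNIV. if i = j then (if a = b then 1 else 0) else 0)"
        unfolding matrix_matrix_mult_def vec_lambda_beta
        by (intro sum.cong refl) (auto simp: zeta0_def ax_nth j inj_eq[OF \<iota>])
      then show ?thesis by (simp add: mat_def)
    qed
    then have "cstar (zeta0 \<iota>) ** zeta0 \<iota> = mat 1" by (simp add: vec_eq_iff)
    then show ?thesis using wavg_square[OF X n2 zeta0_isometry[OF \<iota>]] by (cases "k = l") auto
  next
    case False
    then obtain k' where k': "k' \<notin> range \<iota>" by blast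
    have "wavg X c (ax k) (zeta0 \<iota>) = wavg X c (ax k') (zeta0 \<iota>)" for k
    proof (cases "k \<in> range \<iota>")
      case True
      then show ?thesis using boundary_ball_moments[OF X n2 \<iota> k'] by auto
    next
      case False
      then show ?thesis
        using boundary_ball_moments[OF X n2 \<iota> k'] boundary_ball_moments[OF X n2 \<iota> False] by metis
    qed
    then show ?thesis by metis
  qed
  have "total X (zeta0 \<iota>) = (\<Sum>l\<in>UNIV. wavg X c (ax l) (zeta0 \<iota>))" by (rule sum_wavg[OF X Cl, symmetric])
  also have "\<dots> = (\<Sum>l\<in>(UNIV :: 'n set). wavg X c (ax k) (zeta0 \<iota>))" by (intro sum.cong refl eq)
  finally show ?thesis by simp
qed

lemma zeta0_fixed:
  fixes \<iota> :: "'m::finite \<Rightarrow> 'n::finite"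
  assumes C: "unitary C" and fx: "\<And>j. C *v ax (\<iota> j) = ax (\<iota> j)"
  shows "zeta0 \<iota> ** C = zeta0 \<iota>"
proof -
  have "cstar C *v ax (\<iota> j) = ax (\<iota> j)" for j
    using C fx[of j] unfolding unitary_def by (metis matrix_vector_mul_assoc matrix_vector_mul_lid)
  then have "C $ \<iota> j = ax (\<iota> j)" for j
    by (simp add: mv_axis column_def vec_eq_iff ax_nth) (metis complex_cnj_one complex_cnj_zero complex_cnj_cnj)
  then show ?thesis by (simp add: zeta0_def row_mult vm_ax vec_eq_iff[of "zeta0 _ ** C"]) (simp add: vec_eq_iff zeta0_def row_mult vm_ax)
qed

text \<open>x splits into u on the axes in \<open>range \<iota>\<close> and v on the others. Unitary
  matrices fixing the point rotate v to an axis; u is reached from an axis by acting on the rows. A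
  sign change on the complement of the range removes the mixed term.\<close>

lemma wavg_unit:
  fixes X :: "(complex^'n^'m) list \<Rightarrow> complex^'n^'m \<Rightarrow> real" and \<iota> :: "'m \<Rightarrow> 'n"
  assumes X: "harm_fam X" and n2: "2 \<le> CARD('n)" and \<iota>: "inj \<iota>" and x: "norm x = 1"
  shows "wavg X c x (zeta0 \<iota>) = total X (zeta0 \<iota>) / CARD('n)"
proof -
  let ?z = "zeta0 \<iota>"
  define \<kappa> where "\<kappa> = total X ?z / CARD('n)"
  have iso: "?z ** cstar ?z = mat 1" by (rule zeta0_isometry[OF \<iota>])
  have Cl: "?z \<in> Cl" by (rule isometry_Cl[OF iso])
  have W0: "wavg X c 0 ?z = 0"
  proof -
    have "0 *s (0 :: complex^'n) = 0" by simp
    then show ?thesis using wavg_scale[of X c 0 0 ?z] by simp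
  qed
  define u where "u = (\<chi> a. if a \<in> range \<iota> then x $ a else 0)"
  define v where "v = (\<chi> a. if a \<in> range \<iota> then 0 else x $ a)"
  define y where "y = (\<chi> j. x $ \<iota> j)"
  have uy: "u = cstar ?z *v y"
  proof -
    have "(cstar ?z *v y) $ a = u $ a" for a
    proof (cases "a \<in> range \<iota>")
      case True
      then obtain j where j: "a = \<iota> j" by blast
      have "(cstar ?z *v y) $ a = (\<Sum>i\<in>UNIV. if i = j then x $ \<iota> j else 0)"
        unfolding matrix_vector_mult_def vec_lambda_beta
        by (intro sum.cong refl) (auto simp: zeta0_def ax_nth y_def j inj_eq[OF \<iota>])
      then show ?thesis using j by (simp add: u_def)
    next
      case False
      then have "(cstar ?z *v y) $ a = 0"
        unfolding matrix_vector_mult_def vec_lambda_beta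
        by (intro sum.neutral) (auto simp: zeta0_def ax_nth)
      then show ?thesis using False by (simp add: u_def)
    qed
    then show ?thesis by (simp add: vec_eq_iff)
  qed
  have nrm: "(norm y)\<^sup>2 + (norm v)\<^sup>2 = 1"
  proof -
    have "(norm y)\<^sup>2 = (\<Sum>a\<in>range \<iota>. (cmod (x $ a))\<^sup>2)"
      using \<iota> by (simp add: norm_vec_sq y_def sum.reindex)
    moreover have "(norm v)\<^sup>2 = (\<Sum>a\<in>UNIV - range \<iota>. (cmod (x $ a))\<^sup>2)"
      unfolding norm_vec_sq by (rule sum.mono_neutral_cong_right) (auto simp: v_def)
    moreover have "(\<Sum>a\<in>UNIV. (cmod (x $ a))\<^sup>2) = (\<Sum>a\<in>UNIV - range \<iota>. (cmod (x $ a))\<^sup>2) + (\<Sum>a\<in>range \<iota>. (cmod (x $ a))\<^sup>2)"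
      by (rule sum.subset_diff) auto
    moreover have "(\<Sum>a\<in>UNIV. (cmod (x $ a))\<^sup>2) = 1"
      using x by (simp flip: norm_vec_sq)
    ultimately show ?thesis by simp
  qed
  have Wv: "wavg X c v ?z = (norm v)\<^sup>2 * \<kappa>"
  proof (cases "v = 0")
    case False
    then obtain k where "v $ k \<noteq> 0" by (auto simp: vec_eq_iff)
    then have k: "k \<notin> range \<iota>" by (auto simp: v_def split: if_splits)
    define a where "a = (of_real (norm v) :: complex) *s (ax k :: complex^'n)"
    have "norm a = norm v"
    proof -
      have "(norm a)\<^sup>2 = (norm v)\<^sup>2 * (norm (ax k :: complex^'n))\<^sup>2"
        by (simp only: a_def norm_vec_sq[of "_ *s _"] vector_smult_component norm_mult power_mult_distrib
            norm_vec_sq[of "ax k"] sum_distrib_left norm_of_real power2_abs)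
      then show ?thesis by (simp add: power2_eq_iff_nonneg)
    qed
    from complex_reflection[OF this] obtain C where C: "unitary C" "C *v a = v"
      "\<And>w. cip a w = 0 \<Longrightarrow> cip v w = 0 \<Longrightarrow> C *v w = w" by blast
    have "C *v ax (\<iota> j) = ax (\<iota> j)" for j
    proof (rule C(3))
      show "cip a (ax (\<iota> j)) = 0" using k by (auto simp: a_def cip_scale_left cip_ax_ax)
      have "cip (ax (\<iota> j)) v = 0" by (simp add: cip_axis v_def)
      then show "cip v (ax (\<iota> j)) = 0" by (metis cip_cnj complex_cnj_zero)
    qed
    from wavg_fixed[OF X Cl C(1) zeta0_fixed[OF C(1) this], of c a] show ?thesis
      unfolding C(2) using wavg_coordinates[OF X n2 \<iota>, of c k] by (simp add: a_def wavg_scale \<kappa>_def)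
  qed (simp add: W0)
  have Wu: "wavg X c u ?z = (norm y)\<^sup>2 * \<kappa>"
  proof (cases "y = 0")
    case True
    then show ?thesis unfolding uy by (simp add: W0)
  next
    case False
    define j0 :: 'm where "j0 = undefined"
    define y' where "y' = (of_real (1 / norm y) :: complex) *s y"
    have yy: "y = of_real (norm y) *s y'" using False by (simp add: y'_def vec_eq_iff)
    have "(norm y')\<^sup>2 = (1 / norm y)\<^sup>2 * (norm y)\<^sup>2"
      by (simp only: y'_def norm_vec_sq[of "_ *s _"] vector_smult_component norm_mult power_mult_distrib
            norm_vec_sq[of y] sum_distrib_left norm_of_real power2_abs)
    then have "(norm y')\<^sup>2 = 1\<^sup>2" using False by (simp flip: power_mult_distrib)
    then have "norm y' = 1" by (simp only: power2_eq_iff_nonneg norm_ge_zero zero_le_one)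
    \<comment> \<open>\<open>A\<close> acts on rows. As \<open>A ** zeta0 \<iota>\<close> is again
      an isometry, it equals \<open>zeta0 \<iota> ** C\<close> for a unitary \<open>C\<close>, and
      \<open>C\<close> carries an axis to the direction of u.\<close>
    then obtain A where A: "unitary A" "column j0 A = y'" using exists_unitary_column by blast
    define X' where "X' vs z = X (map (\<lambda>v. A ** v ** mat 1) vs) (A ** z ** mat 1)" for vs z
    have X': "harm_fam X'" unfolding X'_def by (rule hf_translate[OF X A(1) unitary_mat])
    have "cstar (cstar (A ** ?z)) ** cstar (A ** ?z) = mat 1"
    proof -
      have "A ** ?z ** cstar (A ** ?z) = A ** (?z ** cstar ?z) ** cstar A"
        by (simp add: cstar_mult matrix_mul_assoc)
      then show ?thesis using A(1) by (simp add: iso unitary_def)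
    qed
    moreover have "cstar (cstar ?z) ** cstar ?z = mat 1" by (simp add: iso)
    ultimately obtain U where U: "unitary U" "U ** cstar ?z = cstar (A ** ?z)"
      using isometry_transitive[of "cstar ?z" "cstar (A ** ?z)"] by blast
    define C where "C = cstar U"
    have C: "unitary C" using U by (simp add: C_def)
    have zC: "?z ** C = A ** ?z"
      using arg_cong[OF U(2), of cstar] by (simp add: C_def cstar_mult)
    have "C ** cstar ?z = cstar ?z ** A"
    proof -
      have "C ** (U ** cstar ?z) ** A = C ** (cstar ?z ** cstar A) ** A" by (simp add: U(2) cstar_mult)
      moreover have "C ** (U ** cstar ?z) ** A = (C ** U) ** cstar ?z ** A" by (simp add: matrix_mul_assoc)
      moreover have "C ** (cstar ?z ** cstar A) ** A = C ** cstar ?z ** (cstar A ** A)" by (simp add: matrix_mul_assoc)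
      ultimately show ?thesis using A(1) U(1) by (simp add: C_def unitary_def)
    qed
    moreover have "cstar ?z *v ax j0 = ax (\<iota> j0)"
      by (simp add: mv_axis column_def zeta0_def vec_eq_iff ax_nth)
    ultimately have Cax: "C *v ax (\<iota> j0) = cstar ?z *v y'"
      using A(2) by (metis matrix_vector_mul_assoc mv_axis)
    have e: "X' [] (?z ** B) = X [] (?z ** C ** B)" for B
      by (simp add: X'_def zC matrix_mul_assoc)
    have "wavg X' c (ax (\<iota> j0)) ?z = wavg X c (ax (\<iota> j0)) (?z ** C)"
      by (simp add: wavg_def haar_avg_def e)
    also have "\<dots> = wavg X c (cstar ?z *v y') ?z"
      unfolding wavg_shift[OF X Cl C] Cax ..
    finally have "wavg X c (cstar ?z *v y') ?z = total X' ?z / CARD('n)"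
      using wavg_coordinates[OF X' n2 \<iota>] by simp
    also have "total X' ?z = total X (?z ** C)" by (simp add: total_def e)
    also have "\<dots> = total X ?z" by (rule total_shift[OF X Cl C])
    finally have 1: "wavg X c (cstar ?z *v y') ?z = \<kappa>" by (simp add: \<kappa>_def)
    have "u = of_real (norm y) *s (cstar ?z *v y')" by (simp only: uy mv_scale[symmetric] yy[symmetric])
    then show ?thesis using 1 by (simp add: wavg_scale)
  qed
  have "x = u + v" by (simp add: u_def v_def vec_eq_iff)
  moreover have "wavg X c (u + v) ?z = wavg X c u ?z + wavg X c v ?z"
  proof (rule wavg_add[OF X Cl unitary_flip[of "- range \<iota>"]])
    show "?z ** flip (- range \<iota>) = ?z"
      by (rule zeta0_fixed[OF unitary_flip]) (auto simp: vec_eq_iff flip_mv ax_nth)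
  qed (auto simp: vec_eq_iff flip_mv u_def v_def)
  ultimately have "wavg X c x ?z = ((norm y)\<^sup>2 + (norm v)\<^sup>2) * \<kappa>"
    by (simp add: Wu Wv distrib_right)
  then show ?thesis by (simp add: nrm \<kappa>_def)
qed

text \<open>The points with \<open>z ** cstar z = mat 1\<close> form one orbit under right
  multiplication. Moving along it rotates the weight vector, and \<open>wavg_unit\<close> gives the
  same value for every unit vector.\<close>

lemma wavg_constant:
  fixes X :: "(complex^'n^'m) list \<Rightarrow> complex^'n^'m \<Rightarrow> real"
  assumes X: "harm_fam X" and n2: "2 \<le> CARD('n)" and mn: "CARD('m) \<le> CARD('n)" and x: "norm x = 1"
  shows "\<exists>\<kappa>. \<forall>z\<in>Cl. wavg X c x z = \<kappa>"
proof -
  obtain \<iota> :: "'m \<Rightarrow> 'n" where \<iota>: "inj \<iota>"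
    using card_le_inj[of "UNIV :: 'm set" "UNIV :: 'n set"] mn by auto
  have Y: "harm_fam (haar_avg X (colw c x))" by (intro hf_avg X n2 continuous_intros)
  have iso: "zeta0 \<iota> ** cstar (zeta0 \<iota>) = mat 1" by (rule zeta0_isometry[OF \<iota>])
  have "haar_avg X (colw c x) [] z = total X (zeta0 \<iota>) / CARD('n)" if "z \<in> Cl" for z
  proof (rule max_principle[OF Y n2 mn _ that])
    fix z :: "complex^'n^'m" assume z: "z \<in> Cl" "z ** cstar z = mat 1"
    obtain U where U: "unitary U" "U ** cstar (zeta0 \<iota>) = cstar z"
      using isometry_transitive[of "cstar (zeta0 \<iota>)" "cstar z"] iso z(2) by auto
    have "z = zeta0 \<iota> ** cstar U" using arg_cong[OF U(2), of cstar] by (simp add: cstar_mult)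
    then have "wavg X c x z = wavg X c (cstar U *v x) (zeta0 \<iota>)"
      using wavg_shift[OF X isometry_Cl[OF iso]] U(1) by simp
    also have "\<dots> = total X (zeta0 \<iota>) / CARD('n)"
      using wavg_unit[OF X n2 \<iota>] unitary_norm_mv U(1) x by (metis unitary_cstar)
    finally show "haar_avg X (colw c x) [] z = total X (zeta0 \<iota>) / CARD('n)" by (simp add: wavg_def)
  qed
  then show ?thesis by (auto simp: wavg_def)
qed

lemma small_in_Cl:
  fixes z :: "complex^'n^'m"
  assumes "norm z \<le> 1" shows "z \<in> Cl"
proof -
  have "norm (cstar z *v w) \<le> norm w" for w
    using norm_mv_le[of "cstar z" w] mult_right_mono[OF assms, of "norm w"] by simp
  then show ?thesis by (simp add: Cl_def)
qed

lemma Lam_const_zero: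
  fixes Y :: "(complex^'n^'m) list \<Rightarrow> complex^'n^'m \<Rightarrow> real"
  assumes Y: "harm_fam Y" and n2: "2 \<le> CARD('n)" and const: "\<And>z. z \<in> Cl \<Longrightarrow> Y [] z = \<kappa>"
  shows "Lam Y 0 v = 0"
proof -
  have "Y [v, v] 0 = 0" for v
  proof -
    define d where "d = 1 / (norm v + 1)"
    have d: "0 < d" by (simp add: d_def add_nonneg_pos)
    have seg: "0 + t *\<^sub>R v \<in> Cl" if "\<bar>t\<bar> < d" for t
    proof (rule small_in_Cl)
      have "norm (0 + t *\<^sub>R v) \<le> \<bar>t\<bar> * (norm v + 1)" by (simp add: distrib_left)
      also have "\<dots> \<le> d * (norm v + 1)" using that by (intro mult_right_mono) auto
      also have "\<dots> = 1" by (simp add: d_def add_nonneg_eq_0_iff)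
      finally show "norm (0 + t *\<^sub>R v) \<le> 1" .
    qed
    have ev: "eventually (\<lambda>s. \<bar>s\<bar> < d) (nhds t)" if "\<bar>t\<bar> < d" for t
      using that by (intro eventually_nhds_in_open[of "{s. \<bar>s\<bar> < d}", simplified] open_Collect_less continuous_intros) auto
    have 1: "Y [v] (0 + t *\<^sub>R v) = 0" if t: "\<bar>t\<bar> < d" for t
    proof -
      have "eventually (\<lambda>s. Y [] (0 + s *\<^sub>R v) = \<kappa>) (nhds t)"
        using ev[OF t] by (rule eventually_mono) (intro const seg)
      then have "((\<lambda>s. Y [] (0 + s *\<^sub>R v)) has_real_derivative 0) (at t)"
        using DERIV_cong_ev[of t t "\<lambda>s. Y [] (0 + s *\<^sub>R v)" "\<lambda>_. \<kappa>" 0 0] by simp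
      then show ?thesis using hf_second_deriv(1)[OF Y n2 seg t] DERIV_unique by blast
    qed
    have "eventually (\<lambda>s. Y [v] (0 + s *\<^sub>R v) = 0) (nhds 0)"
      using ev[of 0] d by (auto elim: eventually_mono simp: 1 simp del: add_0)
    then have "((\<lambda>s. Y [v] (0 + s *\<^sub>R v)) has_real_derivative 0) (at 0)"
      using DERIV_cong_ev[of 0 0 "\<lambda>s. Y [v] (0 + s *\<^sub>R v)" "\<lambda>_. 0" 0 0] by simp
    moreover have "((\<lambda>s. Y [v] (0 + s *\<^sub>R v)) has_real_derivative Y [v, v] (0 + 0 *\<^sub>R v)) (at 0)"
      using hf_second_deriv(2)[OF Y n2 seg, of d 0] d by simp
    ultimately show ?thesis using DERIV_unique by fastforce
  qed
  then show ?thesis by (simp add: Lam_def)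
qed

subsection \<open>Fourth moments\<close>

text \<open>Summing |P + w Q|^4 over the fourth roots of unity w cancels all terms that depend on
  the phase of w.\<close>

lemma fourth_power_sum:
  "((cmod (P + Q))\<^sup>2)\<^sup>2 + ((cmod (P - Q))\<^sup>2)\<^sup>2 + ((cmod (P + \<i> * Q))\<^sup>2)\<^sup>2 + ((cmod (P - \<i> * Q))\<^sup>2)\<^sup>2
   = 4 * ((cmod P)\<^sup>2)\<^sup>2 + 4 * ((cmod Q)\<^sup>2)\<^sup>2 + 16 * ((cmod P)\<^sup>2 * (cmod Q)\<^sup>2)"
proof -
  have "((a + c)\<^sup>2 + (b + d)\<^sup>2)\<^sup>2 + ((a - c)\<^sup>2 + (b - d)\<^sup>2)\<^sup>2 + ((a - d)\<^sup>2 + (b + c)\<^sup>2)\<^sup>2 + ((a + d)\<^sup>2 + (b - c)\<^sup>2)\<^sup>2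
    = 4 * (a\<^sup>2 + b\<^sup>2)\<^sup>2 + 4 * (c\<^sup>2 + d\<^sup>2)\<^sup>2 + 16 * ((a\<^sup>2 + b\<^sup>2) * (c\<^sup>2 + d\<^sup>2))" for a b c d :: real
    by (simp add: power2_eq_square algebra_simps)
  from this[of "Re P" "Re Q" "Im P" "Im Q"] show ?thesis
    by (simp add: cmod_power2)
qed

definition mom :: "'n::finite \<Rightarrow> 'n \<Rightarrow> 'n \<Rightarrow> real" where
  "mom p a c = (LINT B|(haar :: (complex^'n^'n) measure). (cmod (B $ p $ a))\<^sup>2 * (cmod (B $ p $ c))\<^sup>2)"

text \<open>Right invariance, applied to a unitary matrix whose column \<open>a\<close> is
  \<open>x\<close>.\<close>

lemma fourth_moment:
  fixes x :: "complex^'n"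
  assumes "norm x = 1"
  shows "(LINT B|haar. ((cmod ((B *v x) $ p))\<^sup>2)\<^sup>2) = mom p a a"
proof -
  obtain U where U: "unitary U" "column a U = x" using exists_unitary_column[OF assms] by blast
  have "(B ** U) $ p $ a = (B *v x) $ p" for B :: "complex^'n^'n"
    using column_mult[of a B U] U(2) by (simp add: column_def vec_eq_iff)
  then have "(LINT B|haar. ((cmod ((B *v x) $ p))\<^sup>2)\<^sup>2) = (LINT B|haar. ((cmod ((B ** U) $ p $ a))\<^sup>2)\<^sup>2)" by simp
  also have "\<dots> = (LINT B|haar. ((cmod (B $ p $ a))\<^sup>2)\<^sup>2)"
    by (rule haar_right[OF U(1)]) (intro continuous_intros)
  finally show ?thesis by (simp add: mom_def power2_eq_square)
qed

lemma mom_diag_const: "mom p a a = mom p c c"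
  using fourth_moment[of "ax a" p a] fourth_moment[of "ax a" p c] by simp

text \<open>The unit vectors (e_a + w e_c) / sqrt 2 with w a fourth root of unity all have the same
  fourth moment. Summing over w with \<open>fourth_power_sum\<close> gives 16 M = 4 M + 4 M + 16 m
  for M = \<open>mom p a a\<close> and m = \<open>mom p a c\<close>.\<close>

lemma mom_offdiag:
  assumes "a \<noteq> (c::'n::finite)"
  shows "2 * mom p a c = mom p a a"
proof -
  define s :: complex where "s = of_real (1 / sqrt 2)"
  have s2: "(cmod s)\<^sup>2 = 1 / 2" by (simp add: s_def norm_divide power_divide)
  have m: "(LINT B|haar. ((cmod (B $ p $ a + w * B $ p $ c))\<^sup>2)\<^sup>2) = 4 * mom p a a" if w: "cmod w = 1" for w
  proof -
    have "(norm (s *s (ax a + w *s ax c)))\<^sup>2 = 1"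
    proof -
      have "cip (s *s (ax a + w *s ax c)) (s *s (ax a + w *s ax c)) = (s * cnj s) * (1 + w * cnj w)"
        using assms by (simp add: cip_scale_left cip_scale_right cip_add_left cip_add_right cip_ax_ax algebra_simps)
      also have "\<dots> = of_real ((cmod s)\<^sup>2) * (1 + of_real ((cmod w)\<^sup>2))"
        by (simp only: complex_norm_square)
      also have "\<dots> = 1" unfolding s2 w by simp
      finally have "cip (s *s (ax a + w *s ax c)) (s *s (ax a + w *s ax c)) = 1" .
      then show ?thesis unfolding cip_self using of_real_eq_1_iff by blast
    qed
    then have n: "norm (s *s (ax a + w *s ax c)) = 1"
      using power2_eq_iff_nonneg[of "norm (s *s (ax a + w *s ax c))" 1] by simp
    have "(B *v (s *s (ax a + w *s ax c))) $ p = s * (B $ p $ a + w * B $ p $ c)" for B :: "complex^'n^'n"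
      by (simp only: mv_scale matrix_vector_right_distrib mv_axis vector_smult_component vector_add_component)
        (simp add: column_def)
    then have e: "((cmod ((B *v (s *s (ax a + w *s ax c))) $ p))\<^sup>2)\<^sup>2 = 1/4 * ((cmod (B $ p $ a + w * B $ p $ c))\<^sup>2)\<^sup>2" for B :: "complex^'n^'n"
      by (simp only: norm_mult power_mult_distrib s2) (simp add: power2_eq_square)
    have "(LINT B|haar. ((cmod ((B *v (s *s (ax a + w *s ax c))) $ p))\<^sup>2)\<^sup>2)
       = 1/4 * (LINT B|haar. ((cmod (B $ p $ a + w * B $ p $ c))\<^sup>2)\<^sup>2)"
      unfolding e by (rule integral_mult_right_zero)
    then show ?thesis unfolding fourth_moment[OF n, of p a] by linarith
  qed
  have int: "integrable haar (\<lambda>B::complex^'n^'n. ((cmod (B $ p $ a + w * B $ p $ c))\<^sup>2)\<^sup>2)" for w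
    by (intro haar_integrable continuous_intros)
  have int': "integrable haar (\<lambda>B::complex^'n^'n. (cmod (B $ p $ i))\<^sup>2 * (cmod (B $ p $ j))\<^sup>2)" for i j
    by (intro haar_integrable continuous_intros)
  have "16 * mom p a a = (LINT B|haar. ((cmod (B $ p $ a + 1 * B $ p $ c))\<^sup>2)\<^sup>2 + ((cmod (B $ p $ a + (-1) * B $ p $ c))\<^sup>2)\<^sup>2
     + ((cmod (B $ p $ a + \<i> * B $ p $ c))\<^sup>2)\<^sup>2 + ((cmod (B $ p $ a + (-\<i>) * B $ p $ c))\<^sup>2)\<^sup>2)"
    by (subst Bochner_Integration.integral_add, (intro Bochner_Integration.integrable_add int)+,
        subst Bochner_Integration.integral_add, (intro Bochner_Integration.integrable_add int)+,
        subst Bochner_Integration.integral_add, (intro int)+,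
        subst m, simp, subst m, simp, subst m, simp, subst m, simp_all)
  also have "\<dots> = (LINT B|haar. 4 * ((cmod (B $ p $ a))\<^sup>2 * (cmod (B $ p $ a))\<^sup>2) + 4 * ((cmod (B $ p $ c))\<^sup>2 * (cmod (B $ p $ c))\<^sup>2)
      + 16 * ((cmod (B $ p $ a))\<^sup>2 * (cmod (B $ p $ c))\<^sup>2))"
    using fourth_power_sum by (intro Bochner_Integration.integral_cong refl) (simp add: power2_eq_square)
  also have "\<dots> = 4 * mom p a a + 4 * mom p c c + 16 * mom p a c"
  proof -
    have "(LINT B|haar. 4 * f B + 4 * g B + 16 * h B) = 4 * (LINT B|haar. f B) + 4 * (LINT B|haar. g B) + 16 * (LINT B|haar. h B)"
      if "integrable haar f" "integrable haar g" "integrable haar h" for f g h :: "complex^'n^'n \<Rightarrow> real"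
      using that by simp
    from this[OF int' int' int'] show ?thesis unfolding mom_def .
  qed
  finally show ?thesis using mom_diag_const[of p a c] by simp
qed

lemma sum_mom: "(\<Sum>a\<in>UNIV. \<Sum>c\<in>UNIV. mom p a c) = 1"
proof -
  have int': "integrable haar (\<lambda>B::complex^'a^'a. (cmod (B $ p $ i))\<^sup>2 * (cmod (B $ p $ j))\<^sup>2)" for i j
    by (intro haar_integrable continuous_intros)
  have "(\<Sum>a\<in>UNIV. \<Sum>c\<in>UNIV. mom p a c) = (LINT B|(haar :: (complex^'a^'a) measure). (\<Sum>a\<in>UNIV. \<Sum>c\<in>UNIV. (cmod (B $ p $ a))\<^sup>2 * (cmod (B $ p $ c))\<^sup>2))"
    unfolding mom_def
    by (subst Bochner_Integration.integral_sum, (intro Bochner_Integration.integrable_sum int')+,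
        subst Bochner_Integration.integral_sum, (intro int')+) simp
  also have "\<dots> = (LINT B|(haar :: (complex^'a^'a) measure). 1)"
  proof (rule Bochner_Integration.integral_cong[OF refl])
    fix B :: "complex^'a^'a" assume "B \<in> space haar"
    then have "unitary (cstar B)" by (simp add: unitary_UG)
    then have "(norm (column p (cstar B)))\<^sup>2 = 1" by (simp add: unitary_col_norm)
    then have "(\<Sum>a\<in>UNIV. (cmod (B $ p $ a))\<^sup>2) = 1" by (simp add: norm_vec_sq column_def)
    then show "(\<Sum>a\<in>UNIV. \<Sum>c\<in>UNIV. (cmod (B $ p $ a))\<^sup>2 * (cmod (B $ p $ c))\<^sup>2) = 1"
      by (simp flip: sum_product)
  qed
  finally show ?thesis unfolding haar_total .
qed

text \<open>By \<open>mom_offdiag\<close> the moment matrix is \<kappa>/2 times the sum of the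
  identity and the all-ones matrix, which is invertible; \<kappa> is nonzero because the entries add
  up to 1.\<close>

lemma mom_relation_trivial:
  fixes h :: "'n::finite \<Rightarrow> real"
  assumes "\<And>c. (\<Sum>a\<in>UNIV. h a * mom p a c) = 0"
  shows "h c = 0"
proof -
  define \<kappa> where "\<kappa> = mom p p p"
  have d: "mom p a a = \<kappa>" for a unfolding \<kappa>_def by (rule mom_diag_const)
  have m: "mom p a c = \<kappa> / 2 + (if a = c then \<kappa> / 2 else 0)" for a c
    using mom_offdiag[of a c p] d[of a] by auto
  have "\<kappa> \<noteq> 0"
  proof
    assume "\<kappa> = 0"
    then have "mom p a c = 0" for a c by (simp add: m)
    then show False using sum_mom[of p] by simp
  qed
  define T where "T = (\<Sum>a\<in>UNIV. h a)"
  have hT: "h c = - T" for c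
  proof -
    have "(\<Sum>a\<in>UNIV. h a * mom p a c) = \<kappa> / 2 * (T + h c)"
      unfolding m T_def by (simp add: distrib_left sum.distrib sum_distrib_left sum_distrib_right mult_ac
          if_distrib[of "\<lambda>x. _ * x"] cong: if_cong)
    then show ?thesis using assms[of c] \<open>\<kappa> \<noteq> 0\<close> by simp
  qed
  have "sum h UNIV = (\<Sum>a\<in>(UNIV :: 'n set). - T)" by (intro sum.cong refl hT)
  then have "T = - (real CARD('n) * T)" unfolding T_def[symmetric] by simp
  then have "(1 + real CARD('n)) * T = 0" by (simp add: distrib_right)
  then have "T = 0" by (simp add: add_nonneg_eq_0_iff)
  then show ?thesis using hT by simp
qed

subsection \<open>The mixed second derivatives at the center\<close>

text \<open>Separates the dependence on y from that on X, for integration over y. Since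
  \<open>harm_fam\<close> does not state that mixed derivatives commute, both orders appear.\<close>

lemma Lam_expand:
  fixes X :: "(complex^'n^'m) list \<Rightarrow> complex^'n^'m \<Rightarrow> real"
  assumes X: "harm_fam X" and n2: "2 \<le> CARD('n)"
  defines "e \<equiv> \<lambda>j a. tens (ax j) (ax a)"
  shows "Lam X 0 (tens (ax j) y) = (\<Sum>a\<in>UNIV. \<Sum>b\<in>UNIV.
      Re (y $ a * cnj (y $ b)) * (X [e j a, e j b] 0 + X [csm \<i> (e j a), csm \<i> (e j b)] 0)
    + Im (cnj (y $ a) * y $ b) * (X [e j a, csm \<i> (e j b)] 0 - X [csm \<i> (e j a), e j b] 0))"
proof -
  have l1: "linear (\<lambda>v. X [v, w] 0)" for w
    using hf_linear[OF X, of "[]" "[w]" 0] n2 by simp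
  have l2: "linear (\<lambda>w. X [v, w] 0)" for v
    using hf_linear[OF X, of "[v]" "[]" 0] n2 by simp
  define P where "P v = (\<lambda>a. Re (v $ a) *\<^sub>R e j a + Im (v $ a) *\<^sub>R csm \<i> (e j a))" for v :: "complex^'n"
  have exp: "tens (ax j) v = (\<Sum>a\<in>UNIV. P v a)" for v
  proof -
    have "P v a = tens (ax j) ((v $ a) *s ax a)" for a
      by (auto simp: P_def e_def csm_def tens_def vec_eq_iff ax_nth complex_eq_iff)
    moreover have "tens (ax j) v = (\<Sum>a\<in>UNIV. tens (ax j) ((v $ a) *s ax a))"
      by (simp add: tens_def vec_eq_iff ax_nth sum_distrib_left[symmetric] if_distrib[of "\<lambda>x. _ * x"] cong: if_cong)
    ultimately show ?thesis by simp
  qed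
  have bil: "X [tens (ax j) v, tens (ax j) v] 0 = (\<Sum>a\<in>UNIV. \<Sum>b\<in>UNIV. X [P v a, P v b] 0)" for v
    unfolding exp linear_sum[OF l1] linear_sum[OF l2] by (rule sum.swap)
  have P2: "X [P v a, P v b] 0 = Re (v $ a) * Re (v $ b) * X [e j a, e j b] 0 + Re (v $ a) * Im (v $ b) * X [e j a, csm \<i> (e j b)] 0
    + Im (v $ a) * Re (v $ b) * X [csm \<i> (e j a), e j b] 0 + Im (v $ a) * Im (v $ b) * X [csm \<i> (e j a), csm \<i> (e j b)] 0" for v a b
    unfolding P_def by (simp add: linear_add[OF l1] linear_add[OF l2] linear_scale[OF l1] linear_scale[OF l2] algebra_simps)
  have "Lam X 0 (tens (ax j) y) = (\<Sum>a\<in>UNIV. \<Sum>b\<in>UNIV. X [P y a, P y b] 0 + X [P (\<i> *s y) a, P (\<i> *s y) b] 0)"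
    unfolding Lam_def csm_tens_right bil by (simp add: sum.distrib)
  also have "\<dots> = (\<Sum>a\<in>UNIV. \<Sum>b\<in>UNIV.
      Re (y $ a * cnj (y $ b)) * (X [e j a, e j b] 0 + X [csm \<i> (e j a), csm \<i> (e j b)] 0)
    + Im (cnj (y $ a) * y $ b) * (X [e j a, csm \<i> (e j b)] 0 - X [csm \<i> (e j a), e j b] 0))"
    unfolding P2 by (intro sum.cong refl) (simp add: algebra_simps)
  finally show ?thesis .
qed

text \<open>The average with weight \<open>colw c (ax p)\<close> is constant, so its
  \<open>Lam\<close> vanishes at 0. Under the integral this is \<open>Lam X 0\<close> in direction
  \<open>tens (ax j) (B $ p)\<close> against |B_pc|^2, which yields one moment relation for each
  column c.\<close>

lemma hf_Lam_axes:
  fixes X :: "(complex^'n^'m) list \<Rightarrow> complex^'n^'m \<Rightarrow> real"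
  assumes X: "harm_fam X" and n2: "2 \<le> CARD('n)" and mn: "CARD('m) \<le> CARD('n)"
  shows "Lam X 0 (tens (ax j) (ax c0)) = 0"
proof -
  define p :: 'n where "p = undefined"
  define e where "e a = (tens (ax j) (ax a) :: complex^'n^'m)" for a
  define h where "h a = Lam X 0 (e a)" for a
  define F where "F a b = X [e a, e b] 0 + X [csm \<i> (e a), csm \<i> (e b)] 0" for a b
  define G where "G a b = X [e a, csm \<i> (e b)] 0 - X [csm \<i> (e a), e b] 0" for a b
  have hF: "F a a = h a" for a by (simp add: F_def h_def Lam_def)
  have "(\<Sum>a\<in>UNIV. h a * mom p a c) = 0" for c
  proof -
    define q where "q B = (cmod (B $ p $ c))\<^sup>2" for B :: "complex^'n^'n"
    define R where "R a b B = Re (B $ p $ a * cnj (B $ p $ b)) * q B" for a b and B :: "complex^'n^'n"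
    define I where "I a b B = Im (cnj (B $ p $ a) * B $ p $ b) * q B" for a b and B :: "complex^'n^'n"
    have Rc: "continuous_on UG (R a b)" and Ic: "continuous_on UG (I a b)" for a b
      unfolding R_def I_def q_def by (intro continuous_intros)+
    define Y where "Y = haar_avg X (colw c (ax p))"
    have Y: "harm_fam Y" unfolding Y_def by (intro hf_avg X n2 continuous_intros)
    obtain \<kappa> where \<kappa>: "\<forall>z\<in>Cl. wavg X c (ax p) z = \<kappa>"
      using wavg_constant[OF X n2 mn, of "ax p" c] by auto
    have "Lam Y 0 (tens (ax j) (ax p)) = 0"
      by (rule Lam_const_zero[OF Y n2, of \<kappa>]) (use \<kappa> in \<open>simp add: Y_def wavg_def\<close>)
    moreover have "Lam Y 0 (tens (ax j) (ax p)) = (LINT B|haar. Lam X 0 (tens (ax j) (B $ p)) * q B)"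
    proof -
      have q: "colw c (ax p) = q" by (rule ext) (simp add: colw_def q_def cip_axis column_def)
      have i: "integrable haar (\<lambda>B. X (map (\<lambda>v. v ** B) [v, v]) (0 ** B) * q B)" for v
        using hf_avg_integrable[OF X _ zero_in_Cl continuous_on_colw, of "[v, v]" c "ax p"] n2 unfolding q by simp
      have z: "(0 :: complex^'n^'m) ** B = 0" for B :: "complex^'n^'n"
        by (simp add: matrix_matrix_mult_def vec_eq_iff)
      have "(\<lambda>B. Lam X 0 (tens (ax j) (B $ p)) * q B) = (\<lambda>B. X (map (\<lambda>v. v ** B) [tens (ax j) (ax p), tens (ax j) (ax p)]) (0 ** B) * q B
         + X (map (\<lambda>v. v ** B) [csm \<i> (tens (ax j) (ax p)), csm \<i> (tens (ax j) (ax p))]) (0 ** B) * q B)"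
        by (simp add: Lam_def z csm_mult tens_mult vm_ax distrib_right)
      then show ?thesis
        unfolding Y_def Lam_def haar_avg_def q using Bochner_Integration.integral_add[OF i i] by simp
    qed
    moreover have "(\<lambda>B. Lam X 0 (tens (ax j) (B $ p)) * q B) = (\<lambda>B. \<Sum>a\<in>UNIV. \<Sum>b\<in>UNIV. F a b * R a b B + G a b * I a b B)"
    proof -
      have "Lam X 0 (tens (ax j) y) = (\<Sum>a\<in>UNIV. \<Sum>b\<in>UNIV. Re (y $ a * cnj (y $ b)) * F a b + Im (cnj (y $ a) * y $ b) * G a b)" for y
        unfolding Lam_expand[OF X n2] F_def G_def e_def ..
      then show ?thesis
        unfolding R_def I_def by (simp only: sum_distrib_left sum_distrib_right distrib_left distrib_right mult_ac)
    qed
    moreover have "(LINT B|haar. (\<Sum>a\<in>UNIV. \<Sum>b\<in>UNIV. F a b * R a b B + G a b * I a b B))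
      = (\<Sum>a\<in>UNIV. \<Sum>b\<in>UNIV. F a b * (LINT B|haar. R a b B) + G a b * (LINT B|haar. I a b B))"
    proof -
      have iR: "integrable haar (R a b)" and iI: "integrable haar (I a b)" for a b
        using Rc Ic by (auto intro: haar_integrable)
      show ?thesis
        by (subst Bochner_Integration.integral_sum, (intro Bochner_Integration.integrable_sum Bochner_Integration.integrable_add integrable_mult_right iR iI)+,
          subst Bochner_Integration.integral_sum, (intro Bochner_Integration.integrable_add integrable_mult_right iR iI)+)
          (simp add: iR iI)
    qed
    moreover have "(LINT B|haar. R a b B) = (if a = b then mom p a c else 0)" "(LINT B|haar. I a b B) = 0" for a b
    proof -
      \<comment> \<open>Right multiplication by \<open>flip {a}\<close> negates column a: the weight
        is unchanged, while the terms with a \<noteq> b change sign and integrate to 0.\<close>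
      have fl: "(B ** flip {a}) $ p $ i = (if i = a then - B $ p $ i else B $ p $ i)" for i and B :: "complex^'n^'n"
        by (simp add: matrix_matrix_mult_def flip_def if_distrib[of "\<lambda>x. _ * x"] cong: if_cong)
      have q: "q (B ** flip {a}) = q B" for B unfolding q_def fl by simp
      { assume "a \<noteq> b"
        then have "R a b (B ** flip {a}) = - R a b B" "I a b (B ** flip {a}) = - I a b B" for B
          unfolding R_def I_def q fl by (simp_all add: algebra_simps)
        then have "- (LINT B|haar. R a b B) = (LINT B|haar. R a b B)" "- (LINT B|haar. I a b B) = (LINT B|haar. I a b B)"
          using haar_right[OF unitary_flip Rc, of a b "{a}"] haar_right[OF unitary_flip Ic, of a b "{a}"] by simp_all
        then have "(LINT B|haar. R a b B) = 0" "(LINT B|haar. I a b B) = 0" by linarith+ }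
      moreover have "R a a = (\<lambda>B. (cmod (B $ p $ a))\<^sup>2 * (cmod (B $ p $ c))\<^sup>2)" "I a a = (\<lambda>B. 0)"
        by (rule ext, simp only: R_def q_def complex_norm_square[symmetric] Re_complex_of_real)
          (rule ext, simp add: I_def)
      ultimately have "(LINT B|haar. R a b B) = (if a = b then mom p a c else 0) \<and> (LINT B|haar. I a b B) = 0"
        by (cases "a = b") (auto simp: mom_def)
      then show "(LINT B|haar. R a b B) = (if a = b then mom p a c else 0)" "(LINT B|haar. I a b B) = 0"
        by auto
    qed
    ultimately have "(\<Sum>a\<in>UNIV. \<Sum>b\<in>UNIV. F a b * (if a = b then mom p a c else 0)) = 0" by simp
    then show ?thesis by (simp add: if_distrib[of "\<lambda>x. _ * x"] hF cong: if_cong)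
  qed
  from mom_relation_trivial[OF this] show ?thesis by (simp add: h_def e_def)
qed

text \<open>Unitary matrices on both sides carry a pair of axes to any pair of unit vectors and fix
  the center.\<close>

lemma hf_Lam_rank_one:
  fixes X :: "(complex^'n^'m) list \<Rightarrow> complex^'n^'m \<Rightarrow> real"
  assumes X: "harm_fam X" and n2: "2 \<le> CARD('n)" and mn: "CARD('m) \<le> CARD('n)"
    and x: "norm x = 1" and y: "norm y = 1"
  shows "Lam X 0 (tens x y) = 0"
proof -
  define j :: 'm where "j = undefined"
  define c :: 'n where "c = undefined"
  obtain A where A: "unitary A" "column j A = x" using exists_unitary_column[OF x] by blast
  have "norm (vcnj y) = 1" using y by simp
  then obtain B where B: "unitary B" "column c B = vcnj y" using exists_unitary_column by blast
  have "cstar B $ c = y"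
    using B(2) by (simp add: vec_eq_iff column_def vcnj_def)
  then have "A ** tens (ax j) (ax c) ** cstar B = tens x y"
    by (simp add: mult_tens tens_mult mv_axis A(2) vm_ax)
  moreover have "A ** 0 ** cstar B = (0 :: complex^'n^'m)"
    by (simp add: matrix_matrix_mult_def vec_eq_iff)
  ultimately show ?thesis
    using hf_Lam_axes[OF hf_translate[OF X A(1), of "cstar B"] n2 mn, of j c] B(1)
    by (simp add: Lam_def mult_csm csm_mult)
qed

subsection \<open>The domain and its closure\<close>

lemma Imn_iff: "z \<in> Imn \<longleftrightarrow> (\<forall>w. w \<noteq> 0 \<longrightarrow> norm (cstar z *v w) < norm w)" for z :: "complex^'n^'m"
proof -
  let ?A = "mat 1 - z ** cstar z"
  have "cstar ?A = ?A" by (simp add: cstar_diff cstar_mult)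
  then have herm: "?A $ i $ j = cnj (?A $ j $ i)" for i j by (metis cstar_nth)
  have q: "Re (\<Sum>i\<in>UNIV. \<Sum>j\<in>UNIV. cnj (w $ i) * ?A $ i $ j * w $ j) = (norm w)\<^sup>2 - (norm (cstar z *v w))\<^sup>2" for w
  proof -
    have "(\<Sum>i\<in>UNIV. \<Sum>j\<in>UNIV. cnj (w $ i) * ?A $ i $ j * w $ j) = cip w (?A *v w)"
      by (simp only: cip_def matrix_vector_mult_def vec_lambda_beta sum_distrib_left mult.assoc)
    then show ?thesis by (simp only: cip_defect)
  qed
  have sq: "0 < (norm w)\<^sup>2 - (norm (cstar z *v w))\<^sup>2 \<longleftrightarrow> norm (cstar z *v w) < norm w" for w
    using power_strict_mono[of "norm (cstar z *v w)" "norm w" 2] power2_less_imp_less[of "norm (cstar z *v w)" "norm w"] by auto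
  show ?thesis
    unfolding Imn_def mem_Collect_eq pos_def_herm_def q sq using herm by blast
qed

text \<open>By compactness of the unit sphere the strict contraction has a constant M < 1, and a
  perturbation of norm below 1 - M preserves strictness.\<close>

lemma open_Imn: "open (Imn :: (complex^'n^'m) set)"
  unfolding open_dist
proof
  fix z :: "complex^'n^'m" assume z: "z \<in> Imn"
  have ne: "sphere 0 1 \<noteq> ({} :: (complex^'m) set)"
    using norm_axis_unit by (metis dist_0_norm empty_iff mem_sphere)
  have "continuous_on (sphere 0 1) (\<lambda>w. norm (cstar z *v w))"
    unfolding matrix_vector_mult_def by (intro continuous_intros)
  then obtain w0 where w0: "norm w0 = 1" "\<And>w. norm w = 1 \<Longrightarrow> norm (cstar z *v w) \<le> norm (cstar z *v w0)"
    using continuous_attains_sup[OF compact_sphere ne] by (metis dist_0_norm mem_sphere)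
  define M where "M = norm (cstar z *v w0)"
  have "w0 \<noteq> 0" using w0(1) by auto
  then have "norm (cstar z *v w0) < norm w0" using z unfolding Imn_iff by blast
  then have M: "M < 1" by (simp add: M_def w0(1))
  have bound: "norm (cstar z *v w) \<le> M * norm w" for w
  proof (cases "w = 0")
    case False
    have "norm (cstar z *v ((1 / norm w) *\<^sub>R w)) \<le> M"
      unfolding M_def using False by (intro w0(2)) simp
    moreover have "cstar z *v ((1 / norm w) *\<^sub>R w) = (1 / norm w) *\<^sub>R (cstar z *v w)"
      by (simp add: vec_eq_iff matrix_vector_mult_def scaleR_sum_right)
    ultimately show ?thesis using False by (simp add: field_simps)
  qed simp
  show "\<exists>e>0. \<forall>y. dist y z < e \<longrightarrow> y \<in> Imn"
  proof (intro exI[of _ "1 - M"] conjI allI impI)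
    fix y assume y: "dist y z < 1 - M"
    show "y \<in> Imn"
      unfolding Imn_iff
    proof (intro allI impI)
      fix w :: "complex^'m" assume w: "w \<noteq> 0"
      have "cstar y *v w = cstar z *v w + cstar (y - z) *v w"
        by (simp add: cstar_diff matrix_vector_mult_diff_rdistrib)
      also have "norm \<dots> \<le> M * norm w + norm (y - z) * norm w"
        using bound[of w] norm_mv_le[of "cstar (y - z)" w] by (intro norm_triangle_le) simp
      also have "\<dots> < M * norm w + (1 - M) * norm w"
        using y w by (simp add: dist_norm)
      finally show "norm (cstar y *v w) < norm w" by (simp add: algebra_simps)
    qed
  qed (use M in simp)
qed

lemma scale_in_Imn:
  fixes z :: "complex^'n^'m"
  assumes "z \<in> Cl" "0 \<le> \<rho>" "\<rho> < 1"
  shows "\<rho> *\<^sub>R z \<in> Imn"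
  unfolding Imn_iff
proof (intro allI impI)
  fix w :: "complex^'m" assume w: "w \<noteq> 0"
  have "norm (cstar (\<rho> *\<^sub>R z) *v w) = \<rho> * norm (cstar z *v w)"
    using assms by (simp add: cstar_scaleR mv_scaleR)
  also have "\<dots> \<le> \<rho> * norm w" using assms by (intro mult_left_mono) (auto simp: Cl_def)
  also have "\<dots> < norm w" using assms w by simp
  finally show "norm (cstar (\<rho> *\<^sub>R z) *v w) < norm w" .
qed

lemma Imn_subset_Cl: "Imn \<subseteq> (Cl :: (complex^'n^'m) set)"
proof
  fix z :: "complex^'n^'m" assume z: "z \<in> Imn"
  have "norm (cstar z *v w) \<le> norm w" for w
    using z unfolding Imn_iff by (cases "w = 0") (auto simp: less_imp_le)
  then show "z \<in> Cl" by (simp add: Cl_def)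
qed

lemma closure_Imn: "closure Imn = (Cl :: (complex^'n^'m) set)"
proof
  show "closure Imn \<subseteq> (Cl :: (complex^'n^'m) set)"
    using Imn_subset_Cl compact_imp_closed[OF compact_Cl] by (rule closure_minimal)
  show "(Cl :: (complex^'n^'m) set) \<subseteq> closure Imn"
  proof
    fix z :: "complex^'n^'m" assume z: "z \<in> Cl"
    have "(\<lambda>i. 1 / real (Suc i)) \<longlonglongrightarrow> 0" using LIMSEQ_Suc[OF lim_1_over_n[where 'a=real]] by simp
    then have "(\<lambda>i. (1 - 1 / real (Suc i)) *\<^sub>R z) \<longlonglongrightarrow> (1 - 0) *\<^sub>R z"
      by (intro tendsto_scaleR tendsto_diff tendsto_const)
    moreover have "(1 - 1 / real (Suc i)) *\<^sub>R z \<in> Imn" for i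
      using z by (intro scale_in_Imn) auto
    ultimately show "z \<in> closure Imn" unfolding closure_sequential
      by (intro exI[of _ "\<lambda>i. (1 - 1 / real (Suc i)) *\<^sub>R z"]) simp
  qed
qed

text \<open>Density of the domain in the closed ball carries identities between extended derivatives
  to the boundary.\<close>

lemma eq_on_Cl:
  fixes f g :: "complex^'n^'m \<Rightarrow> complex"
  assumes "continuous_on Cl f" "continuous_on Cl g" "\<And>z. z \<in> Imn \<Longrightarrow> f z = g z" "z \<in> Cl"
  shows "f z = g z"
proof -
  have c: "continuous_on (closure Imn) (\<lambda>z. f z - g z)"
    unfolding closure_Imn by (rule continuous_on_diff[OF assms(1,2)])
  have "z \<in> closure Imn" unfolding closure_Imn by (rule assms(4))
  then have "f z - g z = 0"
    by (rule continuous_constant_on_closure[OF c, rotated]) (simp add: assms(3))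
  then show ?thesis by simp
qed

subsection \<open>Symmetry of second derivatives\<close>

text \<open>Schwarz's theorem from derivatives along lines: by the mean value theorem, the second
  difference over a small parallelogram is h^2 times either mixed derivative at some nearby
  point.\<close>

lemma mixed_derivatives_commute:
  fixes f :: "'a::real_normed_vector \<Rightarrow> real"
  assumes S: "open S" "z \<in> S"
    and v: "\<And>y. y \<in> S \<Longrightarrow> ((\<lambda>s. f (y + s *\<^sub>R v)) has_real_derivative fv y) (at 0)"
    and w: "\<And>y. y \<in> S \<Longrightarrow> ((\<lambda>s. f (y + s *\<^sub>R w)) has_real_derivative fw y) (at 0)"
    and vw: "\<And>y. y \<in> S \<Longrightarrow> ((\<lambda>s. fv (y + s *\<^sub>R w)) has_real_derivative fvw y) (at 0)"
    and wv: "\<And>y. y \<in> S \<Longrightarrow> ((\<lambda>s. fw (y + s *\<^sub>R v)) has_real_derivative fwv y) (at 0)"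
    and c: "continuous_on S fvw" "continuous_on S fwv"
  shows "fvw z = fwv z"
proof -
  have shift: "((\<lambda>s. g (y + s *\<^sub>R u)) has_real_derivative g' (y + t *\<^sub>R u)) (at t)"
    if "\<And>y. y \<in> S \<Longrightarrow> ((\<lambda>s. g (y + s *\<^sub>R u)) has_real_derivative g' y) (at 0)" "y + t *\<^sub>R u \<in> S" for g g' u y t
  proof -
    have "((\<lambda>s. g (y + t *\<^sub>R u + s *\<^sub>R u)) has_real_derivative g' (y + t *\<^sub>R u)) (at (t + - t))"
      using that(1)[OF that(2)] by simp
    then have d: "((\<lambda>s. g (y + t *\<^sub>R u + (s + - t) *\<^sub>R u)) has_real_derivative g' (y + t *\<^sub>R u)) (at t)"
      using DERIV_shift[of "\<lambda>s. g (y + t *\<^sub>R u + s *\<^sub>R u)" "g' (y + t *\<^sub>R u)" t "- t"] by simp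
    have e: "y + t *\<^sub>R u + (s + - t) *\<^sub>R u = y + s *\<^sub>R u" for s by (simp add: algebra_simps)
    show ?thesis using d unfolding e .
  qed
  obtain r where r: "r > 0" "ball z r \<subseteq> S" using S by (meson open_contains_ball)
  define K where "K = norm v + norm w + 1"
  have K: "K > 0" by (simp add: K_def add_nonneg_pos)
  have inS: "z + s *\<^sub>R v + t *\<^sub>R w \<in> S" "dist (z + s *\<^sub>R v + t *\<^sub>R w) z \<le> h * K"
    if "0 \<le> s" "s \<le> h" "0 \<le> t" "t \<le> h" "h * K < r" for s t h
  proof -
    have "norm (s *\<^sub>R v + t *\<^sub>R w) \<le> s * norm v + t * norm w"
      using that by (intro norm_triangle_le) simp
    also have "\<dots> \<le> h * norm v + h * norm w" using that by (intro add_mono mult_right_mono) auto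
    also have "\<dots> \<le> h * K" using that by (simp add: K_def distrib_left)
    finally show "dist (z + s *\<^sub>R v + t *\<^sub>R w) z \<le> h * K" by (simp add: dist_norm add.assoc)
    then show "z + s *\<^sub>R v + t *\<^sub>R w \<in> S" using r(2) that(5) by (auto simp: dist_commute)
  qed
  have quad: "\<exists>y1 y2. dist y1 z \<le> h * K \<and> dist y2 z \<le> h * K \<and> fvw y1 = fwv y2" if h: "0 < h" "h * K < r" for h
  proof -
    have mem: "z + a *\<^sub>R v + b *\<^sub>R w \<in> S" "z + b *\<^sub>R w + a *\<^sub>R v \<in> S" if "0 \<le> a" "a \<le> h" "0 \<le> b" "b \<le> h" for a b
      using inS(1)[of a h b] that h by (simp_all add: add_ac)
    have mem0: "z + a *\<^sub>R v \<in> S" "z + a *\<^sub>R w \<in> S" if "0 \<le> a" "a \<le> h" for a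
      using mem[of a 0] mem[of 0 a] that h by simp_all
    have "\<exists>s. 0 < s \<and> s < h \<and> (f (z + h *\<^sub>R w + h *\<^sub>R v) - f (z + h *\<^sub>R v)) - (f (z + h *\<^sub>R w + 0 *\<^sub>R v) - f (z + 0 *\<^sub>R v))
      = (h - 0) * (fv (z + h *\<^sub>R w + s *\<^sub>R v) - fv (z + s *\<^sub>R v))"
      using h mem mem0 by (intro MVT2[where f="\<lambda>s. f (z + h *\<^sub>R w + s *\<^sub>R v) - f (z + s *\<^sub>R v)"] DERIV_diff shift[OF v]) simp_all
    then obtain s where s: "0 < s" "s < h" "f (z + h *\<^sub>R w + h *\<^sub>R v) - f (z + h *\<^sub>R v) - (f (z + h *\<^sub>R w) - f z)
      = h * (fv (z + h *\<^sub>R w + s *\<^sub>R v) - fv (z + s *\<^sub>R v))" by auto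
    have "\<exists>t. 0 < t \<and> t < h \<and> fv ((z + s *\<^sub>R v) + h *\<^sub>R w) - fv ((z + s *\<^sub>R v) + 0 *\<^sub>R w) = (h - 0) * fvw ((z + s *\<^sub>R v) + t *\<^sub>R w)"
      using h s mem by (intro MVT2[where f="\<lambda>t. fv ((z + s *\<^sub>R v) + t *\<^sub>R w)"] shift[OF vw]) simp_all
    then obtain t where t: "0 < t" "t < h" "fv (z + s *\<^sub>R v + h *\<^sub>R w) - fv (z + s *\<^sub>R v) = h * fvw (z + s *\<^sub>R v + t *\<^sub>R w)" by auto
    have "\<exists>s. 0 < s \<and> s < h \<and> (f (z + h *\<^sub>R v + h *\<^sub>R w) - f (z + h *\<^sub>R w)) - (f (z + h *\<^sub>R v + 0 *\<^sub>R w) - f (z + 0 *\<^sub>R w))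
      = (h - 0) * (fw (z + h *\<^sub>R v + s *\<^sub>R w) - fw (z + s *\<^sub>R w))"
      using h mem mem0 by (intro MVT2[where f="\<lambda>s. f (z + h *\<^sub>R v + s *\<^sub>R w) - f (z + s *\<^sub>R w)"] DERIV_diff shift[OF w]) simp_all
    then obtain s' where s': "0 < s'" "s' < h" "f (z + h *\<^sub>R v + h *\<^sub>R w) - f (z + h *\<^sub>R w) - (f (z + h *\<^sub>R v) - f z)
      = h * (fw (z + h *\<^sub>R v + s' *\<^sub>R w) - fw (z + s' *\<^sub>R w))" by auto
    have "\<exists>t. 0 < t \<and> t < h \<and> fw ((z + s' *\<^sub>R w) + h *\<^sub>R v) - fw ((z + s' *\<^sub>R w) + 0 *\<^sub>R v) = (h - 0) * fwv ((z + s' *\<^sub>R w) + t *\<^sub>R v)"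
      using h s' mem by (intro MVT2[where f="\<lambda>t. fw ((z + s' *\<^sub>R w) + t *\<^sub>R v)"] shift[OF wv]) simp_all
    then obtain t' where t': "0 < t'" "t' < h" "fw (z + s' *\<^sub>R w + h *\<^sub>R v) - fw (z + s' *\<^sub>R w) = h * fwv (z + s' *\<^sub>R w + t' *\<^sub>R v)" by auto
    have comm: "z + a *\<^sub>R w + b *\<^sub>R v = z + b *\<^sub>R v + a *\<^sub>R w" for a b by simp
    have "h * (h * fvw (z + s *\<^sub>R v + t *\<^sub>R w)) = h * (h * fwv (z + t' *\<^sub>R v + s' *\<^sub>R w))"
    proof -
      have "f (z + h *\<^sub>R v + h *\<^sub>R w) - f (z + h *\<^sub>R v) - (f (z + h *\<^sub>R w) - f z) = h * (h * fvw (z + s *\<^sub>R v + t *\<^sub>R w))"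
        using s(3) t(3) unfolding comm by simp
      moreover have "f (z + h *\<^sub>R v + h *\<^sub>R w) - f (z + h *\<^sub>R w) - (f (z + h *\<^sub>R v) - f z) = h * (h * fwv (z + t' *\<^sub>R v + s' *\<^sub>R w))"
        using s'(3) t'(3) unfolding comm by simp
      ultimately show ?thesis by linarith
    qed
    then have "fvw (z + s *\<^sub>R v + t *\<^sub>R w) = fwv (z + t' *\<^sub>R v + s' *\<^sub>R w)" using h by simp
    moreover have "dist (z + s *\<^sub>R v + t *\<^sub>R w) z \<le> h * K" "dist (z + t' *\<^sub>R v + s' *\<^sub>R w) z \<le> h * K"
      using s t s' t' h by (auto intro!: inS(2))
    ultimately show ?thesis by blast
  qed
  show ?thesis
  proof (rule ccontr)
    assume ne: "fvw z \<noteq> fwv z"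
    define e where "e = \<bar>fvw z - fwv z\<bar> / 2"
    have e: "e > 0" using ne by (simp add: e_def)
    have "isCont fvw z" "isCont fwv z"
      using c S by (simp_all add: continuous_on_eq_continuous_at)
    then obtain d1 d2 where d: "d1 > 0" "\<And>y. dist y z < d1 \<Longrightarrow> dist (fvw y) (fvw z) < e"
      "d2 > 0" "\<And>y. dist y z < d2 \<Longrightarrow> dist (fwv y) (fwv z) < e"
      using e unfolding continuous_at_eps_delta by metis
    define h where "h = min r (min d1 d2) / (2 * K)"
    have "h * K = min r (min d1 d2) / 2" using K by (simp add: h_def)
    then have h: "0 < h" "h * K < r" "h * K < d1" "h * K < d2"
      using r d K by (auto simp: h_def)
    obtain y1 y2 where y: "dist y1 z \<le> h * K" "dist y2 z \<le> h * K" "fvw y1 = fwv y2" using quad[OF h(1,2)] by blast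
    have "dist (fvw y1) (fvw z) < e" "dist (fwv y2) (fwv z) < e"
      using d(2)[of y1] d(4)[of y2] y h by auto
    moreover have "\<bar>fvw z - fwv z\<bar> \<le> \<bar>fwv y2 - fwv z\<bar> + \<bar>fvw y1 - fvw z\<bar>"
      using abs_triangle_ineq4[of "fwv y2 - fwv z" "fvw y1 - fvw z"] y(3) by simp
    ultimately show False unfolding e_def dist_real_def by simp
  qed
qed

subsection \<open>Hermitian forms\<close>

text \<open>With e' as \<i> times e, v is the combination with complex coefficients c, and v' is
  \<i> v. Rewriting the real form with complex coefficients adds a term \<open>A\<close> that is
  antisymmetric in the indices by symmetry of \<open>B\<close>, so its double sum is 0.\<close>

lemma hermitian_form:
  fixes B :: "'v::real_vector \<Rightarrow> 'v \<Rightarrow> complex" and e e' :: "'i::finite \<Rightarrow> 'v" and c :: "'i \<Rightarrow> complex"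
  assumes l: "\<And>w. linear (\<lambda>v. B v w)" and sym: "\<And>v w. B v w = B w v"
  defines "v \<equiv> \<Sum>J\<in>UNIV. Re (c J) *\<^sub>R e J + Im (c J) *\<^sub>R e' J"
    and "v' \<equiv> \<Sum>J\<in>UNIV. Re (c J) *\<^sub>R e' J - Im (c J) *\<^sub>R e J"
  shows "B v v + B v' v' = (\<Sum>J\<in>UNIV. \<Sum>K\<in>UNIV. c J * cnj (c K) *
    (B (e J) (e K) + B (e' J) (e' K) + \<i> * (B (e J) (e' K) - B (e' J) (e K))))"
proof -
  have l2: "linear (\<lambda>w. B v w)" for v using l[of v] sym by simp
  define P where "P J = Re (c J) *\<^sub>R e J + Im (c J) *\<^sub>R e' J" for J
  define Q where "Q J = Re (c J) *\<^sub>R e' J - Im (c J) *\<^sub>R e J" for J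
  define F where "F J K = B (e J) (e K) + B (e' J) (e' K)" for J K
  define G where "G J K = B (e J) (e' K) - B (e' J) (e K)" for J K
  define A where "A J K = \<i> * (of_real (Re (c J * cnj (c K))) * G J K + of_real (Im (c J * cnj (c K))) * F J K)" for J K
  have bil: "B (\<Sum>J\<in>UNIV. f J) (\<Sum>J\<in>UNIV. f J) = (\<Sum>J\<in>UNIV. \<Sum>K\<in>UNIV. B (f J) (f K))" for f :: "'i \<Rightarrow> 'v"
    unfolding linear_sum[OF l] linear_sum[OF l2] by (rule sum.swap)
  have "B (P J) (P K) + B (Q J) (Q K) = c J * cnj (c K) * (F J K + \<i> * G J K) - A J K" for J K
  proof -
    have e1: "B (P J) (P K) = of_real (Re (c J)) * of_real (Re (c K)) * B (e J) (e K) + of_real (Re (c J)) * of_real (Im (c K)) * B (e J) (e' K)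
      + of_real (Im (c J)) * of_real (Re (c K)) * B (e' J) (e K) + of_real (Im (c J)) * of_real (Im (c K)) * B (e' J) (e' K)"
      unfolding P_def by (simp add: linear_add[OF l] linear_add[OF l2] linear_scale[OF l] linear_scale[OF l2] scaleR_conv_of_real algebra_simps)
    have e2: "B (Q J) (Q K) = of_real (Re (c J)) * of_real (Re (c K)) * B (e' J) (e' K) - of_real (Re (c J)) * of_real (Im (c K)) * B (e' J) (e K)
      - of_real (Im (c J)) * of_real (Re (c K)) * B (e J) (e' K) + of_real (Im (c J)) * of_real (Im (c K)) * B (e J) (e K)"
      unfolding Q_def by (simp add: linear_diff[OF l] linear_diff[OF l2] linear_scale[OF l] linear_scale[OF l2] scaleR_conv_of_real algebra_simps)
    have e3: "c J * cnj (c K) * (F J K + \<i> * G J K) - A J K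
      = of_real (Re (c J * cnj (c K))) * F J K - of_real (Im (c J * cnj (c K))) * G J K"
    proof -
      have "c J * cnj (c K) = of_real (Re (c J * cnj (c K))) + \<i> * of_real (Im (c J * cnj (c K)))" by (rule complex_eq)
      moreover have "(R + \<i> * I) * (f + \<i> * g) - \<i> * (R * g + I * f) = R * f - I * g" for R I f g :: complex
        by (simp add: algebra_simps)
      ultimately show ?thesis unfolding A_def by metis
    qed
    show ?thesis unfolding e3 unfolding e1 e2 F_def G_def by (simp add: algebra_simps)
  qed
  then have "B v v + B v' v' = (\<Sum>J\<in>UNIV. \<Sum>K\<in>UNIV. c J * cnj (c K) * (F J K + \<i> * G J K)) - (\<Sum>J\<in>UNIV. \<Sum>K\<in>UNIV. A J K)"
    unfolding v_def v'_def P_def[symmetric] Q_def[symmetric] bil sum.distrib[symmetric] sum_subtractf[symmetric] by simp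
  moreover have "(\<Sum>J\<in>UNIV. \<Sum>K\<in>UNIV. A J K) = 0"
  proof -
    have "A J K = - A K J" for J K
    proof -
      have "F J K = F K J" "G J K = - G K J" unfolding F_def G_def using sym by auto
      moreover have "Re (c J * cnj (c K)) = Re (c K * cnj (c J))" "Im (c J * cnj (c K)) = - Im (c K * cnj (c J))" by simp_all
      ultimately show ?thesis by (simp only: A_def) (simp add: algebra_simps)
    qed
    then have "(\<Sum>J\<in>UNIV. \<Sum>K\<in>UNIV. A J K) = (\<Sum>J\<in>UNIV. \<Sum>K\<in>UNIV. - A K J)" by (intro sum.cong refl)
    also have "\<dots> = (\<Sum>K\<in>UNIV. \<Sum>J\<in>UNIV. - A K J)" by (rule sum.swap)
    finally show ?thesis by (simp add: sum_negf)
  qed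
  ultimately show ?thesis by (simp add: F_def G_def)
qed

text \<open>Polarization: b(x, y) + b(y, x) = 0, and replacing x by \<i> x gives b(x, y) - b(y, x) =
  0.\<close>

lemma hermitian_form_zero:
  fixes G :: "'i::finite \<Rightarrow> 'i \<Rightarrow> complex"
  assumes "\<And>x :: complex^'i. (\<Sum>j\<in>UNIV. \<Sum>k\<in>UNIV. x $ j * cnj (x $ k) * G j k) = 0"
  shows "G j k = 0"
proof -
  define b where "b x y = (\<Sum>j\<in>UNIV. \<Sum>k\<in>UNIV. x $ j * cnj (y $ k) * G j k)" for x y :: "complex^'i"
  have add: "b (x + y) (x + y) = b x x + b x y + b y x + b y y" for x y
    unfolding b_def sum.distrib[symmetric] by (simp add: algebra_simps)
  have sc: "b (\<i> *s x) y = \<i> * b x y" "b x (\<i> *s y) = - \<i> * b x y" for x y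
    unfolding b_def by (simp_all add: sum_distrib_left mult_ac sum_negf)
  have ax: "b (ax j) (ax k) = G j k" for j k
    unfolding b_def by (simp add: ax_nth if_distrib[of cnj] if_distrib[of "\<lambda>x. x * _"] if_distrib[of "\<lambda>x. _ * x"] cong: if_cong)
  have b0: "b x x = 0" for x using assms by (simp add: b_def)
  have 1: "b x y + b y x = 0" for x y using add[of x y] by (simp add: b0)
  have "b (ax j) (ax k) = 0"
    using 1[of "ax j" "ax k"] 1[of "\<i> *s ax j" "ax k"] by (simp add: sc algebra_simps)
  then show ?thesis by (simp add: ax)
qed

subsection \<open>The harmonic family of an invariant harmonic function\<close>

lemma sum_UNIV_prod: "(\<Sum>J\<in>(UNIV :: ('a::finite \<times> 'b::finite) set). f J) = (\<Sum>j\<in>UNIV. \<Sum>a\<in>UNIV. f (j, a))"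
  by (simp add: sum.cartesian_product)

lemma sum_swap_middle:
  "(\<Sum>j\<in>J. \<Sum>a\<in>A. \<Sum>k\<in>K. \<Sum>b\<in>B. f j a k b) = (\<Sum>j\<in>J. \<Sum>k\<in>K. \<Sum>a\<in>A. \<Sum>b\<in>B. f j a k b)"
  by (intro sum.cong refl sum.swap)

lemma dd_path:
  fixes u :: "complex^'n^'m \<Rightarrow> complex"
  assumes u: "Ck_on N Imn u" and l: "length vs < N" and y: "y \<in> Imn"
  shows "(dd vs u has_derivative (\<lambda>v. dd (v # vs) u y)) (at y)"
  using assms by (simp add: Ck_on_def flip: frechet_derivative_works)

text \<open>For the outermost slot this is linearity of the Frechet derivative. For inner slots, the
  identity holds on the open domain and is preserved by further differentiation.\<close>

lemma dd_linear:
  fixes u :: "complex^'n^'m \<Rightarrow> complex"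
  assumes u: "Ck_on N Imn u" and "length ws + length vs < N" "z \<in> Imn"
  shows "linear (\<lambda>v. dd (ws @ v # vs) u z)"
  using assms(2,3)
proof (induction ws arbitrary: z)
  case Nil
  have "linear (\<lambda>v. dd (v # vs) u z)"
    using dd_path[OF u, of vs z] Nil has_derivative_linear by auto
  then show ?case by simp
next
  case (Cons x ws)
  have IH: "linear (\<lambda>v. dd (ws @ v # vs) u y)" if "y \<in> Imn" for y using Cons that by simp
  have D: "(dd (ws @ v # vs) u has_derivative (\<lambda>x. dd (x # ws @ v # vs) u z)) (at z)" for v
    using Cons.prems by (intro dd_path[OF u]) simp_all
  show ?case
  proof (rule linearI)
    fix v w
    have "((\<lambda>y. dd (ws @ v # vs) u y + dd (ws @ w # vs) u y) has_derivative
        (\<lambda>x. dd (x # ws @ v # vs) u z + dd (x # ws @ w # vs) u z)) (at z)"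
      by (intro has_derivative_add D)
    then have "(dd (ws @ (v + w) # vs) u has_derivative
        (\<lambda>x. dd (x # ws @ v # vs) u z + dd (x # ws @ w # vs) u z)) (at z)"
      by (rule has_derivative_transform_within_open[OF _ open_Imn Cons.prems(2)]) (simp add: linear_add[OF IH])
    from has_derivative_unique[OF D this] show "dd ((x # ws) @ (v + w) # vs) u z = dd ((x # ws) @ v # vs) u z + dd ((x # ws) @ w # vs) u z"
      by (metis append_Cons)
  next
    fix c v
    have "((\<lambda>y. c *\<^sub>R dd (ws @ v # vs) u y) has_derivative (\<lambda>x. c *\<^sub>R dd (x # ws @ v # vs) u z)) (at z)"
      by (intro has_derivative_scaleR_right D)
    then have "(dd (ws @ (c *\<^sub>R v) # vs) u has_derivative (\<lambda>x. c *\<^sub>R dd (x # ws @ v # vs) u z)) (at z)"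
      by (rule has_derivative_transform_within_open[OF _ open_Imn Cons.prems(2)]) (simp add: linear_scale[OF IH])
    from has_derivative_unique[OF D this] show "dd ((x # ws) @ (c *\<^sub>R v) # vs) u z = c *\<^sub>R dd ((x # ws) @ v # vs) u z"
      by (metis append_Cons)
  qed
qed

lemma dd_commute:
  fixes u :: "complex^'n^'m \<Rightarrow> complex"
  assumes u: "Ck_on N Imn u" and N: "2 \<le> N" and z: "z \<in> Imn"
  shows "dd [w, v] u z = dd [v, w] u z"
proof -
  have path: "((\<lambda>s. T (dd vs u (y + s *\<^sub>R x))) has_real_derivative T (dd (x # vs) u y)) (at 0)"
    if "length vs < N" "y \<in> Imn" "bounded_linear T" for T :: "complex \<Rightarrow> real" and vs x y
  proof -
    have lin: "linear (\<lambda>v. dd (v # vs) u y)" using dd_linear[OF u, of "[]" vs y] that by simp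
    have "((\<lambda>s. y + s *\<^sub>R x) has_derivative (\<lambda>h. h *\<^sub>R x)) (at 0)"
      by (auto intro!: derivative_eq_intros)
    moreover have "(dd vs u has_derivative (\<lambda>v. dd (v # vs) u y)) (at (y + 0 *\<^sub>R x))"
      using dd_path[OF u that(1,2)] by simp
    ultimately have "((\<lambda>s. dd vs u (y + s *\<^sub>R x)) has_derivative (\<lambda>h. dd (h *\<^sub>R x # vs) u y)) (at 0)"
      by (rule has_derivative_compose)
    from bounded_linear.has_derivative[OF that(3) this]
    have "((\<lambda>s. T (dd vs u (y + s *\<^sub>R x))) has_derivative (\<lambda>h. T (dd (h *\<^sub>R x # vs) u y))) (at 0)" .
    moreover have "T (dd (h *\<^sub>R x # vs) u y) = T (dd (x # vs) u y) * h" for h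
      by (simp only: linear_scale[OF lin] linear_scale[OF bounded_linear.linear[OF that(3)]]) simp
    ultimately show ?thesis by (simp only: has_field_derivative_def)
  qed
  have cont: "continuous_on Imn (\<lambda>y. T (dd vs u y))" if "length vs \<le> N" "bounded_linear T" for T :: "complex \<Rightarrow> real" and vs
    using u that by (auto simp: Ck_on_def intro: bounded_linear.continuous_on)
  have "T (dd [w, v] u z) = T (dd [v, w] u z)" if T: "bounded_linear T" for T :: "complex \<Rightarrow> real"
    by (rule mixed_derivatives_commute[OF open_Imn z, where f="\<lambda>y. T (dd [] u y)" and v=v and w=w
          and fv="\<lambda>y. T (dd [v] u y)" and fw="\<lambda>y. T (dd [w] u y)"])
      (use N T in \<open>auto intro!: path cont simp del: dd.simps\<close>)
  from this[OF bounded_linear_Re] this[OF bounded_linear_Im] show ?thesis by (simp only: complex_eq_iff)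
qed

lemma Emat_expansion:
  "(\<Sum>j\<in>UNIV. \<Sum>a\<in>UNIV. Re (x $ j * y $ a) *\<^sub>R Emat j a 1 + Im (x $ j * y $ a) *\<^sub>R Emat j a \<i>) = tens x y" (is ?A)
  "(\<Sum>j\<in>UNIV. \<Sum>a\<in>UNIV. Re (x $ j * y $ a) *\<^sub>R Emat j a \<i> - Im (x $ j * y $ a) *\<^sub>R Emat j a 1) = csm \<i> (tens x y)" (is ?B)
proof -
  have *: "(\<Sum>j\<in>UNIV. \<Sum>a\<in>UNIV. f j a) = (v :: complex^'n^'m)"
    if "\<And>j a r s. f j a $ r $ s = (if a = s then if j = r then v $ r $ s else 0 else 0)" for f v
    by (simp add: vec_eq_iff that)
  show ?A by (rule *) (auto simp: Emat_def tens_def complex_eq_iff)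
  show ?B by (rule *) (auto simp: Emat_def tens_def csm_def complex_eq_iff)
qed

text \<open>Each \<open>Xc vs\<close> is a separately chosen continuous extension of
  \<open>dd vs u\<close>; relations between different lists are recovered from the interior.\<close>

locale extension =
  fixes u :: "complex^'n^'m \<Rightarrow> complex" and Xc :: "(complex^'n^'m) list \<Rightarrow> complex^'n^'m \<Rightarrow> complex"
  assumes u: "Ck_on CARD('n) Imn u" and n2: "2 \<le> CARD('n)" and harm: "\<And>z. z \<in> Imn \<Longrightarrow> LB u z = 0"
    and cont: "\<And>vs. length vs \<le> CARD('n) \<Longrightarrow> continuous_on Cl (Xc vs)"
    and ext: "\<And>vs z. length vs \<le> CARD('n) \<Longrightarrow> z \<in> Imn \<Longrightarrow> Xc vs z = dd vs u z"
begin

lemma Xc_linear: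
  assumes l: "length ws + length vs < CARD('n)" and z: "z \<in> Cl"
  shows "linear (\<lambda>v. Xc (ws @ v # vs) z)"
proof (rule linearI)
  have D: "linear (\<lambda>v. Xc (ws @ v # vs) y)" if "y \<in> Imn" for y
    using dd_linear[OF u l that] ext[OF _ that] l by simp
  have c: "continuous_on Cl (Xc (ws @ v # vs))" for v using l by (intro cont) simp
  show "Xc (ws @ (v + w) # vs) z = Xc (ws @ v # vs) z + Xc (ws @ w # vs) z" for v w
    by (rule eq_on_Cl[OF c continuous_on_add[OF c c] linear_add[OF D] z])
  show "Xc (ws @ (r *\<^sub>R v) # vs) z = r *\<^sub>R Xc (ws @ v # vs) z" for r v
    by (rule eq_on_Cl[OF c continuous_on_scaleR[OF continuous_on_const c] linear_scale[OF D] z])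
qed

lemma Xc_commute: "z \<in> Cl \<Longrightarrow> Xc [w, v] z = Xc [v, w] z"
  by (rule eq_on_Cl[OF cont cont]) (use n2 in \<open>auto simp: ext dd_commute[OF u n2, of _ w v] simp del: dd.simps\<close>)

text \<open>The segment may lie wholly in the boundary, where nothing is known about
  \<open>u\<close> itself. Its dilates by \<rho> < 1 lie in the domain; there the derivatives
  converge uniformly as \<rho> tends to 1, so the limit can be differentiated.\<close>

lemma Xc_path:
  fixes T :: "complex \<Rightarrow> real"
  assumes T: "bounded_linear T" and l: "length vs < CARD('n)" and S: "convex S"
    and seg: "\<And>s. s \<in> S \<Longrightarrow> z + s *\<^sub>R v \<in> Cl" and t: "t \<in> S"
  shows "((\<lambda>s. T (Xc vs (z + s *\<^sub>R v))) has_real_derivative T (Xc (v # vs) (z + t *\<^sub>R v))) (at t within S)"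
proof -
  define \<rho> where "\<rho> i = 1 - 1 / real (Suc i)" for i
  have \<rho>: "0 \<le> \<rho> i" "\<rho> i < 1" for i by (simp_all add: \<rho>_def)
  have "(\<lambda>i. 1 / real (Suc i)) \<longlonglongrightarrow> 0" using LIMSEQ_Suc[OF lim_1_over_n[where 'a=real]] by simp
  then have "(\<lambda>i. 1 - 1 / real (Suc i)) \<longlonglongrightarrow> 1 - 0" by (intro tendsto_diff tendsto_const)
  then have \<rho>1: "\<rho> \<longlonglongrightarrow> 1" by (simp add: \<rho>_def[abs_def])
  have star: "r *\<^sub>R y \<in> Cl" if "y \<in> Cl" "0 \<le> r" "r \<le> 1" for r and y :: "complex^'n^'m"
    using scale_in_Imn[OF that(1,2)] Imn_subset_Cl that by (cases "r = 1") auto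
  define f where "f i s = T (Xc vs (\<rho> i *\<^sub>R (z + s *\<^sub>R v)))" for i s
  define f' where "f' i s h = h * (\<rho> i * T (Xc (v # vs) (\<rho> i *\<^sub>R (z + s *\<^sub>R v))))" for i s h
  define g' where "g' s h = h * T (Xc (v # vs) (z + s *\<^sub>R v))" for s h
  have der: "(f i has_derivative f' i s) (at s within S)" if s: "s \<in> S" for i s
  proof -
    let ?y = "\<rho> i *\<^sub>R (z + s *\<^sub>R v)"
    have y: "\<rho> i *\<^sub>R (z + s *\<^sub>R v) \<in> Imn" if "s \<in> S" for s by (intro scale_in_Imn seg \<rho> that)
    have lin: "linear (\<lambda>w. dd (w # vs) u ?y)" using dd_linear[OF u, of "[]" vs ?y] y[OF s] l by simp
    have "((\<lambda>s. \<rho> i *\<^sub>R (z + s *\<^sub>R v)) has_derivative (\<lambda>h. (h * \<rho> i) *\<^sub>R v)) (at s within S)"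
      by (auto intro!: derivative_eq_intros simp: mult.commute)
    then have "((\<lambda>s. dd vs u (\<rho> i *\<^sub>R (z + s *\<^sub>R v))) has_derivative (\<lambda>h. dd ((h * \<rho> i) *\<^sub>R v # vs) u ?y)) (at s within S)"
      by (rule has_derivative_compose) (rule dd_path[OF u l y[OF s]])
    from bounded_linear.has_derivative[OF T this]
    have "((\<lambda>s. T (dd vs u (\<rho> i *\<^sub>R (z + s *\<^sub>R v)))) has_derivative (\<lambda>h. T (dd ((h * \<rho> i) *\<^sub>R v # vs) u ?y))) (at s within S)" .
    moreover have "T (dd ((h * \<rho> i) *\<^sub>R v # vs) u ?y) = f' i s h" for h
    proof -
      have "dd ((h * \<rho> i) *\<^sub>R v # vs) u ?y = (h * \<rho> i) *\<^sub>R dd (v # vs) u ?y" by (rule linear_scale[OF lin])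
      also have "dd (v # vs) u ?y = Xc (v # vs) ?y" using ext[of "v # vs" ?y] y[OF s] l by simp
      finally show ?thesis by (simp only: f'_def linear_scale[OF bounded_linear.linear[OF T]]) simp
    qed
    ultimately have "((\<lambda>s. T (dd vs u (\<rho> i *\<^sub>R (z + s *\<^sub>R v)))) has_derivative f' i s) (at s within S)" by (simp only: eta_contract_eq)
    then show ?thesis
      by (rule has_derivative_transform[OF s, rotated]) (use y ext[of vs] l in \<open>simp add: f_def\<close>)
  qed
  \<comment> \<open>Uniform continuity in the pair of dilation factor and point, on a compact
    product.\<close>
  have unif: "\<forall>\<^sub>F i in sequentially. \<forall>y\<in>Cl. \<bar>\<rho> i * T (Xc (v # vs) (\<rho> i *\<^sub>R y)) - T (Xc (v # vs) y)\<bar> \<le> e" if e: "e > 0" for e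
  proof -
    define k where "k p = fst p * T (Xc (v # vs) (fst p *\<^sub>R snd p))" for p :: "real \<times> (complex^'n^'m)"
    have "continuous_on ({0..1} \<times> Cl) k"
      unfolding k_def using l
      by (intro continuous_intros bounded_linear.continuous_on[OF T] continuous_on_compose2[OF cont[of "v # vs"]])
        (auto intro: star)
    then have "uniformly_continuous_on ({0..1} \<times> Cl) k"
      by (intro compact_uniformly_continuous compact_Times compact_Icc compact_Cl)
    then obtain d where d: "d > 0" "\<And>p q. p \<in> {0..1} \<times> Cl \<Longrightarrow> q \<in> {0..1} \<times> Cl \<Longrightarrow> dist q p < d \<Longrightarrow> dist (k q) (k p) < e"
      unfolding uniformly_continuous_on_def using e by metis
    have "\<forall>\<^sub>F i in sequentially. dist (\<rho> i) 1 < d" using \<rho>1 d(1) by (rule tendstoD)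
    then show ?thesis
    proof (rule eventually_mono, intro ballI)
      fix i and y :: "complex^'n^'m" assume i: "dist (\<rho> i) 1 < d" and y: "y \<in> Cl"
      have "dist (k (\<rho> i, y)) (k (1, y)) < e"
        using i y \<rho>[of i] by (intro d(2)) (auto simp: dist_Pair_Pair)
      then show "\<bar>\<rho> i * T (Xc (v # vs) (\<rho> i *\<^sub>R y)) - T (Xc (v # vs) y)\<bar> \<le> e"
        by (simp add: k_def dist_real_def)
    qed
  qed
  have lim: "(\<lambda>i. f i s) \<longlonglongrightarrow> T (Xc vs (z + s *\<^sub>R v))" if s: "s \<in> S" for s
  proof -
    have "continuous_on Cl (\<lambda>y. T (Xc vs y))" using l by (intro bounded_linear.continuous_on[OF T] cont) simp
    moreover have "(\<lambda>i. \<rho> i *\<^sub>R (z + s *\<^sub>R v)) \<longlonglongrightarrow> 1 *\<^sub>R (z + s *\<^sub>R v)"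
      by (intro tendsto_scaleR \<rho>1 tendsto_const)
    then have "(\<lambda>i. \<rho> i *\<^sub>R (z + s *\<^sub>R v)) \<longlonglongrightarrow> z + s *\<^sub>R v" by simp
    ultimately show ?thesis
      unfolding f_def using seg[OF s] star[OF seg[OF s]] \<rho>
      by (elim continuous_on_tendsto_compose) (auto simp: less_imp_le)
  qed
  have "\<exists>g. \<forall>s\<in>S. (\<lambda>i. f i s) \<longlonglongrightarrow> g s \<and> (g has_derivative g' s) (at s within S)"
  proof (rule has_derivative_sequence[OF S der _ t lim[OF t]])
    fix e :: real assume "e > 0"
    from unif[OF this] show "\<forall>\<^sub>F i in sequentially. \<forall>s\<in>S. \<forall>h. norm (f' i s h - g' s h) \<le> e * norm h"
    proof (rule eventually_mono, intro ballI allI)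
      fix i s h
      assume *: "\<forall>y\<in>Cl. \<bar>\<rho> i * T (Xc (v # vs) (\<rho> i *\<^sub>R y)) - T (Xc (v # vs) y)\<bar> \<le> e" and s: "s \<in> S"
      have "norm (f' i s h - g' s h) = \<bar>\<rho> i * T (Xc (v # vs) (\<rho> i *\<^sub>R (z + s *\<^sub>R v))) - T (Xc (v # vs) (z + s *\<^sub>R v))\<bar> * norm h"
        by (simp add: f'_def g'_def abs_mult[symmetric] right_diff_distrib mult.commute)
      also have "\<dots> \<le> e * norm h" using * seg[OF s] by (intro mult_right_mono) auto
      finally show "norm (f' i s h - g' s h) \<le> e * norm h" .
    qed
  qed
  then obtain g where g: "\<And>s. s \<in> S \<Longrightarrow> (\<lambda>i. f i s) \<longlonglongrightarrow> g s" "\<And>s. s \<in> S \<Longrightarrow> (g has_derivative g' s) (at s within S)" by blast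
  have "g s = T (Xc vs (z + s *\<^sub>R v))" if "s \<in> S" for s
    using LIMSEQ_unique[OF g(1)[OF that] lim[OF that]] .
  then have "((\<lambda>s. T (Xc vs (z + s *\<^sub>R v))) has_derivative g' t) (at t within S)"
    by (intro has_derivative_transform[OF t _ g(2)[OF t]]) simp
  moreover have "g' t = (*) (T (Xc (v # vs) (z + t *\<^sub>R v)))" by (simp add: fun_eq_iff g'_def)
  ultimately show ?thesis by (simp only: has_field_derivative_def)
qed

text \<open>The mixed derivative \<open>wdz j a (wdzbar k b u)\<close>, multiplied out and written
  with the extensions so that it makes sense on the closed ball.\<close>

definition Hc :: "complex^'n^'m \<Rightarrow> 'm \<Rightarrow> 'm \<Rightarrow> 'n \<Rightarrow> 'n \<Rightarrow> complex" where
  "Hc z j k a b = (Xc [Emat j a 1, Emat k b 1] z + Xc [Emat j a \<i>, Emat k b \<i>] z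
     + \<i> * (Xc [Emat j a 1, Emat k b \<i>] z - Xc [Emat j a \<i>, Emat k b 1] z)) / 4"

lemma Hc_interior:
  assumes z: "z \<in> Imn"
  shows "wdz j a (wdzbar k b u) z = Hc z j k a b"
proof -
  have D: "(dd [w] u has_derivative (\<lambda>v. dd [v, w] u z)) (at z)" for w
    using dd_path[OF u, of "[w]" z] z n2 by simp
  have "(wdzbar k b u has_derivative (\<lambda>v. (dd [v, Emat k b 1] u z + \<i> * dd [v, Emat k b \<i>] u z) / 2)) (at z)"
    unfolding wdzbar_def
    by (intro bounded_linear.has_derivative[OF bounded_linear_divide] has_derivative_add has_derivative_mult_right D)
  from frechet_derivative_at[OF this]
  have bar: "dd [v] (wdzbar k b u) z = (dd [v, Emat k b 1] u z + \<i> * dd [v, Emat k b \<i>] u z) / 2" for v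
    by (simp only: dd.simps(2)[of v "[]"] dd.simps(1)) (simp add: fun_eq_iff del: dd.simps)
  have "wdz j a (wdzbar k b u) z = ((dd [Emat j a 1, Emat k b 1] u z + \<i> * dd [Emat j a 1, Emat k b \<i>] u z) / 2
     - \<i> * ((dd [Emat j a \<i>, Emat k b 1] u z + \<i> * dd [Emat j a \<i>, Emat k b \<i>] u z) / 2)) / 2"
    by (simp only: wdz_def bar)
  also have "\<dots> = Hc z j k a b"
    unfolding Hc_def using ext[OF _ z] n2 by (simp add: field_simps del: dd.simps)
  finally show ?thesis .
qed

text \<open>The real Laplacian on a complex line is four times the Levi form;
  \<open>hermitian_form\<close> is applied with index pairs (row, column).\<close>

lemma Lam_complex:
  assumes z: "z \<in> Cl"
  shows "Xc [tens x y, tens x y] z + Xc [csm \<i> (tens x y), csm \<i> (tens x y)] z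
    = 4 * (\<Sum>j\<in>UNIV. \<Sum>k\<in>UNIV. \<Sum>a\<in>UNIV. \<Sum>b\<in>UNIV. (x $ j * cnj (x $ k)) * ((y $ a * cnj (y $ b)) * Hc z j k a b))"
proof -
  define e where "e = (\<lambda>(j, a). Emat j a 1 :: complex^'n^'m)"
  define e' where "e' = (\<lambda>(j, a). Emat j a \<i> :: complex^'n^'m)"
  define c where "c = (\<lambda>(j, a). x $ j * y $ a)"
  have lin: "linear (\<lambda>v. Xc [v, w] z)" for w
    using Xc_linear[of "[]" "[w]" z] n2 z by simp
  have v: "(\<Sum>J\<in>UNIV. Re (c J) *\<^sub>R e J + Im (c J) *\<^sub>R e' J) = tens x y"
    unfolding sum_UNIV_prod c_def e_def e'_def prod.case by (rule Emat_expansion)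
  have v': "(\<Sum>J\<in>UNIV. Re (c J) *\<^sub>R e' J - Im (c J) *\<^sub>R e J) = csm \<i> (tens x y)"
    unfolding sum_UNIV_prod c_def e_def e'_def prod.case by (rule Emat_expansion)
  have "Xc [tens x y, tens x y] z + Xc [csm \<i> (tens x y), csm \<i> (tens x y)] z
    = (\<Sum>J\<in>UNIV. \<Sum>K\<in>UNIV. c J * cnj (c K) * (Xc [e J, e K] z + Xc [e' J, e' K] z + \<i> * (Xc [e J, e' K] z - Xc [e' J, e K] z)))"
    using hermitian_form[where B="\<lambda>v w. Xc [v, w] z" and e=e and e'=e' and c=c, OF lin Xc_commute[OF z]]
    unfolding v v' .
  also have "\<dots> = (\<Sum>j\<in>UNIV. \<Sum>a\<in>UNIV. \<Sum>k\<in>UNIV. \<Sum>b\<in>UNIV. 4 * ((x $ j * cnj (x $ k)) * ((y $ a * cnj (y $ b)) * Hc z j k a b)))"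
  proof -
    have "Xc [Emat j a 1, Emat k b 1] z + Xc [Emat j a \<i>, Emat k b \<i>] z
        + \<i> * (Xc [Emat j a 1, Emat k b \<i>] z - Xc [Emat j a \<i>, Emat k b 1] z) = 4 * Hc z j k a b" for j k a b
      by (simp add: Hc_def)
    then show ?thesis
      unfolding sum_UNIV_prod c_def e_def e'_def prod.case by (intro sum.cong refl) (simp only: complex_cnj_mult mult_ac)
  qed
  also have "\<dots> = 4 * (\<Sum>j\<in>UNIV. \<Sum>k\<in>UNIV. \<Sum>a\<in>UNIV. \<Sum>b\<in>UNIV. (x $ j * cnj (x $ k)) * ((y $ a * cnj (y $ b)) * Hc z j k a b))"
    by (subst sum_swap_middle) (simp only: sum_distrib_left)
  finally show ?thesis .
qed

lemma LB_closure:
  assumes z: "z \<in> Cl"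
  shows "(\<Sum>j\<in>UNIV. \<Sum>k\<in>UNIV. (mat 1 - z ** cstar z) $ j $ k * (\<Sum>a\<in>UNIV. \<Sum>b\<in>UNIV. (mat 1 - cstar z ** z) $ b $ a * Hc z j k a b)) = 0"
proof (rule eq_on_Cl[where g="\<lambda>_. 0", OF _ continuous_on_const _ z])
  have "continuous_on Cl (\<lambda>z. Hc z j k a b)" for j k a b
    unfolding Hc_def using n2 by (intro continuous_intros cont) auto
  then show "continuous_on Cl (\<lambda>z. \<Sum>j\<in>UNIV. \<Sum>k\<in>UNIV. (mat 1 - z ** cstar z) $ j $ k * (\<Sum>a\<in>UNIV. \<Sum>b\<in>UNIV. (mat 1 - cstar z ** z) $ b $ a * Hc z j k a b))"
    by (intro continuous_intros)
next
  fix z :: "complex^'n^'m" assume z: "z \<in> Imn"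
  have P: "(mat 1 - z ** cstar z) $ j $ k = (if j = k then 1 else 0) - (\<Sum>l\<in>UNIV. z $ j $ l * cnj (z $ k $ l))" for j k
    by (simp add: mat_def matrix_matrix_mult_def)
  have Q: "(mat 1 - cstar z ** z) $ b $ a = (if a = b then 1 else 0) - (\<Sum>l\<in>UNIV. z $ l $ a * cnj (z $ l $ b))" for a b
    by (auto simp add: mat_def matrix_matrix_mult_def mult.commute)
  show "(\<Sum>j\<in>UNIV. \<Sum>k\<in>UNIV. (mat 1 - z ** cstar z) $ j $ k * (\<Sum>a\<in>UNIV. \<Sum>b\<in>UNIV. (mat 1 - cstar z ** z) $ b $ a * Hc z j k a b)) = 0"
    using harm[OF z] unfolding LB_def P Q Hc_interior[OF z] .
qed

text \<open>Inserting the rank one decompositions into \<open>LB_closure\<close> and exchanging sums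
  gives the equation for \<open>Lam\<close>. Families are real-valued; \<open>T\<close> will be the
  real and the imaginary part.\<close>

lemma harm_family:
  fixes T :: "complex \<Rightarrow> real"
  assumes T: "bounded_linear T"
  shows "harm_fam (\<lambda>vs z. T (Xc vs z))"
  unfolding harm_fam_def
proof (intro conjI allI impI ballI)
  fix vs :: "(complex^'n^'m) list" assume "length vs \<le> CARD('n)"
  then show "continuous_on Cl (\<lambda>z. T (Xc vs z))" by (intro bounded_linear.continuous_on[OF T] cont)
next
  fix ws vs :: "(complex^'n^'m) list" and z :: "complex^'n^'m" assume "length ws + length vs < CARD('n)" "z \<in> Cl"
  from linear_compose[OF Xc_linear[OF this] bounded_linear.linear[OF T]]
  show "linear (\<lambda>v. T (Xc (ws @ v # vs) z))" by (simp add: o_def)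
next
  fix vs :: "(complex^'n^'m) list" and z v :: "complex^'n^'m" and S t
  assume "length vs < CARD('n)" "convex S" "\<forall>s\<in>S. z + s *\<^sub>R v \<in> Cl" "t \<in> S"
  then show "((\<lambda>s. T (Xc vs (z + s *\<^sub>R v))) has_real_derivative T (Xc (v # vs) (z + t *\<^sub>R v))) (at t within S)"
    by (intro Xc_path[OF T]) auto
next
  fix z :: "complex^'n^'m" and p x q y assume z: "z \<in> Cl" and dec: "decL z p x" "decR z q y"
  define H where "H i l = (\<Sum>j\<in>UNIV. \<Sum>k\<in>UNIV. \<Sum>a\<in>UNIV. \<Sum>b\<in>UNIV. (x i $ j * cnj (x i $ k)) * ((y l $ a * cnj (y l $ b)) * Hc z j k a b))" for i l
  have prod3: "(\<Sum>i\<in>A. f i) * ((\<Sum>l\<in>B. g l) * h) = (\<Sum>i\<in>A. \<Sum>l\<in>B. f i * (g l * h))"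
    for A :: "'m set" and B :: "'n set" and f g and h :: complex
    unfolding sum_distrib_right[of g] sum_product ..
  have "0 = (\<Sum>j\<in>UNIV. \<Sum>k\<in>UNIV. (\<Sum>i\<in>UNIV. of_real (p i) * (x i $ j * cnj (x i $ k)))
      * (\<Sum>a\<in>UNIV. \<Sum>b\<in>UNIV. (\<Sum>l\<in>UNIV. of_real (q l) * (y l $ a * cnj (y l $ b))) * Hc z j k a b))"
    using LB_closure[OF z] dec unfolding decL_def decR_def by (simp only:)
  also have "\<dots> = (\<Sum>j\<in>UNIV. \<Sum>k\<in>UNIV. \<Sum>a\<in>UNIV. \<Sum>b\<in>UNIV. \<Sum>i\<in>UNIV. \<Sum>l\<in>UNIV.
      of_real (p i) * of_real (q l) * ((x i $ j * cnj (x i $ k)) * ((y l $ a * cnj (y l $ b)) * Hc z j k a b)))"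
  proof (intro sum.cong refl)
    fix j k
    have "(\<Sum>i\<in>UNIV. of_real (p i) * (x i $ j * cnj (x i $ k))) * (\<Sum>a\<in>UNIV. \<Sum>b\<in>UNIV. (\<Sum>l\<in>UNIV. of_real (q l) * (y l $ a * cnj (y l $ b))) * Hc z j k a b)
      = (\<Sum>a\<in>UNIV. \<Sum>b\<in>UNIV. (\<Sum>i\<in>UNIV. of_real (p i) * (x i $ j * cnj (x i $ k))) * ((\<Sum>l\<in>UNIV. of_real (q l) * (y l $ a * cnj (y l $ b))) * Hc z j k a b))"
      by (simp only: sum_distrib_left)
    also have "\<dots> = (\<Sum>a\<in>UNIV. \<Sum>b\<in>UNIV. \<Sum>i\<in>UNIV. \<Sum>l\<in>UNIV.
      of_real (p i) * of_real (q l) * ((x i $ j * cnj (x i $ k)) * ((y l $ a * cnj (y l $ b)) * Hc z j k a b)))"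
      by (intro sum.cong refl) (simp only: prod3, simp only: mult_ac)
    finally show "(\<Sum>i\<in>UNIV. of_real (p i) * (x i $ j * cnj (x i $ k))) * (\<Sum>a\<in>UNIV. \<Sum>b\<in>UNIV. (\<Sum>l\<in>UNIV. of_real (q l) * (y l $ a * cnj (y l $ b))) * Hc z j k a b)
      = (\<Sum>a\<in>UNIV. \<Sum>b\<in>UNIV. \<Sum>i\<in>UNIV. \<Sum>l\<in>UNIV.
      of_real (p i) * of_real (q l) * ((x i $ j * cnj (x i $ k)) * ((y l $ a * cnj (y l $ b)) * Hc z j k a b)))" .
  qed
  also have "\<dots> = (\<Sum>i\<in>UNIV. \<Sum>l\<in>UNIV. of_real (p i) * of_real (q l) * H i l)"
  proof -
    have inner: "(\<Sum>a\<in>(UNIV::'n set). \<Sum>b\<in>(UNIV::'n set). \<Sum>i\<in>(UNIV::'m set). \<Sum>l\<in>(UNIV::'n set). f a b i l)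
      = (\<Sum>i\<in>UNIV. \<Sum>l\<in>UNIV. \<Sum>a\<in>UNIV. \<Sum>b\<in>UNIV. f a b i l)" for f :: "'n \<Rightarrow> 'n \<Rightarrow> 'm \<Rightarrow> 'n \<Rightarrow> complex"
    proof -
      have "(\<Sum>a\<in>(UNIV::'n set). \<Sum>b\<in>(UNIV::'n set). \<Sum>i\<in>(UNIV::'m set). \<Sum>l\<in>(UNIV::'n set). f a b i l)
        = (\<Sum>A\<in>(UNIV::('n \<times> 'n) set). \<Sum>I\<in>(UNIV::('m \<times> 'n) set). f (fst A) (snd A) (fst I) (snd I))"
        by (simp add: sum_UNIV_prod)
      also have "\<dots> = (\<Sum>I\<in>(UNIV::('m \<times> 'n) set). \<Sum>A\<in>(UNIV::('n \<times> 'n) set). f (fst A) (snd A) (fst I) (snd I))"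
        by (rule sum.swap)
      finally show ?thesis by (simp add: sum_UNIV_prod)
    qed
    have outer: "(\<Sum>j\<in>(UNIV::'m set). \<Sum>k\<in>(UNIV::'m set). \<Sum>i\<in>(UNIV::'m set). \<Sum>l\<in>(UNIV::'n set). f j k i l)
      = (\<Sum>i\<in>UNIV. \<Sum>l\<in>UNIV. \<Sum>j\<in>UNIV. \<Sum>k\<in>UNIV. f j k i l)" for f :: "'m \<Rightarrow> 'm \<Rightarrow> 'm \<Rightarrow> 'n \<Rightarrow> complex"
    proof -
      have "(\<Sum>j\<in>(UNIV::'m set). \<Sum>k\<in>(UNIV::'m set). \<Sum>i\<in>(UNIV::'m set). \<Sum>l\<in>(UNIV::'n set). f j k i l)
        = (\<Sum>A\<in>(UNIV::('m \<times> 'm) set). \<Sum>I\<in>(UNIV::('m \<times> 'n) set). f (fst A) (snd A) (fst I) (snd I))"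
        by (simp add: sum_UNIV_prod)
      also have "\<dots> = (\<Sum>I\<in>(UNIV::('m \<times> 'n) set). \<Sum>A\<in>(UNIV::('m \<times> 'm) set). f (fst A) (snd A) (fst I) (snd I))"
        by (rule sum.swap)
      finally show ?thesis by (simp add: sum_UNIV_prod)
    qed
    show ?thesis unfolding inner outer H_def by (simp only: sum_distrib_left)
  qed
  finally have H0: "(\<Sum>i\<in>UNIV. \<Sum>l\<in>UNIV. (p i * q l) *\<^sub>R H i l) = 0" by (simp add: scaleR_conv_of_real)
  have "Lam (\<lambda>vs z. T (Xc vs z)) z (tens (x i) (y l)) = T (4 *\<^sub>R H i l)" for i l
  proof -
    have "Lam (\<lambda>vs z. T (Xc vs z)) z (tens (x i) (y l)) = T (Xc [tens (x i) (y l), tens (x i) (y l)] z + Xc [csm \<i> (tens (x i) (y l)), csm \<i> (tens (x i) (y l))] z)"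
      by (simp only: Lam_def linear_add[OF bounded_linear.linear[OF T]])
    then show ?thesis unfolding Lam_complex[OF z] H_def[symmetric] by (simp add: scaleR_conv_of_real)
  qed
  then have "(\<Sum>i\<in>UNIV. \<Sum>l\<in>UNIV. p i * q l * Lam (\<lambda>vs z. T (Xc vs z)) z (tens (x i) (y l)))
     = 4 * T (\<Sum>i\<in>UNIV. \<Sum>l\<in>UNIV. (p i * q l) *\<^sub>R H i l)"
    using bounded_linear.linear[OF T]
    by (simp add: linear_sum linear_scale sum_distrib_left mult_ac)
  then show "(\<Sum>i\<in>UNIV. \<Sum>l\<in>UNIV. p i * q l * Lam (\<lambda>vs z. T (Xc vs z)) z (tens (x i) (y l))) = 0"
    unfolding H0 using linear_0[OF bounded_linear.linear[OF T]] by simp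
qed

text \<open>Vanishing on unit rank one directions extends by homogeneity. The resulting expression
  is Hermitian in x and in y separately, so \<open>hermitian_form_zero\<close> is used once for
  each.\<close>

lemma mixed_second_derivatives_zero:
  assumes mn: "CARD('m) \<le> CARD('n)"
  shows "Hc 0 j k a b = 0"
proof -
  define L where "L v = Xc [v, v] 0 + Xc [csm \<i> v, csm \<i> v] 0" for v
  have L1: "L (tens x y) = 0" if "norm x = 1" "norm y = 1" for x y
  proof -
    have "T (L (tens x y)) = 0" if T: "bounded_linear T" for T :: "complex \<Rightarrow> real"
      using hf_Lam_rank_one[OF harm_family[OF T] n2 mn \<open>norm x = 1\<close> \<open>norm y = 1\<close>]
      by (simp add: Lam_def L_def linear_add[OF bounded_linear.linear[OF T]])
    from this[OF bounded_linear_Re] this[OF bounded_linear_Im] show ?thesis by (simp add: complex_eq_iff)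
  qed
  have lin: "linear (\<lambda>v. Xc [v, w] 0)" "linear (\<lambda>v. Xc [w, v] 0)" for w
    using Xc_linear[of "[]" "[w]" 0] Xc_linear[of "[w]" "[]" 0] n2 by simp_all
  have scale: "L (r *\<^sub>R v) = (r * r) *\<^sub>R L v" for r v
  proof -
    have "csm \<i> (r *\<^sub>R v) = r *\<^sub>R csm \<i> v" by (simp add: csm_def vec_eq_iff)
    then show ?thesis by (simp add: L_def linear_scale[OF lin(1)] linear_scale[OF lin(2)] scaleR_right_distrib)
  qed
  have L0: "L (tens x y) = 0" for x y
  proof (cases "x = 0 \<or> y = 0")
    case True
    then have "tens x y = 0 *\<^sub>R tens x y" by (auto simp: tens_def vec_eq_iff)
    then show ?thesis using scale[of 0 "tens x y"] by simp
  next
    case False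
    have "tens x y = (norm x * norm y) *\<^sub>R tens ((1 / norm x) *\<^sub>R x) ((1 / norm y) *\<^sub>R y)"
      using False by (simp add: tens_def vec_eq_iff)
    then show ?thesis
      using scale[of "norm x * norm y"] L1[of "(1 / norm x) *\<^sub>R x" "(1 / norm y) *\<^sub>R y"] False by simp
  qed
  have "(\<Sum>j\<in>UNIV. \<Sum>k\<in>UNIV. \<Sum>a\<in>UNIV. \<Sum>b\<in>UNIV. (x $ j * cnj (x $ k)) * ((y $ a * cnj (y $ b)) * Hc 0 j k a b)) = 0" for x y
    using L0[of x y] unfolding L_def Lam_complex[OF zero_in_Cl] by (simp only: mult_eq_0_iff) simp
  then have "(\<Sum>j\<in>UNIV. \<Sum>k\<in>UNIV. x $ j * cnj (x $ k) * (\<Sum>a\<in>UNIV. \<Sum>b\<in>UNIV. y $ a * cnj (y $ b) * Hc 0 j k a b)) = 0" for x y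
    by (simp only: sum_distrib_left)
  then have "(\<Sum>a\<in>UNIV. \<Sum>b\<in>UNIV. y $ a * cnj (y $ b) * Hc 0 j k a b) = 0" for y
    by (rule hermitian_form_zero)
  then show ?thesis by (rule hermitian_form_zero)
qed

end

theorem theorem4p3:
  fixes u :: "complex^'n^'m \<Rightarrow> complex"
  assumes "CARD('m) \<le> CARD('n)"
    and "Ck_closure CARD('n) (Imn :: (complex^'n^'m) set) u"
    and "inv_harmonic u"
  shows "\<forall>(j::'m) (k::'m) (a::'n) (b::'n). wdz j a (wdzbar k b u) 0 = 0"
proof (intro allI)
  fix j k :: 'm and a b :: 'n
  have "(0 :: complex^'n^'m) \<in> Imn" using scale_in_Imn[OF zero_in_Cl, of 0] by simp
  show "wdz j a (wdzbar k b u) 0 = 0"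
  proof (cases "2 \<le> CARD('n)")
    case True
    have "\<forall>vs. \<exists>g. length vs \<le> CARD('n) \<longrightarrow> continuous_on (closure Imn) g \<and> (\<forall>z\<in>(Imn :: (complex^'n^'m) set). g z = dd vs u z)"
      using assms(2) unfolding Ck_closure_def by metis
    then obtain Xc where Xc: "\<And>vs. length vs \<le> CARD('n) \<Longrightarrow> continuous_on Cl (Xc vs) \<and> (\<forall>z\<in>(Imn :: (complex^'n^'m) set). Xc vs z = dd vs u z)"
      unfolding closure_Imn by metis
    interpret extension u Xc
      by unfold_locales (use assms True Xc in \<open>auto simp: Ck_closure_def inv_harmonic_def\<close>)
    show ?thesis
      using Hc_interior[OF \<open>0 \<in> Imn\<close>] mixed_second_derivatives_zero[OF assms(1)] by simp
  next
    \<comment> \<open>Here n = m = 1, so second derivatives are not assumed to extend to the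
      closure; but \<open>LB u 0\<close> is then the single mixed derivative itself.\<close>
    case False
    then have "CARD('n) = 1" "CARD('m) = 1"
      using assms(1) zero_less_card_finite[where 'a='n] zero_less_card_finite[where 'a='m] by linarith+
    then have U: "UNIV = {a}" "UNIV = {j}" by (metis UNIV_I card_1_singletonE singletonD)+
    then have "b = a" "k = j" by auto
    moreover have "LB u 0 = 0" using assms(3) \<open>0 \<in> Imn\<close> by (simp add: inv_harmonic_def)
    ultimately show ?thesis unfolding LB_def U by simp
  qed
qed

end
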